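(* Let $g:\mathbb{R}\to\mathbb{R}$ be an odd function and let the observations $X_1,\dots,X_n$ follow the change-point model with fixed jump height $\Delta$ and change-point $k_n^*$ satisfying $k_n^*/(c\sqrt n)\to1$ (see context). Assume that $g(\xi_2-\xi_1)$ has finite second moments, that $\operatorname{Var}(h_1(\xi_1))<\infty$, and that $\sigma^2=E(g_1^2(\xi_1))>0$. Then, as $n\to\infty$, $$\max_{1\le k<n}|G_n^0(k)|\ \xrightarrow{\ \mathcal D\ }\ \sup_{0\le\lambda\le1}\Big|\sigma W^{(0)}(\lambda)+c(1-\lambda)u(\Delta)\Big|.$$
   Context: $(\xi_i)_{i\ge1}$ is an i.i.d. sequence of mean-zero real random variables. For each $n$ the observations are $X_i=\mu+\xi_i$ for $i\le k_n^*$ and $X_i=\mu+\Delta+\xi_i$ for $k_n^*+1\le i\le n$, where $\mu\in\mathbb{R}$ is an unknown constant, $\Delta\neq0$ is a constant not depending on $n$, and $k_n^*\in\{1,\dots,n-1\}$ satisfies $k_n^*/(c\sqrt n)\to1$ for a constant $c>0$. The (unweighted) test statistic is $$G_n^0(k)=\frac{1}{n^{3/2}}\sum_{i=1}^k\sum_{j=k+1}^n g(X_j-X_i),\qquad 1\le k<n.$$ With $\xi,\eta$ independent and distributed as $\xi_1$, define (the expectations being understood to exist) $$g_1(x)=E[g(\xi-x)]-E[g(\xi-\eta)],\qquad u(\Delta)=E[g(\xi-\eta+\Delta)-g(\xi-\eta)],$$ $$h_1(x)=E[g(\xi-x+\Delta)-g(\xi-x)]-u(\Delta).$$ $\{W^{(0)}(\lambda),0\le\lambda\le1\}$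 is a standard Brownian bridge, and $\xrightarrow{\mathcal D}$ denotes convergence in distribution. *)

theory Defs
  imports "HOL-Probability.Probability"
begin

text \<open>Observations of the change-point model with change point \<open>ks\<close>, for a noise sequence \<open>\<xi>\<close> indexed
  from 1.\<close>

definition cp_obs :: "real \<Rightarrow> real \<Rightarrow> nat \<Rightarrow> (nat \<Rightarrow> 'a \<Rightarrow> real) \<Rightarrow> nat \<Rightarrow> 'a \<Rightarrow> real" where
  "cp_obs \<mu> \<Delta> ks \<xi> i \<omega> = (if i \<le> ks then \<mu> + \<xi> i \<omega> else \<mu> + \<Delta> + \<xi> i \<omega>)"

definition G0 :: "(real \<Rightarrow> real) \<Rightarrow> (nat \<Rightarrow> real) \<Rightarrow> nat \<Rightarrow> nat \<Rightarrow> real" where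
  "G0 g x n k = 1 / real n powr (3/2) * (\<Sum>i=1..k. \<Sum>j=k+1..n. g (x j - x i))"

text \<open>Below, \<open>F\<close> is the law of the noise, so that \<open>F \<Otimes>\<^sub>M F\<close> is the joint law of two independent
  copies \<open>(\<xi>, \<eta>)\<close>. An integral over a non-integrable function is 0; when \<open>g(\<xi> - \<eta>)\<close> and
  \<open>g(\<xi> - \<eta> + \<Delta>)\<close> are integrable, the expectations over \<open>\<xi>\<close> alone exist for \<open>F\<close>-almost every \<open>x\<close>.\<close>

definition g1 :: "real measure \<Rightarrow> (real \<Rightarrow> real) \<Rightarrow> real \<Rightarrow> real" where
  "g1 F g x = (\<integral>z. g (z - x) \<partial>F) - (\<integral>(z, y). g (z - y) \<partial>(F \<Otimes>\<^sub>M F))"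

definition u_shift :: "real measure \<Rightarrow> (real \<Rightarrow> real) \<Rightarrow> real \<Rightarrow> real" where
  "u_shift F g \<Delta> = (\<integral>(z, y). g (z - y + \<Delta>) - g (z - y) \<partial>(F \<Otimes>\<^sub>M F))"

definition h1 :: "real measure \<Rightarrow> (real \<Rightarrow> real) \<Rightarrow> real \<Rightarrow> real \<Rightarrow> real" where
  "h1 F g \<Delta> x = (\<integral>z. g (z - x + \<Delta>) - g (z - x) \<partial>F) - u_shift F g \<Delta>"

text \<open>A normally distributed random variable, where variance 0 (a constant almost surely) is allowed.
  This is needed because, for instance, a Brownian bridge vanishes at both end points.\<close>

definition gaussian_rv :: "'b measure \<Rightarrow> ('b \<Rightarrow> real) \<Rightarrow> bool" where
  "gaussian_rv N Y \<longleftrightarrow> Y \<in> borel_measurable N \<and>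
     (\<exists>m s. (s = 0 \<and> (AE \<omega> in N. Y \<omega> = m)) \<or>
            (s > 0 \<and> distributed N lborel Y (\<lambda>x. ennreal (normal_density m s x))))"

text \<open>Standard Brownian bridge on \<open>[0,1]\<close>: a centred Gaussian process with continuous paths and
  covariance \<open>min s t - s t\<close>. All paths, not just almost all of them, are continuous; this makes
  suprema over \<open>[0,1]\<close> measurable on an arbitrary, possibly incomplete, probability space.\<close>

definition std_brownian_bridge :: "'b measure \<Rightarrow> (real \<Rightarrow> 'b \<Rightarrow> real) \<Rightarrow> bool" where
  "std_brownian_bridge N W \<longleftrightarrow>
     prob_space N \<and>
     (\<forall>t\<in>{0..1}. W t \<in> borel_measurable N) \<and>
     (\<forall>\<omega>\<in>space N. continuous_on {0..1} (\<lambda>t. W t \<omega>)) \<and>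
     (\<forall>T a. finite T \<longrightarrow> T \<subseteq> {0..1} \<longrightarrow> gaussian_rv N (\<lambda>\<omega>. \<Sum>t\<in>T. a t * W t \<omega>)) \<and>
     (\<forall>t\<in>{0..1}. (\<integral>\<omega>. W t \<omega> \<partial>N) = 0) \<and>
     (\<forall>s\<in>{0..1}. \<forall>t\<in>{0..1}. (\<integral>\<omega>. W s \<omega> * W t \<omega> \<partial>N) = min s t - s * t)"

end

theory Submission
  imports Defs
begin

text \<open>Write \<open>h(x, y) = g (y - x + \<Delta>) - g (y - x)\<close>, \<open>u = E h(\<xi>\<^sub>1, \<xi>\<^sub>2)\<close>, and let \<open>k*\<close> be the change
  point. In the double sum over \<open>i \<le> k < j\<close>, a pair sees the jump exactly when \<open>i \<le> k* < j\<close>. Since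
  \<open>g\<close> is odd, \<open>E g(\<xi>\<^sub>2 - \<xi>\<^sub>1) = 0\<close> and the projection of \<open>g (y - x)\<close> onto functions of one variable is
  \<open>g\<^sub>1(x) - g\<^sub>1(y)\<close>. With \<open>S\<^sub>k = g\<^sub>1(\<xi>\<^sub>1) + \<dots> + g\<^sub>1(\<xi>\<^sub>k)\<close>, the double sum is therefore the sum of

  \<^item> \<open>n S\<^sub>k - k S\<^sub>n\<close>, a tied-down random walk, which after division by \<open>n\<^sup>3\<^sup>/\<^sup>2\<close> behaves like \<open>\<sigma> W(k/n)\<close>;

  \<^item> \<open>u min(k, k*) (n - max(k, k*))\<close>, which for \<open>k \<ge> k*\<close> contributes \<open>c (1 - k/n) u\<close>, because
    \<open>k*\<close> is of the order \<open>c \<surd>n\<close>;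

  \<^item> the cross sum of the degenerate antisymmetric remainder \<open>g (y - x) - g\<^sub>1(x) + g\<^sub>1(y)\<close>;

  \<^item> the fluctuation of \<open>h(\<xi>\<^sub>i, \<xi>\<^sub>j) - u\<close> over at most \<open>k* n\<close> pairs.

  The last two are \<open>o(n\<^sup>3\<^sup>/\<^sup>2)\<close> in probability, uniformly in \<open>k\<close>. For the cross sums
  (\<open>cross_sums_negligible\<close>), antisymmetry cancels all pairs inside a block, so that an increment over
  a block of length \<open>b\<close> has variance at most \<open>b n\<close> times a constant. A union bound over a grid of mesh
  \<open>b\<close>, and another one over the distances to the grid, then suffice. The fluctuation of \<open>h\<close>
  (\<open>uniform_two_sample_LLN\<close>) obeys a weak law of large numbers: truncate \<open>h\<close>, and use variances on a
  finite grid of rectangles.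

  For \<open>k < k*\<close> the statistic does not follow the limit process near \<open>0\<close>: the drift is still growing
  from \<open>0\<close> to \<open>c u\<close>. This does not affect the maximum, because there the random part is negligible and
  the absolute drift stays below its value at \<open>k*\<close>, which is close to that of the limiting drift at \<open>0\<close>
  (\<open>change_point_max_comparison\<close>).

  There remains the invariance principle for the maximum of a tied-down walk plus a continuous drift
  (\<open>bridge_invariance_principle\<close>). Cut the walk into \<open>L\<close> blocks. The block sums are independent, and by
  the central limit theorem each of them converges; Skorohod couplings of the coordinates turn this into
  convergence of continuous functionals of the whole vector
  (\<open>weak_conv_continuous_functional_of_iid\<close>). The limit vector has the law of the bridge on the grid,
  as both are centred Gaussian with the same covariance (\<open>bridge_grid_law\<close>, through the uniqueness
  part of the Cramer-Wold device). The oscillation inside the blocks is controlled by Ottaviani's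
  inequality, and \<open>L \<rightarrow> \<infinity>\<close> gives the supremum.\<close>

section \<open>Weak convergence by approximation and by independent coordinates\<close>

lemma cts_step_Lipschitz:
  assumes "x < y"
  shows "\<bar>cts_step x y a - cts_step x y b\<bar> \<le> \<bar>a - b\<bar> / (y - x)"
  using assms by (auto simp: cts_step_def abs_if divide_simps)

lemma cts_step_bounds: "x < y \<Longrightarrow> 0 \<le> cts_step x y a" "x < y \<Longrightarrow> cts_step x y a \<le> 1"
  by (auto simp: cts_step_def divide_simps)

lemma cts_step_measurable [measurable]: "cts_step x y \<in> borel_measurable borel"
  unfolding cts_step_def[abs_def] by measurable

lemma isCont_cts_step: "x < y \<Longrightarrow> isCont (cts_step x y) a"
  using uniformly_continuous_imp_continuous[OF cts_step_uniformly_continuous]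
  by (simp add: continuous_on_eq_continuous_at)

text \<open>The functions \<^term>\<open>cts_step x y\<close> determine weak convergence on the line. They are Lipschitz and
  take values in the unit interval, so random variables that are close in probability have close
  expectations.\<close>

lemma (in prob_space) expectation_cts_step_close:
  assumes xy: "x < y" and e: "e > 0"
    and [measurable]: "A \<in> borel_measurable M" "X \<in> borel_measurable M"
  shows "\<bar>expectation (\<lambda>\<omega>. cts_step x y (X \<omega>)) - expectation (\<lambda>\<omega>. cts_step x y (A \<omega>))\<bar>
       \<le> e / (y - x) + prob {\<omega>\<in>space M. e < \<bar>A \<omega> - X \<omega>\<bar>}"
proof -
  let ?f = "cts_step x y" and ?B = "{\<omega>\<in>space M. e < \<bar>A \<omega> - X \<omega>\<bar>}"
  have i: "integrable M (\<lambda>\<omega>. ?f (Z \<omega>))" if "Z \<in> borel_measurable M" for Z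
    using that by (intro integrable_const_bound[of _ 1]) (auto simp: cts_step_bounds xy)
  have "\<bar>expectation (\<lambda>\<omega>. ?f (X \<omega>)) - expectation (\<lambda>\<omega>. ?f (A \<omega>))\<bar>
      = \<bar>expectation (\<lambda>\<omega>. ?f (X \<omega>) - ?f (A \<omega>))\<bar>"
    by (subst Bochner_Integration.integral_diff) (auto intro: i)
  also have "\<dots> \<le> expectation (\<lambda>\<omega>. \<bar>?f (X \<omega>) - ?f (A \<omega>)\<bar>)" by (rule integral_abs_bound)
  also have "\<dots> \<le> expectation (\<lambda>\<omega>. e / (y - x) + indicator ?B \<omega>)"
  proof (rule integral_mono)
    show "integrable M (\<lambda>\<omega>. \<bar>?f (X \<omega>) - ?f (A \<omega>)\<bar>)"
      by (intro integrable_abs Bochner_Integration.integrable_diff i) measurable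
    show "integrable M (\<lambda>\<omega>. e / (y - x) + indicator ?B \<omega>)"
      by (intro Bochner_Integration.integrable_add integrable_const integrable_const_bound[of _ 1]) auto
    fix \<omega> assume w: "\<omega> \<in> space M"
    show "\<bar>?f (X \<omega>) - ?f (A \<omega>)\<bar> \<le> e / (y - x) + indicator ?B \<omega>"
    proof (cases "\<omega> \<in> ?B")
      case True
      have "\<bar>?f (X \<omega>) - ?f (A \<omega>)\<bar> \<le> 1"
        using cts_step_bounds[OF xy, of "X \<omega>"] cts_step_bounds[OF xy, of "A \<omega>"] by linarith
      moreover have "0 \<le> e / (y - x)" using e xy by simp
      ultimately show ?thesis using True by simp
    next
      case False
      then have "\<bar>X \<omega> - A \<omega>\<bar> \<le> e" using w by auto
      then have "\<bar>X \<omega> - A \<omega>\<bar> / (y - x) \<le> e / (y - x)" using xy by (intro divide_right_mono) auto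
      then show ?thesis using False cts_step_Lipschitz[OF xy, of "X \<omega>" "A \<omega>"] by simp
    qed
  qed
  also have "\<dots> = e / (y - x) + prob ?B"
    by (subst Bochner_Integration.integral_add)
       (auto simp: prob_space intro!: integrable_const_bound[of _ 1])
  finally show ?thesis .
qed

text \<open>The usual device for passing from finitely many coordinates to a whole path: \<open>A L n\<close> is an
  approximation of \<open>X n\<close> at resolution \<open>L\<close>, uniformly good for large \<open>n\<close> once \<open>L\<close> is large. When \<open>A L\<close>
  and \<open>B L\<close> do not depend on \<open>L\<close>, this is Slutsky's lemma.\<close>

lemma weak_conv_by_approximation:
  fixes X :: "nat \<Rightarrow> 'a \<Rightarrow> real" and A :: "nat \<Rightarrow> nat \<Rightarrow> 'a \<Rightarrow> real"
    and Y :: "'b \<Rightarrow> real" and B :: "nat \<Rightarrow> 'b \<Rightarrow> real"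
  assumes M: "prob_space M" and N: "prob_space N"
    and X[measurable]: "\<And>n. X n \<in> borel_measurable M"
    and A[measurable]: "\<And>L n. A L n \<in> borel_measurable M"
    and Y[measurable]: "Y \<in> borel_measurable N"
    and B[measurable]: "\<And>L. B L \<in> borel_measurable N"
    and AB: "\<And>L. weak_conv_m (\<lambda>n. distr M borel (A L n)) (distr N borel (B L))"
    and BY: "\<And>\<omega>. \<omega> \<in> space N \<Longrightarrow> (\<lambda>L. B L \<omega>) \<longlonglongrightarrow> Y \<omega>"
    and close: "\<And>e. e > 0 \<Longrightarrow> \<forall>\<^sub>F L in sequentially. \<forall>\<^sub>F n in sequentially.
                  measure M {\<omega>\<in>space M. e < \<bar>A L n \<omega> - X n \<omega>\<bar>} \<le> e"
  shows "weak_conv_m (\<lambda>n. distr M borel (X n)) (distr N borel Y)"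
proof -
  interpret M: prob_space M by fact
  interpret N: prob_space N by fact
  show ?thesis
  proof (rule integral_cts_step_conv_imp_weak_conv)
    show "real_distribution (distr M borel (X n))" for n by (intro M.real_distribution_distr) simp
    show "real_distribution (distr N borel Y)" by (intro N.real_distribution_distr) simp
    fix x y :: real assume xy: "x < y"
    let ?f = "cts_step x y"
    have lim_Y: "(\<lambda>L. N.expectation (\<lambda>\<omega>. ?f (B L \<omega>))) \<longlonglongrightarrow> N.expectation (\<lambda>\<omega>. ?f (Y \<omega>))"
    proof (rule integral_dominated_convergence[where w = "\<lambda>_. 1"])
      show "AE \<omega> in N. (\<lambda>L. ?f (B L \<omega>)) \<longlonglongrightarrow> ?f (Y \<omega>)"
        using isCont_tendsto_compose[OF isCont_cts_step[OF xy] BY] by auto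
      show "AE \<omega> in N. norm (?f (B L \<omega>)) \<le> 1" for L by (simp add: cts_step_bounds xy)
    qed auto
    have lim_B: "(\<lambda>n. M.expectation (\<lambda>\<omega>. ?f (A L n \<omega>))) \<longlonglongrightarrow> N.expectation (\<lambda>\<omega>. ?f (B L \<omega>))" for L
    proof -
      have "(\<lambda>n. integral\<^sup>L (distr M borel (A L n)) ?f) \<longlonglongrightarrow> integral\<^sup>L (distr N borel (B L)) ?f"
        by (rule weak_conv_imp_integral_bdd_continuous_conv[where B = 1])
           (auto intro: M.real_distribution_distr N.real_distribution_distr AB
              simp: isCont_cts_step cts_step_bounds xy)
      then show ?thesis by (simp add: integral_distr)
    qed
    have "(\<lambda>n. M.expectation (\<lambda>\<omega>. ?f (X n \<omega>))) \<longlonglongrightarrow> N.expectation (\<lambda>\<omega>. ?f (Y \<omega>))"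
    proof (rule tendstoI)
      fix r :: real assume r: "r > 0"
      define e where "e = min (r / 6) (r * (y - x) / 6)"
      have e: "e > 0" "e \<le> r / 6" "e / (y - x) \<le> r / 6" 
      proof -
        show "e > 0" "e \<le> r / 6" using r xy by (auto simp: e_def)
        have "e \<le> r / 6 * (y - x)" by (simp add: e_def)
        then show "e / (y - x) \<le> r / 6" using xy by (simp add: pos_divide_le_eq)
      qed
      have "\<forall>\<^sub>F L in sequentially. dist (N.expectation (\<lambda>\<omega>. ?f (B L \<omega>))) (N.expectation (\<lambda>\<omega>. ?f (Y \<omega>))) < r / 3"
        using lim_Y r by (intro tendstoD) auto
      \<comment> \<open>One resolution \<open>L\<close> serves both approximations: that of the limit and that of \<open>X n\<close>.\<close>
      with close[OF e(1)] have "\<forall>\<^sub>F L in sequentially.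
          (\<forall>\<^sub>F n in sequentially. measure M {\<omega>\<in>space M. e < \<bar>A L n \<omega> - X n \<omega>\<bar>} \<le> e) \<and>
          dist (N.expectation (\<lambda>\<omega>. ?f (B L \<omega>))) (N.expectation (\<lambda>\<omega>. ?f (Y \<omega>))) < r / 3"
        by (rule eventually_conj)
      then obtain L where L1: "\<forall>\<^sub>F n in sequentially. measure M {\<omega>\<in>space M. e < \<bar>A L n \<omega> - X n \<omega>\<bar>} \<le> e"
        and L2: "dist (N.expectation (\<lambda>\<omega>. ?f (B L \<omega>))) (N.expectation (\<lambda>\<omega>. ?f (Y \<omega>))) < r / 3"
        unfolding eventually_sequentially by blast
      have "\<forall>\<^sub>F n in sequentially. dist (M.expectation (\<lambda>\<omega>. ?f (A L n \<omega>))) (N.expectation (\<lambda>\<omega>. ?f (B L \<omega>))) < r / 3"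
        using lim_B r by (intro tendstoD) auto
      with L1 show "\<forall>\<^sub>F n in sequentially. dist (M.expectation (\<lambda>\<omega>. ?f (X n \<omega>))) (N.expectation (\<lambda>\<omega>. ?f (Y \<omega>))) < r"
      proof eventually_elim
        case (elim n)
        from M.expectation_cts_step_close[OF xy e(1) A[of L n] X[of n]] elim e L2
        show ?case unfolding dist_real_def by linarith
      qed
    qed
    then show "(\<lambda>n. integral\<^sup>L (distr M borel (X n)) ?f) \<longlonglongrightarrow> integral\<^sup>L (distr N borel Y) ?f"
      by (simp add: integral_distr)
  qed
qed

text \<open>Weak convergence of independent coordinates gives weak convergence of continuous functionals of the
  vector, without any multivariate theory: Skorohod's theorem realises the one-dimensional
  convergence \<open>\<mu> n \<rightarrow> \<nu>\<close> pointwise on a space \<open>\<Omega>\<close>, and the product of copies of \<open>\<Omega>\<close> carries the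
  independent vectors, which then converge pointwise.\<close>

lemma weak_conv_continuous_functional_of_iid:
  fixes Y :: "nat \<Rightarrow> 'i \<Rightarrow> 'a \<Rightarrow> real" and \<mu> :: "nat \<Rightarrow> real measure" and \<nu> :: "real measure"
    and F :: "('i \<Rightarrow> real) \<Rightarrow> real"
  assumes M: "prob_space M" and I: "finite I" "I \<noteq> {}"
    and ind: "\<And>n. prob_space.indep_vars M (\<lambda>_. borel) (Y n) I"
    and law: "\<And>n i. i \<in> I \<Longrightarrow> distr M borel (Y n i) = \<mu> n"
    and \<nu>: "real_distribution \<nu>"
    and conv: "weak_conv_m \<mu> \<nu>"
    and F[measurable]: "F \<in> borel_measurable (PiM I (\<lambda>_. borel))"
    and cont: "\<And>x z. (\<And>i. i \<in> I \<Longrightarrow> (\<lambda>n. x n i) \<longlonglongrightarrow> z i) \<Longrightarrow>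
                  (\<lambda>n. F (restrict (x n) I)) \<longlonglongrightarrow> F (restrict z I)"
  shows "weak_conv_m (\<lambda>n. distr M borel (\<lambda>\<omega>. F (\<lambda>i\<in>I. Y n i \<omega>))) (distr (PiM I (\<lambda>_. \<nu>)) borel F)"
proof -
  interpret M: prob_space M by fact
  have Y[measurable]: "Y n i \<in> borel_measurable M" if "i \<in> I" for n i
    using ind[of n] that by (auto simp: M.indep_vars_def)
  obtain i0 where i0: "i0 \<in> I" using I by auto
  have \<mu>: "real_distribution (\<mu> n)" for n
    using M.real_distribution_distr[OF Y[OF i0, of n]] law[OF i0] by simp
  obtain \<Omega> :: "real measure" and U V where \<Omega>: "prob_space \<Omega>"
    and U[measurable]: "\<And>n. U n \<in> measurable \<Omega> borel" and U_law: "\<And>n. distr \<Omega> borel (U n) = \<mu> n"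
    and V[measurable]: "V \<in> measurable \<Omega> borel" and V_law: "distr \<Omega> borel V = \<nu>"
    and UV: "\<And>x. x \<in> space \<Omega> \<Longrightarrow> (\<lambda>n. U n x) \<longlonglongrightarrow> V x"
    using Skorohod[OF \<mu> \<nu> conv] by (auto simp only: measurable_lborel1 measurable_lborel2) blast?
  interpret \<Omega>: prob_space \<Omega> by fact
  let ?P = "PiM I (\<lambda>_. \<Omega>)"
  have P: "prob_space ?P" by (intro prob_space_PiM \<Omega>)
  interpret P: prob_space ?P by fact
  have prod_law: "distr ?P (PiM I (\<lambda>_. borel)) (compose I h) = PiM I (\<lambda>_. distr \<Omega> borel h)"
    if [measurable]: "h \<in> borel_measurable \<Omega>" for h :: "real \<Rightarrow> real"
  proof -
    let ?D = "\<lambda>_::'i. distr \<Omega> borel h"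
    have "distr ?P (PiM I (\<lambda>_. borel)) (compose I h) = distr ?P (PiM I ?D) (compose I h)"
      by (rule distr_cong) (auto intro!: sets_PiM_cong)
    also have "\<dots> = PiM I (\<lambda>_. distr \<Omega> (distr \<Omega> borel h) h)"
      using I \<Omega> by (intro distr_PiM_finite_prob_space' \<Omega>.prob_space_distr) auto
    also have "(\<lambda>_::'i. distr \<Omega> (distr \<Omega> borel h) h) = ?D"
      by (intro ext distr_cong) auto
    finally show ?thesis .
  qed
  have cm: "compose I h \<in> measurable ?P (PiM I (\<lambda>_. borel))" if [measurable]: "h \<in> borel_measurable \<Omega>" for h :: "real \<Rightarrow> real"
    unfolding compose_def by measurable
  have law_Y: "distr M (PiM I (\<lambda>_. borel)) (\<lambda>\<omega>. \<lambda>i\<in>I. Y n i \<omega>) = PiM I (\<lambda>_. \<mu> n)" for n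
  proof -
    have "distr M (PiM I (\<lambda>_. borel)) (\<lambda>\<omega>. \<lambda>i\<in>I. Y n i \<omega>) = PiM I (\<lambda>i. distr M borel (Y n i))"
      using M.indep_vars_iff_distr_eq_PiM'[of I "Y n" "\<lambda>_. borel"] ind[of n] I by auto
    also have "\<dots> = PiM I (\<lambda>_. \<mu> n)" by (intro PiM_cong) (auto simp: law)
    finally show ?thesis .
  qed
  have E: "distr M borel (\<lambda>\<omega>. F (\<lambda>i\<in>I. Y n i \<omega>)) = distr ?P borel (\<lambda>w. F (compose I (U n) w))" for n
  proof -
    have "distr M borel (\<lambda>\<omega>. F (\<lambda>i\<in>I. Y n i \<omega>)) = distr (distr M (PiM I (\<lambda>_. borel)) (\<lambda>\<omega>. \<lambda>i\<in>I. Y n i \<omega>)) borel F"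
      by (subst distr_distr) (auto simp: o_def)
    also have "\<dots> = distr (distr ?P (PiM I (\<lambda>_. borel)) (compose I (U n))) borel F"
      by (subst law_Y, subst prod_law) (auto simp: U_law)
    also have "\<dots> = distr ?P borel (\<lambda>w. F (compose I (U n) w))"
      by (subst distr_distr) (auto simp: o_def cm)
    finally show ?thesis .
  qed
  have E': "distr (PiM I (\<lambda>_. \<nu>)) borel F = distr ?P borel (\<lambda>w. F (compose I V w))"
  proof -
    have "distr (PiM I (\<lambda>_. \<nu>)) borel F = distr (distr ?P (PiM I (\<lambda>_. borel)) (compose I V)) borel F"
      by (subst prod_law) (auto simp: V_law)
    also have "\<dots> = distr ?P borel (\<lambda>w. F (compose I V w))"
      by (subst distr_distr) (auto simp: o_def cm)
    finally show ?thesis .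
  qed
  have mF: "(\<lambda>w. F (compose I h w)) \<in> borel_measurable ?P" if "h \<in> borel_measurable \<Omega>" for h
    using measurable_compose[OF cm[OF that] F] .
  show ?thesis
    unfolding E E'
  proof (rule integral_bdd_continuous_conv_imp_weak_conv)
    show "real_distribution (distr ?P borel (\<lambda>w. F (compose I (U n) w)))" for n
      by (intro P.real_distribution_distr mF U)
    show "real_distribution (distr ?P borel (\<lambda>w. F (compose I V w)))"
      by (intro P.real_distribution_distr mF V)
    fix f :: "real \<Rightarrow> real" assume f: "\<And>x. isCont f x" "\<And>x. \<bar>f x\<bar> \<le> 1"
    have [measurable]: "f \<in> borel_measurable borel"
      by (intro borel_measurable_continuous_onI continuous_at_imp_continuous_on) (auto simp: f)
    have "(\<lambda>n. P.expectation (\<lambda>w. f (F (compose I (U n) w)))) \<longlonglongrightarrow> P.expectation (\<lambda>w. f (F (compose I V w)))"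
    proof (rule integral_dominated_convergence[where w = "\<lambda>_. 1"])
      have "(\<lambda>n. f (F (compose I (U n) w))) \<longlonglongrightarrow> f (F (compose I V w))" if "w \<in> space ?P" for w
        unfolding compose_def
        by (intro isCont_tendsto_compose[OF f(1)] cont UV) (use that in \<open>auto simp: space_PiM\<close>)
      then show "AE w in ?P. (\<lambda>n. f (F (compose I (U n) w))) \<longlonglongrightarrow> f (F (compose I V w))" by auto
      show "AE w in ?P. norm (f (F (compose I (U n) w))) \<le> 1" for n by (simp add: f)
    qed (auto intro!: measurable_compose[OF mF \<open>f \<in> borel_measurable borel\<close>] U V)
    then show "(\<lambda>n. integral\<^sup>L (distr ?P borel (\<lambda>w. F (compose I (U n) w))) f)
        \<longlonglongrightarrow> integral\<^sup>L (distr ?P borel (\<lambda>w. F (compose I V w))) f"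
      by (simp add: integral_distr mF)
  qed
qed

section \<open>Random vectors are determined by their linear combinations\<close>

lemma real_distribution_weighted:
  fixes w Z :: "'a \<Rightarrow> real"
  assumes M: "prob_space M" and [measurable]: "w \<in> borel_measurable M" "Z \<in> borel_measurable M"
    and w: "\<And>x. 0 \<le> w x" "\<And>x. w x \<le> K"
    and c: "c = (\<integral>x. w x \<partial>M)" "c > 0"
  defines "D \<equiv> distr (density M (\<lambda>x. ennreal (w x / c))) borel Z"
  shows "real_distribution D"
    and "\<And>f::real \<Rightarrow> real. f \<in> borel_measurable borel \<Longrightarrow> (\<integral>z. f z \<partial>D) = (\<integral>x. (w x / c) * f (Z x) \<partial>M)"
proof -
  interpret prob_space M by fact
  have iw: "integrable M w"
    by (intro integrable_const_bound[of _ K]) (auto simp: w)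
  have p: "prob_space (density M (\<lambda>x. ennreal (w x / c)))"
  proof (rule prob_spaceI)
    have "emeasure (density M (\<lambda>x. ennreal (w x / c))) (space M) = (\<integral>\<^sup>+x. ennreal (w x / c) \<partial>M)"
      by (subst emeasure_density) (auto intro!: nn_integral_cong)
    also have "\<dots> = ennreal (\<integral>x. w x / c \<partial>M)"
      using iw w c by (intro nn_integral_eq_integral) auto
    also have "\<dots> = 1" using c by simp
    finally show "emeasure (density M (\<lambda>x. ennreal (w x / c))) (space (density M (\<lambda>x. ennreal (w x / c)))) = 1" by simp
  qed
  then interpret D: prob_space "density M (\<lambda>x. ennreal (w x / c))" .
  show "real_distribution D" unfolding D_def by (rule D.real_distribution_distr) simp
  show "(\<integral>z. f z \<partial>D) = (\<integral>x. (w x / c) * f (Z x) \<partial>M)" if [measurable]: "f \<in> borel_measurable borel" for f :: "real \<Rightarrow> real"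
    unfolding D_def using w c by (subst integral_distr, simp, simp, subst integral_density) auto
qed

text \<open>Uniqueness of characteristic functions for the measure with density \<open>w\<close>. Testing with a shift
  \<open>\<theta>\<close> covers the cosine and the sine part at once and keeps everything real.\<close>

lemma weighted_Levy_uniqueness:
  fixes w Z :: "'a \<Rightarrow> real" and v U :: "'b \<Rightarrow> real"
  assumes M: "prob_space M" and [measurable]: "w \<in> borel_measurable M" "Z \<in> borel_measurable M"
    and N: "prob_space N" and [measurable]: "v \<in> borel_measurable N" "U \<in> borel_measurable N"
    and w: "\<And>x. 0 \<le> w x" "\<And>x. w x \<le> K" and v: "\<And>x. 0 \<le> v x" "\<And>x. v x \<le> K"
    and eq: "\<And>t \<theta>. (\<integral>x. w x * cos (t * Z x + \<theta>) \<partial>M) = (\<integral>x. v x * cos (t * U x + \<theta>) \<partial>N)"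
    and A: "A \<in> sets borel"
  shows "(\<integral>x. w x * indicator A (Z x) \<partial>M) = (\<integral>x. v x * indicator A (U x) \<partial>N)"
proof -
  interpret M: prob_space M by fact
  interpret N: prob_space N by fact
  have iw: "integrable M w" by (intro M.integrable_const_bound[of _ K]) (auto simp: w)
  have iv: "integrable N v" by (intro N.integrable_const_bound[of _ K]) (auto simp: v)
  note A[measurable]
  define c where "c = (\<integral>x. w x \<partial>M)"
  have c': "c = (\<integral>x. v x \<partial>N)" using eq[of 0 0] by (simp add: c_def)
  have c0: "c \<ge> 0" unfolding c_def using w by simp
  show ?thesis
  proof (cases "c = 0")
    case True
    have "AE x in M. w x = 0" using True iw w by (subst (asm) c_def) (simp add: integral_nonneg_eq_0_iff_AE)
    then have 1: "(\<integral>x. w x * indicator A (Z x) \<partial>M) = 0" by (intro integral_eq_zero_AE) auto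
    have "AE x in N. v x = 0" using True iv v by (subst (asm) c') (simp add: integral_nonneg_eq_0_iff_AE)
    then have "(\<integral>x. v x * indicator A (U x) \<partial>N) = 0" by (intro integral_eq_zero_AE) auto
    with 1 show ?thesis by simp
  next
    case False
    then have c: "c > 0" using c0 by simp
    let ?D = "distr (density M (\<lambda>x. ennreal (w x / c))) borel Z"
    let ?E = "distr (density N (\<lambda>x. ennreal (v x / c))) borel U"
    note D = real_distribution_weighted[OF M _ _ w c_def c, of Z, simplified]
    note E = real_distribution_weighted[OF N _ _ v c' c, of U, simplified]
    have ch: "char H t = complex_of_real (\<integral>x. cos (t * x) \<partial>H) + \<i> * complex_of_real (\<integral>x. sin (t * x) \<partial>H)"
      if H: "real_distribution H" for H t
    proof -
      interpret H: real_distribution H by fact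
      have [simp]: "integrable H (\<lambda>x. cos (t * x))" "integrable H (\<lambda>x. sin (t * x))"
        by (auto intro!: H.integrable_const_bound[of _ 1])
      have "char H t = (CLINT x|H. complex_of_real (cos (t * x)) + \<i> * complex_of_real (sin (t * x)))"
        unfolding char_def by (intro Bochner_Integration.integral_cong) (auto simp: Re_exp Im_exp complex_eq_iff)
      also have "\<dots> = (CLINT x|H. complex_of_real (cos (t * x))) + (CLINT x|H. \<i> * complex_of_real (sin (t * x)))"
        by (intro Bochner_Integration.integral_add) auto
      finally show ?thesis by simp
    qed
    have cs: "(\<integral>x. w x * sin (t * Z x) \<partial>M) = (\<integral>x. v x * sin (t * U x) \<partial>N)" for t
      using eq[of t "- pi / 2"] by (simp add: cos_diff)
    have "?D = ?E"
    proof (rule Levy_uniqueness)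
      show "real_distribution ?D" using D by simp
      show "real_distribution ?E" using E by simp
      show "char ?D = char ?E"
      proof
        fix t
        have "(\<integral>x. cos (t * x) \<partial>?D) = (\<integral>x. cos (t * x) \<partial>?E)"
          using D(2)[of "\<lambda>x. cos (t * x)"] E(2)[of "\<lambda>x. cos (t * x)"] eq[of t 0] by simp
        moreover have "(\<integral>x. sin (t * x) \<partial>?D) = (\<integral>x. sin (t * x) \<partial>?E)"
          using D(2)[of "\<lambda>x. sin (t * x)"] E(2)[of "\<lambda>x. sin (t * x)"] cs[of t] by simp
        ultimately show "char ?D t = char ?E t" using D(1) E(1) by (simp add: ch)
      qed
    qed
    then have "(\<integral>x. indicat_real A x \<partial>?D) = (\<integral>x. indicat_real A x \<partial>?E)" by simp
    then show ?thesis using D(2)[of "indicat_real A"] E(2)[of "indicat_real A"] c by simp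
  qed
qed

text \<open>Equal laws of all linear combinations mean equal expectations of \<open>cos (a \<cdot> x + \<theta>)\<close>. Coordinates are
  converted one at a time from such a trigonometric test into an indicator, by one-dimensional
  uniqueness under the weight given by the coordinates already converted and the remaining cosine. As
  a weight has to be nonnegative, \<open>1 + cos\<close> takes the place of \<open>cos\<close>.\<close>

theorem Cramer_Wold_uniqueness:
  fixes P Q :: "('i \<Rightarrow> real) measure"
  assumes I: "finite I" and P: "prob_space P" and Q: "prob_space Q"
    and sP[measurable_cong]: "sets P = sets (PiM I (\<lambda>_. borel))" and sQ[measurable_cong]: "sets Q = sets (PiM I (\<lambda>_. borel))"
    and eq: "\<And>a. distr P borel (\<lambda>x. \<Sum>i\<in>I. a i * x i) = distr Q borel (\<lambda>x. \<Sum>i\<in>I. a i * x i)"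
  shows "P = Q"
proof -
  interpret P: prob_space P by fact
  interpret Q: prob_space Q by fact
  have key: "\<forall>A a \<theta>. (\<forall>j. A j \<in> sets borel) \<longrightarrow>
      (\<integral>x. (\<Prod>j\<in>J. indicator (A j) (x j)) * cos ((\<Sum>i\<in>I. a i * x i) + \<theta>) \<partial>P) =
      (\<integral>x. (\<Prod>j\<in>J. indicator (A j) (x j)) * cos ((\<Sum>i\<in>I. a i * x i) + \<theta>) \<partial>Q)"
    if "J \<subseteq> I" "finite J" for J :: "'i set"
    using that(2,1)
  proof (induction J rule: finite_induct)
    case empty
    show ?case
    proof (intro allI impI)
      fix a :: "'i \<Rightarrow> real" and \<theta> :: real
      have "(\<integral>x. cos (x + \<theta>) \<partial>distr P borel (\<lambda>x. \<Sum>i\<in>I. a i * x i)) = (\<integral>x. cos (x + \<theta>) \<partial>distr Q borel (\<lambda>x. \<Sum>i\<in>I. a i * x i))"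
        by (simp add: eq)
      then show "(\<integral>x. (\<Prod>j\<in>{}. indicator (A j) (x j)) * cos ((\<Sum>i\<in>I. a i * x i) + \<theta>) \<partial>P) =
        (\<integral>x. (\<Prod>j\<in>{}. indicator (A j) (x j)) * cos ((\<Sum>i\<in>I. a i * x i) + \<theta>) \<partial>Q)" for A :: "'i \<Rightarrow> real set"
        by (simp add: integral_distr)
    qed
  next
    case (insert j0 J)
    then have J: "finite J" "J \<subseteq> I" "j0 \<in> I" "j0 \<notin> J" by auto
    show ?case
    proof (intro allI impI)
      fix A :: "'i \<Rightarrow> real set" and a :: "'i \<Rightarrow> real" and \<theta> :: real
      assume A: "\<forall>j. A j \<in> sets borel"
      then have [measurable]: "A j \<in> sets borel" for j by simp
      let ?p = "\<lambda>x. \<Prod>j\<in>J. indicat_real (A j) (x j)" and ?e = "\<lambda>a x. \<Sum>i\<in>I. a i * x i"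
      have p01: "0 \<le> ?p x" "?p x \<le> 1" for x
        by (auto intro!: prod_nonneg prod_le_1)
      have pm: "(\<lambda>x. indicat_real (A j) (x j)) \<in> borel_measurable P" "(\<lambda>x. indicat_real (A j) (x j)) \<in> borel_measurable Q" if "j \<in> I" for j
        using that by measurable
      have [measurable]: "?p \<in> borel_measurable P" "?p \<in> borel_measurable Q"
        using J by (auto intro!: borel_measurable_prod pm)
      have [measurable]: "?e b \<in> borel_measurable P" "?e b \<in> borel_measurable Q" for b
        by measurable
      have [measurable]: "(\<lambda>x. x j0) \<in> borel_measurable P" "(\<lambda>x. x j0) \<in> borel_measurable Q"
        using J by measurable
      have IH: "(\<integral>x. ?p x * cos (?e b x + \<theta>) \<partial>P) = (\<integral>x. ?p x * cos (?e b x + \<theta>) \<partial>Q)" for b \<theta>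
        using insert.IH J A by auto
      have int: "integrable P (\<lambda>x. ?p x * cos (?e b x + \<phi>))" "integrable Q (\<lambda>x. ?p x * cos (?e b x + \<phi>))" for b \<phi>
        using p01 by (auto intro!: P.integrable_const_bound[of _ 1] Q.integrable_const_bound[of _ 1] simp: abs_mult mult_le_one)
      let ?s = "\<lambda>b t i. b i + (if i = j0 then t else 0)"
      have es: "?e (?s b t) x = ?e b x + t * x j0" for b :: "'i \<Rightarrow> real" and t x
      proof -
        have "?e (?s b t) x = (\<Sum>i\<in>I. b i * x i + (if i = j0 then t * x i else 0))"
          by (intro sum.cong refl) (simp add: ring_distribs)
        then show ?thesis using I J by (simp add: sum.distrib)
      qed
      \<comment> \<open>The product of two cosines is a sum of cosines of linear forms, so the induction hypothesis applies.\<close>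
      have split: "?p x * (1 + cos (?e b x + \<phi>)) * cos (t * x j0 + \<psi>)
          = ?p x * cos (?e (?s (\<lambda>_. 0) t) x + \<psi>)
            + (?p x * cos (?e (?s b t) x + (\<phi> + \<psi>)) + ?p x * cos (?e (?s (\<lambda>i. - b i) t) x + (\<psi> - \<phi>))) / 2" for b :: "'i \<Rightarrow> real" and \<phi> t \<psi> x
      proof -
        have c: "cos (S + \<phi>) * cos (T + \<psi>) = (cos (S + T + (\<phi> + \<psi>)) + cos (- S + T + (\<psi> - \<phi>))) / 2" for S T :: real
          using cos_times_cos[of "T + \<psi>" "S + \<phi>"] by (simp add: algebra_simps)
        have *: "p * (1 + cos (S + \<phi>)) * cos (T + \<psi>)
           = p * cos (T + \<psi>) + (p * cos (S + T + (\<phi> + \<psi>)) + p * cos (- S + T + (\<psi> - \<phi>))) / 2" for p S T :: real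
        proof -
          have "p * (1 + cos (S + \<phi>)) * cos (T + \<psi>) = p * cos (T + \<psi>) + p * (cos (S + \<phi>) * cos (T + \<psi>))"
            by (simp add: algebra_simps)
          then show ?thesis unfolding c by (simp add: ring_distribs add_divide_distrib)
        qed
        show ?thesis unfolding es * by (simp add: sum_negf)
      qed
      have wb: "0 \<le> ?p x * (1 + cos (?e b x + \<phi>))" "?p x * (1 + cos (?e b x + \<phi>)) \<le> 2" for b :: "'i \<Rightarrow> real" and \<phi> x
      proof -
        have c: "0 \<le> 1 + cos (?e b x + \<phi>)" "1 + cos (?e b x + \<phi>) \<le> 2"
          using cos_ge_minus_one[of "?e b x + \<phi>"] cos_le_one[of "?e b x + \<phi>"] by linarith+
        show "0 \<le> ?p x * (1 + cos (?e b x + \<phi>))" using p01(1)[of x] c by (intro mult_nonneg_nonneg)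
        have "?p x * (1 + cos (?e b x + \<phi>)) \<le> 1 * 2"
          using p01[of x] c by (intro mult_mono) auto
        then show "?p x * (1 + cos (?e b x + \<phi>)) \<le> 2" by simp
      qed
      have W: "(\<integral>x. (?p x * (1 + cos (?e b x + \<phi>))) * indicator (A j0) (x j0) \<partial>P)
          = (\<integral>x. (?p x * (1 + cos (?e b x + \<phi>))) * indicator (A j0) (x j0) \<partial>Q)" for b \<phi>
      proof (rule weighted_Levy_uniqueness[OF P _ _ Q, where K = 2])
        show "0 \<le> ?p x * (1 + cos (?e b x + \<phi>))" "?p x * (1 + cos (?e b x + \<phi>)) \<le> 2"
          "0 \<le> ?p x * (1 + cos (?e b x + \<phi>))" "?p x * (1 + cos (?e b x + \<phi>)) \<le> 2" for x
          by (rule wb)+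
        fix t \<psi>
        show "(\<integral>x. ?p x * (1 + cos (?e b x + \<phi>)) * cos (t * x j0 + \<psi>) \<partial>P) = (\<integral>x. ?p x * (1 + cos (?e b x + \<phi>)) * cos (t * x j0 + \<psi>) \<partial>Q)"
          unfolding split
          by (simp only: Bochner_Integration.integral_add Bochner_Integration.integrable_add integrable_divide_zero integral_divide_zero int IH)
      qed auto
      have int2: "integrable P (\<lambda>x. ?p x * (1 + cos (?e b x + \<phi>)) * indicator (A j0) (x j0))"
         "integrable Q (\<lambda>x. ?p x * (1 + cos (?e b x + \<phi>)) * indicator (A j0) (x j0))" for b \<phi>
      proof -
        have "\<bar>?p x * (1 + cos (?e b x + \<phi>)) * indicator (A j0) (x j0)\<bar> \<le> 2" for x
          using wb[of x b \<phi>] by (cases "x j0 \<in> A j0") auto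
        then show "integrable P (\<lambda>x. ?p x * (1 + cos (?e b x + \<phi>)) * indicator (A j0) (x j0))"
         "integrable Q (\<lambda>x. ?p x * (1 + cos (?e b x + \<phi>)) * indicator (A j0) (x j0))"
          by (auto intro!: P.integrable_const_bound[of _ 2] Q.integrable_const_bound[of _ 2])
      qed
      \<comment> \<open>The weight \<open>1 + cos 0 = 2\<close> yields the term that has to be subtracted to pass from \<open>1 + cos\<close> to \<open>cos\<close>.\<close>
      have d: "(\<Prod>j\<in>insert j0 J. indicator (A j) (x j)) * cos (?e a x + \<theta>)
          = ?p x * (1 + cos (?e a x + \<theta>)) * indicator (A j0) (x j0) - (?p x * (1 + cos (?e (\<lambda>_. 0) x + 0)) * indicator (A j0) (x j0)) / 2" for x
        using J by (simp add: algebra_simps)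
      show "(\<integral>x. (\<Prod>j\<in>insert j0 J. indicator (A j) (x j)) * cos (?e a x + \<theta>) \<partial>P) =
            (\<integral>x. (\<Prod>j\<in>insert j0 J. indicator (A j) (x j)) * cos (?e a x + \<theta>) \<partial>Q)"
        unfolding d
        by (simp only: Bochner_Integration.integral_diff integrable_divide_zero integral_divide_zero int2 W)
    qed
  qed
  show ?thesis
  proof (rule measure_eqI_PiM_finite[OF I sP sQ])
    fix A :: "'i \<Rightarrow> real set" assume A: "\<And>i. i \<in> I \<Longrightarrow> A i \<in> sets borel"
    define A' where "A' i = (if i \<in> I then A i else {})" for i
    have A': "\<forall>j. A' j \<in> sets borel" by (auto simp: A'_def A)
    have "(\<Prod>j\<in>I. indicat_real (A' j) (x j)) = indicat_real (PiE I A) x" if "x \<in> PiE I (\<lambda>_. UNIV)" for x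
      using that I by (auto simp: indicator_def A'_def PiE_iff prod_zero_iff)
    then have i: "(\<integral>x. (\<Prod>j\<in>I. indicat_real (A' j) (x j)) \<partial>R) = measure R (PiE I A)"
       if R: "prob_space R" "sets R = sets (PiM I (\<lambda>_. borel))" for R
    proof -
      have sp: "space R = PiE I (\<lambda>_. UNIV)" using sets_eq_imp_space_eq[OF R(2)] by (simp add: space_PiM)
      have "(\<integral>x. (\<Prod>j\<in>I. indicat_real (A' j) (x j)) \<partial>R) = (\<integral>x. indicat_real (PiE I A) x \<partial>R)"
        by (intro Bochner_Integration.integral_cong refl \<open>\<And>x. x \<in> PiE I (\<lambda>_. UNIV) \<Longrightarrow> _ x = _\<close>) (simp add: sp)
      also have "\<dots> = measure R (PiE I A \<inter> space R)" by simp
      also have "PiE I A \<inter> space R = PiE I A" by (auto simp: sp)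
      finally show ?thesis .
    qed
    have "measure P (PiE I A) = measure Q (PiE I A)"
      using key[rule_format, OF order_refl I, of A' "\<lambda>_. 0" 0] A' by (simp add: i P Q sP sQ)
    then show "emeasure P (PiE I A) = emeasure Q (PiE I A)"
      by (simp add: P.emeasure_eq_measure Q.emeasure_eq_measure)
  next
    show "range (\<lambda>_. PiE I (\<lambda>_. UNIV)) \<subseteq> prod_algebra I (\<lambda>_. borel :: real measure)"
      using I prod_algebraI_finite[of I "\<lambda>_. UNIV" "\<lambda>_. borel :: real measure"] by auto
    show "(\<Union>i::nat. PiE I (\<lambda>_. UNIV)) = space (PiM I (\<lambda>_. borel :: real measure))"
      by (simp add: space_PiM)
    show "emeasure P (PiE I (\<lambda>_. UNIV)) \<noteq> \<infinity>" for i :: nat by simp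
  qed
qed

section \<open>Ottaviani's maximal inequality\<close>

text \<open>If the first \<open>k\<close> with \<open>\<bar>S\<^sub>k\<bar> \<ge> 2 a\<close> is followed by an increment \<open>S\<^sub>m - S\<^sub>k\<close> of size at most \<open>a\<close>, then
  \<open>\<bar>S\<^sub>m\<bar> \<ge> a\<close>. That increment is independent of the past, and it is small with probability at least
  one half.\<close>

lemma (in prob_space) Ottaviani_inequality:
  fixes X :: "nat \<Rightarrow> 'a \<Rightarrow> real"
  assumes ind: "indep_vars (\<lambda>_. borel) X UNIV" and a: "a > 0"
    and tail: "\<And>k. k \<le> m \<Longrightarrow> prob {\<omega>\<in>space M. a < \<bar>\<Sum>i=k..<m. X i \<omega>\<bar>} \<le> 1/2"
  shows "prob {\<omega>\<in>space M. \<exists>k\<le>m. 2 * a \<le> \<bar>\<Sum>i<k. X i \<omega>\<bar>} \<le> 2 * prob {\<omega>\<in>space M. a \<le> \<bar>\<Sum>i<m. X i \<omega>\<bar>}"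
proof -
  have X[measurable]: "X i \<in> borel_measurable M" for i
    using ind by (auto simp: indep_vars_def)
  let ?S = "\<lambda>k \<omega>. \<Sum>i<k. X i \<omega>"
  \<comment> \<open>\<open>T k\<close>: the level \<open>2 a\<close> is first reached at \<open>k\<close>; \<open>R k\<close>: the remaining increment is at most \<open>a\<close>.\<close>
  define T where "T k = {\<omega>\<in>space M. 2 * a \<le> \<bar>?S k \<omega>\<bar> \<and> (\<forall>j<k. \<bar>?S j \<omega>\<bar> < 2 * a)}" for k
  define R where "R k = {\<omega>\<in>space M. \<bar>\<Sum>i=k..<m. X i \<omega>\<bar> \<le> a}" for k
  have [measurable]: "T k \<in> events" "R k \<in> events" for k
    unfolding T_def R_def by measurable
  have disj: "disjoint_family_on T {..m}"
    unfolding disjoint_family_on_def T_def by (auto simp: not_less) (metis linorder_neqE_nat not_less)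
  have un: "{\<omega>\<in>space M. \<exists>k\<le>m. 2 * a \<le> \<bar>?S k \<omega>\<bar>} = (\<Union>k\<le>m. T k)"
  proof (intro set_eqI iffI)
    fix \<omega> assume "\<omega> \<in> {\<omega>\<in>space M. \<exists>k\<le>m. 2 * a \<le> \<bar>?S k \<omega>\<bar>}"
    then obtain k where k: "\<omega> \<in> space M" "k \<le> m" "2 * a \<le> \<bar>?S k \<omega>\<bar>" by auto
    define l where "l = (LEAST k. 2 * a \<le> \<bar>?S k \<omega>\<bar>)"
    have "2 * a \<le> \<bar>?S l \<omega>\<bar>" "l \<le> k" unfolding l_def using k by (auto intro: LeastI Least_le)
    moreover have "\<forall>j<l. \<bar>?S j \<omega>\<bar> < 2 * a" unfolding l_def using not_less_Least by fastforce
    ultimately show "\<omega> \<in> (\<Union>k\<le>m. T k)" using k by (auto simp: T_def)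
  qed (auto simp: T_def)
  \<comment> \<open>\<open>T k\<close> is an event of \<open>X 0, \<dots>, X (k - 1)\<close>, and \<open>R k\<close> is one of \<open>X k, \<dots>, X (m - 1)\<close>.\<close>
  have indep: "prob (T k \<inter> R k) = prob (T k) * prob (R k)" if k: "k \<le> m" for k
  proof -
    have iv: "indep_var (PiM {..<k} (\<lambda>_. borel)) (\<lambda>\<omega>. \<lambda>i\<in>{..<k}. X i \<omega>) (PiM {k..<m} (\<lambda>_. borel)) (\<lambda>\<omega>. \<lambda>i\<in>{k..<m}. X i \<omega>)"
      by (rule indep_var_restrict[OF ind]) auto
    define TT where "TT = {x\<in>space (PiM {..<k} (\<lambda>_. borel::real measure)). 2 * a \<le> \<bar>\<Sum>i<k. x i\<bar> \<and> (\<forall>j<k. \<bar>\<Sum>i<j. x i\<bar> < 2 * a)}"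
    define RR where "RR = {x\<in>space (PiM {k..<m} (\<lambda>_. borel::real measure)). \<bar>\<Sum>i=k..<m. x i\<bar> \<le> a}"
    have m1: "(\<lambda>x. \<Sum>i<j. x i) \<in> borel_measurable (PiM {..<k} (\<lambda>_. borel::real measure))" if "j \<le> k" for j
    proof (rule borel_measurable_sum)
      fix i assume "i \<in> {..<j}"
      then have "i \<in> {..<k}" using that by auto
      then show "(\<lambda>x. x i) \<in> borel_measurable (PiM {..<k} (\<lambda>_. borel::real measure))"
        by (rule measurable_component_singleton)
    qed
    have "TT = {x\<in>space (PiM {..<k} (\<lambda>_. borel::real measure)). 2 * a \<le> \<bar>\<Sum>i<k. x i\<bar>} \<inter>
       {x\<in>space (PiM {..<k} (\<lambda>_. borel::real measure)). (\<forall>j\<in>{..<k}. \<bar>\<Sum>i<j. x i\<bar> < 2 * a)}"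
      unfolding TT_def by auto
    also have "\<dots> \<in> sets (PiM {..<k} (\<lambda>_. borel))"
    proof (intro sets.Int sets.sets_Collect_finite_All)
      show "{x\<in>space (PiM {..<k} (\<lambda>_. borel::real measure)). 2 * a \<le> \<bar>\<Sum>i<k. x i\<bar>} \<in> sets (PiM {..<k} (\<lambda>_. borel))"
        using m1[OF order_refl] by measurable
      show "{x\<in>space (PiM {..<k} (\<lambda>_. borel::real measure)). \<bar>\<Sum>i<j. x i\<bar> < 2 * a} \<in> sets (PiM {..<k} (\<lambda>_. borel))" if "j \<in> {..<k}" for j
      proof -
        have [measurable]: "(\<lambda>x. \<Sum>i<j. x i) \<in> borel_measurable (PiM {..<k} (\<lambda>_. borel::real measure))"
          using that by (intro m1) auto
        show ?thesis by measurable
      qed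
    qed auto
    finally have [measurable]: "TT \<in> sets (PiM {..<k} (\<lambda>_. borel))" .
    have [measurable]: "RR \<in> sets (PiM {k..<m} (\<lambda>_. borel))"
      unfolding RR_def by measurable
    have "prob ((\<lambda>\<omega>. (\<lambda>i\<in>{..<k}. X i \<omega>, \<lambda>i\<in>{k..<m}. X i \<omega>)) -` (TT \<times> RR) \<inter> space M)
       = prob ((\<lambda>\<omega>. \<lambda>i\<in>{..<k}. X i \<omega>) -` TT \<inter> space M) * prob ((\<lambda>\<omega>. \<lambda>i\<in>{k..<m}. X i \<omega>) -` RR \<inter> space M)"
      by (rule indep_varD[OF iv]) measurable
    moreover have "(\<lambda>\<omega>. (\<lambda>i\<in>{..<k}. X i \<omega>, \<lambda>i\<in>{k..<m}. X i \<omega>)) -` (TT \<times> RR) \<inter> space M = T k \<inter> R k"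
      by (auto simp: TT_def RR_def T_def R_def space_PiM)
    moreover have "(\<lambda>\<omega>. \<lambda>i\<in>{..<k}. X i \<omega>) -` TT \<inter> space M = T k"
      by (auto simp: TT_def T_def space_PiM)
    moreover have "(\<lambda>\<omega>. \<lambda>i\<in>{k..<m}. X i \<omega>) -` RR \<inter> space M = R k"
      by (auto simp: RR_def R_def space_PiM)
    ultimately show ?thesis by simp
  qed
  have half: "1/2 \<le> prob (R k)" if "k \<le> m" for k
  proof -
    have "R k = space M - {\<omega>\<in>space M. a < \<bar>\<Sum>i=k..<m. X i \<omega>\<bar>}" by (auto simp: R_def)
    then have "prob (R k) = 1 - prob {\<omega>\<in>space M. a < \<bar>\<Sum>i=k..<m. X i \<omega>\<bar>}"
      by (simp add: prob_compl)
    then show ?thesis using tail[OF that] by simp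
  qed
  have "prob {\<omega>\<in>space M. \<exists>k\<le>m. 2 * a \<le> \<bar>?S k \<omega>\<bar>} = (\<Sum>k\<le>m. prob (T k))"
    unfolding un by (rule finite_measure_finite_Union) (auto simp: disj)
  also have "\<dots> \<le> (\<Sum>k\<le>m. 2 * prob (T k \<inter> R k))"
  proof (rule sum_mono)
    fix k assume "k \<in> {..m}"
    then have k: "k \<le> m" by simp
    show "prob (T k) \<le> 2 * prob (T k \<inter> R k)"
      using indep[OF k] mult_left_mono[OF half[OF k], of "prob (T k)"] by simp
  qed
  also have "\<dots> = 2 * (\<Sum>k\<le>m. prob (T k \<inter> R k))" by (simp add: sum_distrib_left)
  also have "(\<Sum>k\<le>m. prob (T k \<inter> R k)) = prob (\<Union>k\<le>m. T k \<inter> R k)"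
    using disj by (intro finite_measure_finite_Union[symmetric]) (auto simp: disjoint_family_on_def)
  also have "\<dots> \<le> prob {\<omega>\<in>space M. a \<le> \<bar>?S m \<omega>\<bar>}"
  proof (rule finite_measure_mono)
    show "(\<Union>k\<le>m. T k \<inter> R k) \<subseteq> {\<omega>\<in>space M. a \<le> \<bar>?S m \<omega>\<bar>}"
    proof safe
      fix \<omega> k assume k: "k \<le> m" and w: "\<omega> \<in> T k" "\<omega> \<in> R k"
      have "?S m \<omega> = ?S k \<omega> + (\<Sum>i=k..<m. X i \<omega>)"
        using k by (simp add: sum.atLeastLessThan_concat atLeast0LessThan[symmetric])
      then show "a \<le> \<bar>?S m \<omega>\<bar>" using w by (auto simp: T_def R_def)
    qed (auto simp: T_def)
  qed simp
  finally show ?thesis by simp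
qed

section \<open>The Brownian bridge on a grid\<close>

lemma integrable_mult_of_squares:
  fixes f g :: "'a \<Rightarrow> real"
  assumes [measurable]: "f \<in> borel_measurable M" "g \<in> borel_measurable M"
    and "integrable M (\<lambda>x. (f x)\<^sup>2)" "integrable M (\<lambda>x. (g x)\<^sup>2)"
  shows "integrable M (\<lambda>x. f x * g x)"
proof (rule Bochner_Integration.integrable_bound[where f = "\<lambda>x. (f x)\<^sup>2 + (g x)\<^sup>2"])
  have "\<bar>a * b\<bar> \<le> a\<^sup>2 + b\<^sup>2" for a b :: real
  proof -
    have "2 * \<bar>a * b\<bar> \<le> a\<^sup>2 + b\<^sup>2" using sum_squares_bound[of "\<bar>a\<bar>" "\<bar>b\<bar>"] by (simp add: abs_mult)
    then show ?thesis by (smt (verit) abs_ge_zero)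
  qed
  then show "AE x in M. norm (f x * g x) \<le> norm ((f x)\<^sup>2 + (g x)\<^sup>2)" by auto
qed (use assms in auto)

text \<open>The variance is a parameter, in contrast to \<^const>\<open>gaussian_rv\<close>, so that it determines the law;
  variance \<open>0\<close> is allowed.\<close>

definition centred_gaussian :: "'b measure \<Rightarrow> ('b \<Rightarrow> real) \<Rightarrow> real \<Rightarrow> bool" where
  "centred_gaussian N Y v \<longleftrightarrow> Y \<in> borel_measurable N \<and>
     ((v = 0 \<and> (AE \<omega> in N. Y \<omega> = 0)) \<or>
      (v > 0 \<and> distributed N lborel Y (\<lambda>x. ennreal (normal_density 0 (sqrt v) x))))"

lemma centred_gaussian_law_unique:
  assumes M: "prob_space M" "centred_gaussian M X v" and N: "prob_space N" "centred_gaussian N Y v"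
  shows "distr M borel X = distr N borel Y"
proof (cases "v > 0")
  case True
  then have "distr M lborel X = distr N lborel Y"
    using M N by (auto simp: centred_gaussian_def distributed_def)
  moreover have "distr M lborel X = distr M borel X" "distr N lborel Y = distr N borel Y"
    by (auto intro!: distr_cong)
  ultimately show ?thesis by simp
next
  case False
  interpret M: prob_space M by fact
  interpret N: prob_space N by fact
  have X: "X \<in> borel_measurable M" "AE \<omega> in M. X \<omega> = 0" and Y: "Y \<in> borel_measurable N" "AE \<omega> in N. Y \<omega> = 0"
    using False M N by (auto simp: centred_gaussian_def)
  have "distr M borel X = distr M borel (\<lambda>_. 0)" using X by (intro distr_cong_AE) auto
  also have "\<dots> = return borel 0" by (rule M.distr_const) simp
  also have "\<dots> = distr N borel (\<lambda>_. 0)" by (rule N.distr_const[symmetric]) simp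
  also have "\<dots> = distr N borel Y" using Y by (intro distr_cong_AE) auto
  finally show ?thesis .
qed

lemma gaussian_rv_square_integrable:
  assumes N: "prob_space N" and Y: "gaussian_rv N Y"
  shows "integrable N (\<lambda>\<omega>. (Y \<omega>)\<^sup>2)"
proof -
  interpret prob_space N by fact
  have [measurable]: "Y \<in> borel_measurable N" using Y by (simp add: gaussian_rv_def)
  from Y obtain m s where "(s = 0 \<and> (AE \<omega> in N. Y \<omega> = m)) \<or>
            (s > 0 \<and> distributed N lborel Y (\<lambda>x. ennreal (normal_density m s x)))"
    by (auto simp: gaussian_rv_def)
  then show ?thesis
  proof (elim disjE conjE)
    assume "AE \<omega> in N. Y \<omega> = m"
    then have "integrable N (\<lambda>\<omega>. (Y \<omega>)\<^sup>2) \<longleftrightarrow> integrable N (\<lambda>\<omega>. m\<^sup>2)"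
      by (intro integrable_cong_AE) auto
    then show ?thesis by simp
  next
    assume s: "s > 0" and D: "distributed N lborel Y (\<lambda>x. ennreal (normal_density m s x))"
    have "integrable lborel (\<lambda>x. normal_density m s x * ((x - m)^2 + (2 * m * (x - m)^1 + m\<^sup>2)))"
    proof -
      have "integrable lborel (\<lambda>x. normal_density m s x * (x - m)^2 + ((2 * m) * (normal_density m s x * (x - m)^1) + m\<^sup>2 * normal_density m s x))"
        using integrable_normal_moment[OF s, of m 2] integrable_normal_moment[OF s, of m 1] s
        by (intro Bochner_Integration.integrable_add Bochner_Integration.integrable_mult_right) auto
      then show ?thesis by (simp add: algebra_simps)
    qed
    then have "integrable lborel (\<lambda>x. normal_density m s x * x\<^sup>2)"
      by (simp add: power2_eq_square algebra_simps)
    then show ?thesis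
      using distributed_integrable[OF D, of "\<lambda>x. x\<^sup>2"] by simp
  qed
qed

lemma gaussian_rv_centred:
  assumes N: "prob_space N" and Y: "gaussian_rv N Y" and mean: "(\<integral>\<omega>. Y \<omega> \<partial>N) = 0" and var: "(\<integral>\<omega>. (Y \<omega>)\<^sup>2 \<partial>N) = v"
  shows "centred_gaussian N Y v"
proof -
  interpret prob_space N by fact
  have [measurable]: "Y \<in> borel_measurable N" using Y by (simp add: gaussian_rv_def)
  from Y obtain m s where "(s = 0 \<and> (AE \<omega> in N. Y \<omega> = m)) \<or>
            (s > 0 \<and> distributed N lborel Y (\<lambda>x. ennreal (normal_density m s x)))"
    by (auto simp: gaussian_rv_def)
  then show ?thesis
  proof (elim disjE conjE)
    assume ae: "AE \<omega> in N. Y \<omega> = m"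
    have "(\<integral>\<omega>. Y \<omega> \<partial>N) = (\<integral>\<omega>. m \<partial>N)" using ae by (intro integral_cong_AE) auto
    then have "m = 0" using mean by (simp add: prob_space)
    moreover have "(\<integral>\<omega>. (Y \<omega>)\<^sup>2 \<partial>N) = (\<integral>\<omega>. m\<^sup>2 \<partial>N)" using ae by (intro integral_cong_AE) auto
    ultimately show ?thesis using ae var by (simp add: centred_gaussian_def)
  next
    assume s: "s > 0" and D: "distributed N lborel Y (\<lambda>x. ennreal (normal_density m s x))"
    have "m = 0" using normal_distributed_expectation[OF s D] mean by simp
    moreover have "v = s\<^sup>2" using normal_distributed_variance[OF s D] mean var by simp
    ultimately show ?thesis using s D by (simp add: centred_gaussian_def)
  qed
qed

text \<open>Terms with coefficient \<open>0\<close> are dropped first, as a degenerate summand has no density.\<close>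

lemma (in prob_space) centred_gaussian_linear_combination:
  fixes z :: "'i \<Rightarrow> 'a \<Rightarrow> real"
  assumes I: "finite I" and ind: "indep_vars (\<lambda>_. borel) z I"
    and std: "\<And>i. i \<in> I \<Longrightarrow> distributed M lborel (z i) std_normal_density"
  shows "centred_gaussian M (\<lambda>\<omega>. \<Sum>i\<in>I. b i * z i \<omega>) (\<Sum>i\<in>I. (b i)\<^sup>2)"
proof -
  have [measurable]: "z i \<in> borel_measurable M" if "i \<in> I" for i
    using ind that by (auto simp: indep_vars_def)
  define J where "J = {i\<in>I. b i \<noteq> 0}"
  have J: "finite J" "J \<subseteq> I" using I by (auto simp: J_def)
  have s1: "(\<lambda>\<omega>. \<Sum>i\<in>I. b i * z i \<omega>) = (\<lambda>\<omega>. \<Sum>i\<in>J. b i * z i \<omega>)"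
    using I by (intro ext sum.mono_neutral_right) (auto simp: J_def)
  have s2: "(\<Sum>i\<in>I. (b i)\<^sup>2) = (\<Sum>i\<in>J. (b i)\<^sup>2)"
    using I by (intro sum.mono_neutral_right) (auto simp: J_def)
  have meas: "(\<lambda>\<omega>. \<Sum>i\<in>J. b i * z i \<omega>) \<in> borel_measurable M"
    using J by (intro borel_measurable_sum) auto
  show ?thesis
  proof (cases "J = {}")
    case True
    then show ?thesis unfolding s1 s2 by (simp add: centred_gaussian_def)
  next
    case False
    have "distributed M lborel (\<lambda>\<omega>. \<Sum>i\<in>J. b i * z i \<omega>) (normal_density (\<Sum>i\<in>J. 0) (sqrt (\<Sum>i\<in>J. (\<bar>b i\<bar>)\<^sup>2)))"
    proof (rule sum_indep_normal[OF J(1) False])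
      show "indep_vars (\<lambda>i. borel) (\<lambda>i \<omega>. b i * z i \<omega>) J"
        by (rule indep_vars_compose2[OF indep_vars_subset[OF ind J(2)]]) auto
      show "0 < \<bar>b i\<bar>" if "i \<in> J" for i using that by (simp add: J_def)
      show "distributed M lborel (\<lambda>\<omega>. b i * z i \<omega>) (normal_density 0 \<bar>b i\<bar>)" if "i \<in> J" for i
        using normal_density_affine[OF std, of i "b i" 0] that by (simp add: J_def)
    qed
    moreover have "(\<Sum>i\<in>J. (b i)\<^sup>2) > 0"
      using J False by (intro sum_pos) (auto simp: J_def)
    ultimately show ?thesis unfolding s1 s2 using meas by (simp add: centred_gaussian_def)
  qed
qed

text \<open>\<open>w j\<close> is the vector of coefficients of the tied-down sum \<open>(S\<^sub>j - (j/L) S\<^sub>L) / \<surd>L\<close> of \<open>L\<close> variables;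
  the inner products of these vectors are the covariances of the bridge at the grid points.\<close>

lemma sum_bridge_weights:
  fixes L j k :: nat
  assumes L: "L > 0" and "j \<le> L" "k \<le> L"
  defines "w \<equiv> \<lambda>j i. ((if i < j then 1 else 0) - real j / real L) / sqrt (real L)"
  shows "(\<Sum>i<L. w j i * w k i) = min (j / L) (k / L) - (j / L) * (k / L)"
proof -
  have c: "(\<Sum>i<L. if i < j then (1::real) else 0) = j" if "j \<le> L" for j
  proof -
    have "(\<Sum>i<L. if i < j then (1::real) else 0) = (\<Sum>i\<in>{i\<in>{..<L}. i < j}. 1)"
      by (rule sum.inter_filter[symmetric]) simp
    also have "{i\<in>{..<L}. i < j} = {..<j}" using that by auto
    finally show ?thesis by simp
  qed
  have "(\<Sum>i<L. w j i * w k i) = (\<Sum>i<L. ((if i < min j k then 1 else 0) - real k / L * (if i < j then 1 else 0)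
      - real j / L * (if i < k then 1 else 0) + real j / L * (real k / L)) / L)"
    unfolding w_def using L by (intro sum.cong) (auto simp: field_simps)
  also have "\<dots> = (real (min j k) - real k / L * j - real j / L * k + L * (real j / L * (real k / L))) / L"
    using assms by (simp add: sum_divide_distrib[symmetric] sum.distrib sum_subtractf sum_distrib_left[symmetric] c del: of_nat_min min_less_iff_conj)
  also have "\<dots> = min (j / L) (k / L) - (j / L) * (k / L)"
    using L by (auto simp: field_simps min_def)
  finally show ?thesis .
qed

text \<open>Both vectors are centred Gaussian, and by \<open>sum_bridge_weights\<close> they have the same covariance.\<close>

theorem bridge_grid_law:
  fixes L :: nat
  assumes W: "std_brownian_bridge N W" and L: "L > 0"
  defines "P \<equiv> PiM {..<L} (\<lambda>_. std_normal_distribution)"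
  shows "distr P (PiM {..L} (\<lambda>_. borel)) (\<lambda>z. \<lambda>j\<in>{..L}. ((\<Sum>i<j. z i) - j / L * (\<Sum>i<L. z i)) / sqrt L)
       = distr N (PiM {..L} (\<lambda>_. borel)) (\<lambda>\<omega>. \<lambda>j\<in>{..L}. W (j / L) \<omega>)" (is "?D = ?E")
proof -
  have N: "prob_space N" and Wm: "\<And>t. t \<in> {0..1} \<Longrightarrow> W t \<in> borel_measurable N"
    and Wg: "\<And>T a. finite T \<Longrightarrow> T \<subseteq> {0..1} \<Longrightarrow> gaussian_rv N (\<lambda>\<omega>. \<Sum>t\<in>T. a t * W t \<omega>)"
    and W0: "\<And>t. t \<in> {0..1} \<Longrightarrow> (\<integral>\<omega>. W t \<omega> \<partial>N) = 0"
    and Wc: "\<And>s t. s \<in> {0..1} \<Longrightarrow> t \<in> {0..1} \<Longrightarrow> (\<integral>\<omega>. W s \<omega> * W t \<omega> \<partial>N) = min s t - s * t"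
    using W by (auto simp: std_brownian_bridge_def)
  interpret N: prob_space N by fact
  interpret S: prob_space std_normal_distribution by (rule prob_space_normal_density) simp
  have P: "prob_space P" unfolding P_def by (intro prob_space_PiM S.prob_space_axioms)
  interpret P: prob_space P by fact
  have gr: "real j / L \<in> {0..1}" if "j \<le> L" for j using that L by (auto simp: field_simps)
  have sP[measurable_cong]: "sets P = sets (PiM {..<L} (\<lambda>_. borel))"
    unfolding P_def by (intro sets_PiM_cong) auto
  have zm: "(\<lambda>z. z i) \<in> borel_measurable P" if "i < L" for i
  proof -
    have "i \<in> {..<L}" using that by simp
    then have "(\<lambda>z. z i) \<in> borel_measurable (PiM {..<L} (\<lambda>_. borel :: real measure))"
      by (rule measurable_component_singleton)
    then show ?thesis by (simp add: measurable_cong_sets[OF sP refl])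
  qed
  have zsum: "(\<lambda>z. \<Sum>i<j. z i) \<in> borel_measurable P" if "j \<le> L" for j
    using that by (intro borel_measurable_sum zm) auto
  have zl: "distr P borel (\<lambda>z. z i) = std_normal_distribution" if "i < L" for i
  proof -
    have "distr P borel (\<lambda>z. z i) = distr P std_normal_distribution (\<lambda>z. z i)"
      by (intro distr_cong) auto
    also have "\<dots> = std_normal_distribution" unfolding P_def
      by (rule distr_PiM_component) (use that in \<open>auto intro: S.prob_space_axioms\<close>)
    finally show ?thesis .
  qed
  have zd: "distributed P lborel (\<lambda>z. z i) std_normal_density" if "i < L" for i
    unfolding distributed_def
  proof (intro conjI)
    show "distr P lborel (\<lambda>z. z i) = density lborel (\<lambda>x. ennreal (std_normal_density x))"
      using zl[OF that] by (subst distr_cong[OF refl sets_lborel refl]) simp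
  qed (use zm[OF that] in auto)
  have zi: "P.indep_vars (\<lambda>_. borel) (\<lambda>i z. z i) {..<L}"
  proof (subst P.indep_vars_iff_distr_eq_PiM')
    have "distr P (PiM {..<L} (\<lambda>_. borel)) (\<lambda>x. \<lambda>i\<in>{..<L}. x i) = distr P P (\<lambda>x. x)"
      by (intro distr_cong refl sP[symmetric]) (auto simp: P_def space_PiM PiE_def extensional_def restrict_def)
    also have "\<dots> = P" by (rule distr_id)
    also have "\<dots> = PiM {..<L} (\<lambda>i. distr P borel (\<lambda>z. z i))"
      unfolding P_def by (intro PiM_cong refl) (simp add: zl[unfolded P_def])
    finally show "distr P (PiM {..<L} (\<lambda>_. borel)) (\<lambda>x. \<lambda>i\<in>{..<L}. x i) = PiM {..<L} (\<lambda>i. distr P borel (\<lambda>z. z i))" .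
  qed (use L zm in auto)
  let ?V = "\<lambda>j z. ((\<Sum>i<j. z i) - j / L * (\<Sum>i<L. z i)) / sqrt L"
  let ?w = "\<lambda>j i. ((if i < j then 1 else 0) - real j / real L) / sqrt (real L)"
  have Vw: "?V j z = (\<Sum>i<L. ?w j i * z i)" if "j \<le> L" for j and z :: "nat \<Rightarrow> real"
  proof -
    have "(\<Sum>i<L. (if i < j then 1 else 0) * z i) = (\<Sum>i\<in>{i\<in>{..<L}. i < j}. z i)"
      by (subst sum.inter_filter) (auto intro!: sum.cong)
    also have "{i\<in>{..<L}. i < j} = {..<j}" using that by auto
    finally have e: "(\<Sum>i<L. (if i < j then 1 else 0) * z i) = (\<Sum>i<j. z i)" .
    have "(\<Sum>i<L. ?w j i * z i) = (\<Sum>i<L. ((if i < j then 1 else 0) * z i - j / L * z i) / sqrt L)"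
      by (intro sum.cong refl) (simp add: algebra_simps)
    also have "\<dots> = ((\<Sum>i<L. (if i < j then 1 else 0) * z i) - j / L * (\<Sum>i<L. z i)) / sqrt L"
      by (simp only: sum_divide_distrib[symmetric] sum_subtractf sum_distrib_left)
    finally show ?thesis unfolding e by simp
  qed
  have Vm: "(\<lambda>z. \<lambda>j\<in>{..L}. ?V j z) \<in> measurable P (PiM {..L} (\<lambda>_. borel))"
    by (intro measurable_restrict borel_measurable_divide borel_measurable_diff borel_measurable_times zsum) auto
  have Wm': "(\<lambda>\<omega>. \<lambda>j\<in>{..L}. W (j / L) \<omega>) \<in> measurable N (PiM {..L} (\<lambda>_. borel))"
    using gr by (intro measurable_restrict Wm) auto
  show ?thesis
  proof (rule Cramer_Wold_uniqueness)
    show "finite {..L}" by simp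
    show "prob_space ?D" by (intro P.prob_space_distr Vm)
    show "prob_space ?E" by (intro N.prob_space_distr Wm')
    fix a :: "nat \<Rightarrow> real"
    have lc: "(\<lambda>x. \<Sum>j\<le>L. a j * x j) \<in> borel_measurable (PiM {..L} (\<lambda>_. borel :: real measure))"
      by measurable
    let ?v = "\<Sum>j\<le>L. \<Sum>k\<le>L. a j * a k * (min (real j / L) (real k / L) - (j / L) * (k / L))"
    have "centred_gaussian P (\<lambda>z. \<Sum>i<L. (\<Sum>j\<le>L. a j * ?w j i) * z i) (\<Sum>i<L. (\<Sum>j\<le>L. a j * ?w j i)\<^sup>2)"
      by (intro P.centred_gaussian_linear_combination zi zd) auto
    also have "(\<lambda>z. \<Sum>i<L. (\<Sum>j\<le>L. a j * ?w j i) * z i) = (\<lambda>z. \<Sum>j\<le>L. a j * ?V j z)"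
    proof
      fix z :: "nat \<Rightarrow> real"
      have "(\<Sum>i<L. (\<Sum>j\<le>L. a j * ?w j i) * z i) = (\<Sum>j\<le>L. \<Sum>i<L. a j * (?w j i * z i))"
        by (subst sum.swap) (simp add: sum_distrib_right mult.assoc)
      also have "\<dots> = (\<Sum>j\<le>L. a j * (\<Sum>i<L. ?w j i * z i))"
        by (simp add: sum_distrib_left)
      also have "\<dots> = (\<Sum>j\<le>L. a j * ?V j z)"
        by (intro sum.cong refl arg_cong2[where f = "(*)"] Vw[symmetric]) simp
      finally show "(\<Sum>i<L. (\<Sum>j\<le>L. a j * ?w j i) * z i) = (\<Sum>j\<le>L. a j * ?V j z)" .
    qed
    also have "(\<Sum>i<L. (\<Sum>j\<le>L. a j * ?w j i)\<^sup>2) = (\<Sum>i<L. \<Sum>j\<le>L. \<Sum>k\<le>L. a j * a k * (?w j i * ?w k i))"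
      by (simp add: power2_eq_square sum_product mult_ac)
    also have "\<dots> = (\<Sum>j\<le>L. \<Sum>i<L. \<Sum>k\<le>L. a j * a k * (?w j i * ?w k i))" by (rule sum.swap)
    also have "\<dots> = (\<Sum>j\<le>L. \<Sum>k\<le>L. \<Sum>i<L. a j * a k * (?w j i * ?w k i))"
      by (intro sum.cong refl sum.swap)
    also have "\<dots> = ?v"
      unfolding sum_distrib_left[symmetric] by (intro sum.cong refl arg_cong2[where f = "(*)"] sum_bridge_weights L) auto
    finally have g1: "centred_gaussian P (\<lambda>z. \<Sum>j\<le>L. a j * ?V j z) ?v" .

    have Wsq: "integrable N (\<lambda>\<omega>. (W t \<omega>)\<^sup>2)" if "t \<in> {0..1}" for t
      using gaussian_rv_square_integrable[OF N Wg[of "{t}" "\<lambda>_. 1"]] that by simp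
    have Wi: "integrable N (W t)" if "t \<in> {0..1}" for t
      using N.square_integrable_imp_integrable[OF Wm Wsq] that by simp
    have Wp: "integrable N (\<lambda>\<omega>. W s \<omega> * W t \<omega>)" if "s \<in> {0..1}" "t \<in> {0..1}" for s t
      using that by (intro integrable_mult_of_squares Wsq Wm)
    have inj: "inj_on (\<lambda>j. real j / L) {..L}" using L by (auto simp: inj_on_def)
    \<comment> \<open>The definition of the bridge speaks of sums over sets of times, hence the passage from indices to times.\<close>
    have "gaussian_rv N (\<lambda>\<omega>. \<Sum>t\<in>(\<lambda>j. real j / L) ` {..L}. a (the_inv_into {..L} (\<lambda>j. real j / L) t) * W t \<omega>)"
      using gr by (intro Wg) auto
    also have "(\<lambda>\<omega>. \<Sum>t\<in>(\<lambda>j. real j / L) ` {..L}. a (the_inv_into {..L} (\<lambda>j. real j / L) t) * W t \<omega>)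
        = (\<lambda>\<omega>. \<Sum>j\<le>L. a j * W (j / L) \<omega>)"
      by (simp add: sum.reindex[OF inj] the_inv_into_f_f[OF inj])
    finally have "gaussian_rv N (\<lambda>\<omega>. \<Sum>j\<le>L. a j * W (j / L) \<omega>)" .
    moreover have "(\<integral>\<omega>. (\<Sum>j\<le>L. a j * W (j / L) \<omega>) \<partial>N) = 0"
      using gr by (subst Bochner_Integration.integral_sum) (auto intro!: sum.neutral simp: Wi W0)
    moreover have "(\<integral>\<omega>. (\<Sum>j\<le>L. a j * W (j / L) \<omega>)\<^sup>2 \<partial>N) = ?v"
    proof -
      have "(\<integral>\<omega>. (\<Sum>j\<le>L. a j * W (j / L) \<omega>)\<^sup>2 \<partial>N)
          = (\<integral>\<omega>. (\<Sum>j\<le>L. \<Sum>k\<le>L. a j * a k * (W (j / L) \<omega> * W (k / L) \<omega>)) \<partial>N)"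
        by (simp add: power2_eq_square sum_product mult_ac)
      also have "\<dots> = (\<Sum>j\<le>L. \<Sum>k\<le>L. a j * a k * (\<integral>\<omega>. W (j / L) \<omega> * W (k / L) \<omega> \<partial>N))"
        using gr by (subst Bochner_Integration.integral_sum, simp add: Wp)
          (auto intro!: sum.cong Bochner_Integration.integrable_sum simp: Bochner_Integration.integral_sum Wp)
      also have "\<dots> = ?v" using gr by (intro sum.cong refl arg_cong2[where f = "(*)"] Wc) auto
      finally show ?thesis .
    qed
    ultimately have g2: "centred_gaussian N (\<lambda>\<omega>. \<Sum>j\<le>L. a j * W (j / L) \<omega>) ?v"
      by (rule gaussian_rv_centred[OF N])
    have "distr ?D borel (\<lambda>x. \<Sum>j\<le>L. a j * x j) = distr P borel (\<lambda>z. \<Sum>j\<le>L. a j * ?V j z)"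
      by (subst distr_distr[OF lc Vm]) (auto simp: o_def)
    also have "\<dots> = distr N borel (\<lambda>\<omega>. \<Sum>j\<le>L. a j * W (j / L) \<omega>)"
      by (rule centred_gaussian_law_unique[OF P g1 N g2])
    also have "\<dots> = distr ?E borel (\<lambda>x. \<Sum>j\<le>L. a j * x j)"
      by (subst distr_distr[OF lc Wm']) (auto simp: o_def)
    finally show "distr ?D borel (\<lambda>x. \<Sum>j\<le>L. a j * x j) = distr ?E borel (\<lambda>x. \<Sum>j\<le>L. a j * x j)" .
  qed auto
qed

section \<open>Sums of i.i.d. random variables\<close>

lemma (in prob_space) indep_vars_reindex_inj:
  assumes ind: "indep_vars (\<lambda>_. borel) X I" and f: "inj_on f J" "f ` J \<subseteq> I"
  shows "indep_vars (\<lambda>_. borel) (\<lambda>j. X (f j)) J"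
proof -
  have "indep_vars (\<lambda>j. PiM {f j} (\<lambda>_. borel)) (\<lambda>j \<omega>. restrict (\<lambda>i. X i \<omega>) {f j}) J"
    using f by (intro indep_vars_restrict[OF ind]) (auto simp: disjoint_family_on_def inj_on_def)
  then have "indep_vars (\<lambda>_. borel) (\<lambda>j \<omega>. (\<lambda>x. x (f j)) (restrict (\<lambda>i. X i \<omega>) {f j})) J"
    by (rule indep_vars_compose2) (rule measurable_component_singleton, simp)
  then show ?thesis by simp
qed

locale iid_sequence = prob_space M for M :: "'a measure" +
  fixes X :: "nat \<Rightarrow> 'a \<Rightarrow> real"
  assumes indep: "indep_vars (\<lambda>_. borel) X UNIV"
    and ident: "distr M borel (X i) = distr M borel (X 0)"
begin

lemma rv[measurable]: "X i \<in> borel_measurable M"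
  using indep by (auto simp: indep_vars_def)

lemma reindex: "inj f \<Longrightarrow> iid_sequence M (\<lambda>i. X (f i))"
  by unfold_locales (auto intro: indep_vars_reindex_inj[OF indep] ident[THEN trans] ident[symmetric])

lemma compose:
  assumes [measurable]: "h \<in> borel_measurable borel"
  shows "iid_sequence M (\<lambda>i \<omega>. h (X i \<omega>))"
proof unfold_locales
  show "indep_vars (\<lambda>_. borel) (\<lambda>i \<omega>. h (X i \<omega>)) UNIV"
    by (rule indep_vars_compose2[OF indep]) simp
  have "distr M borel (\<lambda>\<omega>. h (X i \<omega>)) = distr (distr M borel (X i)) borel h" for i
    by (subst distr_distr) (auto simp: o_def)
  then show "distr M borel (\<lambda>\<omega>. h (X i \<omega>)) = distr M borel (\<lambda>\<omega>. h (X 0 \<omega>))" for i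
    using ident[of i] by simp
qed

lemma finite_law:
  assumes I: "finite I" "I \<noteq> {}" and f: "inj_on f I"
  shows "distr M (PiM I (\<lambda>_. borel)) (\<lambda>\<omega>. \<lambda>i\<in>I. X (f i) \<omega>) = PiM I (\<lambda>_. distr M borel (X 0))"
proof -
  have "indep_vars (\<lambda>_. borel) (\<lambda>i. X (f i)) I"
    using f by (intro indep_vars_reindex_inj[OF indep]) auto
  then have "distr M (PiM I (\<lambda>_. borel)) (\<lambda>\<omega>. \<lambda>i\<in>I. X (f i) \<omega>) = PiM I (\<lambda>i. distr M borel (X (f i)))"
    using I by (subst (asm) indep_vars_iff_distr_eq_PiM') auto
  also have "\<dots> = PiM I (\<lambda>_. distr M borel (X 0))" by (intro PiM_cong refl ident)
  finally show ?thesis .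
qed

lemma functional_law:
  assumes I: "finite I" "I \<noteq> {}" and f: "inj_on f I" and g: "inj_on g I"
    and F[measurable]: "F \<in> borel_measurable (PiM I (\<lambda>_. borel))"
  shows "distr M borel (\<lambda>\<omega>. F (\<lambda>i\<in>I. X (f i) \<omega>)) = distr M borel (\<lambda>\<omega>. F (\<lambda>i\<in>I. X (g i) \<omega>))"
proof -
  have "distr M borel (\<lambda>\<omega>. F (\<lambda>i\<in>I. X (h i) \<omega>)) = distr (PiM I (\<lambda>_. distr M borel (X 0))) borel F" if "inj_on h I" for h
    unfolding finite_law[OF I that, symmetric] by (subst distr_distr) (auto simp: o_def)
  then show ?thesis using f g by simp
qed

text \<open>With shifts for \<open>f\<close> and \<open>g\<close>: blocks of the same length have identically distributed sums.\<close>

lemma sum_law: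
  fixes m :: nat and f g :: "nat \<Rightarrow> nat"
  assumes m: "inj_on f {..<m}" "inj_on g {..<m}"
  shows "distr M borel (\<lambda>\<omega>. \<Sum>i<m. X (f i) \<omega>) = distr M borel (\<lambda>\<omega>. \<Sum>i<m. X (g i) \<omega>)"
proof (cases "m = 0")
  case False
  have "distr M borel (\<lambda>\<omega>. (\<lambda>x. \<Sum>i<m. x i) (\<lambda>i\<in>{..<m}. X (f i) \<omega>)) = distr M borel (\<lambda>\<omega>. (\<lambda>x. \<Sum>i<m. x i) (\<lambda>i\<in>{..<m}. X (g i) \<omega>))"
    using False m by (intro functional_law) auto
  then show ?thesis by simp
qed simp

lemma integrable_ident:
  assumes [measurable]: "h \<in> borel_measurable borel" and "integrable M (\<lambda>\<omega>. h (X 0 \<omega>) :: real)"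
  shows "integrable M (\<lambda>\<omega>. h (X i \<omega>))"
proof -
  have "integrable (distr M borel (X 0)) h" using assms by (simp add: integrable_distr_eq)
  then have "integrable (distr M borel (X i)) h" using ident[of i] by simp
  then show ?thesis by (simp add: integrable_distr_eq)
qed

lemma expectation_ident:
  assumes [measurable]: "h \<in> borel_measurable borel"
  shows "expectation (\<lambda>\<omega>. h (X i \<omega>) :: real) = expectation (\<lambda>\<omega>. h (X 0 \<omega>))"
proof -
  have "integral\<^sup>L (distr M borel (X i)) h = integral\<^sup>L (distr M borel (X 0)) h" using ident[of i] by simp
  then show ?thesis by (simp add: integral_distr)
qed

lemma indep_pair: "i \<noteq> j \<Longrightarrow> indep_var borel (X i) borel (X j)"
proof -
  assume ij: "i \<noteq> j"
  have "indep_var (PiM {i} (\<lambda>_. borel)) (\<lambda>\<omega>. restrict (\<lambda>i. X i \<omega>) {i}) (PiM {j} (\<lambda>_. borel)) (\<lambda>\<omega>. restrict (\<lambda>i. X i \<omega>) {j})"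
    using ij by (intro indep_var_restrict[OF indep]) auto
  then have "indep_var borel ((\<lambda>x. x i) \<circ> (\<lambda>\<omega>. restrict (\<lambda>i. X i \<omega>) {i})) borel ((\<lambda>x. x j) \<circ> (\<lambda>\<omega>. restrict (\<lambda>i. X i \<omega>) {j}))"
    by (rule indep_var_compose) (rule measurable_component_singleton, simp)+
  then show ?thesis by (simp add: o_def)
qed

end

lemma (in prob_space) second_moment_Markov:
  assumes [measurable]: "Z \<in> borel_measurable M" and i: "integrable M (\<lambda>\<omega>. (Z \<omega>)\<^sup>2)" and a: "a > (0::real)"
  shows "prob {\<omega>\<in>space M. a \<le> \<bar>Z \<omega>\<bar>} \<le> expectation (\<lambda>\<omega>. (Z \<omega>)\<^sup>2) / a\<^sup>2"
proof -
  have "prob {\<omega>\<in>space M. a \<le> \<bar>Z \<omega>\<bar>} = prob {\<omega>\<in>space M. a\<^sup>2 \<le> (Z \<omega>)\<^sup>2}"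
    using a by (intro arg_cong[where f = prob]) (auto simp: abs_le_square_iff[symmetric])
  also have "\<dots> \<le> expectation (\<lambda>\<omega>. (Z \<omega>)\<^sup>2) / a\<^sup>2"
    using a i by (intro integral_Markov_inequality_measure[where A = "{}"]) auto
  finally show ?thesis .
qed

locale centred_iid_sequence = iid_sequence +
  fixes \<sigma> :: real
  assumes square_integrable: "integrable M (\<lambda>\<omega>. (X 0 \<omega>)\<^sup>2)"
    and centred: "expectation (X 0) = 0"
    and second_moment: "expectation (\<lambda>\<omega>. (X 0 \<omega>)\<^sup>2) = \<sigma>\<^sup>2"
    and \<sigma>_pos: "\<sigma> > 0"
begin

lemma square_integrable_all: "integrable M (\<lambda>\<omega>. (X i \<omega>)\<^sup>2)"
  using integrable_ident[of "\<lambda>x. x\<^sup>2"] square_integrable by simp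

lemma mean_zero: "expectation (X i) = 0"
  using expectation_ident[of "\<lambda>x. x" i] centred by simp

lemma integrable_all: "integrable M (X i)"
  using square_integrable_imp_integrable[OF rv square_integrable_all] .

lemma centred_reindex: "inj f \<Longrightarrow> centred_iid_sequence M (\<lambda>i. X (f i)) \<sigma>"
proof -
  assume "inj f"
  then interpret R: iid_sequence M "\<lambda>i. X (f i)" by (rule reindex)
  show ?thesis
    using square_integrable_all[of "f 0"] mean_zero[of "f 0"] expectation_ident[of "\<lambda>x. x\<^sup>2" "f 0"] second_moment \<sigma>_pos
    by unfold_locales auto
qed

lemma second_moment_sum:
  assumes A: "finite A"
  shows "integrable M (\<lambda>\<omega>. (\<Sum>i\<in>A. X i \<omega>)\<^sup>2)"
    and "expectation (\<lambda>\<omega>. (\<Sum>i\<in>A. X i \<omega>)\<^sup>2) = card A * \<sigma>\<^sup>2"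
proof -
  have p: "integrable M (\<lambda>\<omega>. X i \<omega> * X j \<omega>)" for i j
    by (intro integrable_mult_of_squares rv square_integrable_all)
  have e: "expectation (\<lambda>\<omega>. X i \<omega> * X j \<omega>) = (if i = j then \<sigma>\<^sup>2 else 0)" for i j
  proof (cases "i = j")
    case True
    then show ?thesis using expectation_ident[of "\<lambda>x. x\<^sup>2" i] second_moment by (simp add: power2_eq_square)
  next
    case False
    then show ?thesis
      using indep_var_lebesgue_integral[OF indep_pair[OF False] integrable_all integrable_all] mean_zero by simp
  qed
  have s: "(\<Sum>i\<in>A. X i \<omega>)\<^sup>2 = (\<Sum>i\<in>A. \<Sum>j\<in>A. X i \<omega> * X j \<omega>)" for \<omega>
    by (simp add: power2_eq_square sum_product)
  show "integrable M (\<lambda>\<omega>. (\<Sum>i\<in>A. X i \<omega>)\<^sup>2)" unfolding s by (intro Bochner_Integration.integrable_sum p)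
  show "expectation (\<lambda>\<omega>. (\<Sum>i\<in>A. X i \<omega>)\<^sup>2) = card A * \<sigma>\<^sup>2"
    unfolding s using A by (simp add: Bochner_Integration.integral_sum p e)
qed

lemma sum_Chebyshev:
  assumes "finite A" "a > 0"
  shows "prob {\<omega>\<in>space M. a \<le> \<bar>\<Sum>i\<in>A. X i \<omega>\<bar>} \<le> card A * \<sigma>\<^sup>2 / a\<^sup>2"
  using second_moment_Markov[of "\<lambda>\<omega>. \<Sum>i\<in>A. X i \<omega>" a] second_moment_sum[OF assms(1)] assms(2) by simp

text \<open>The hypothesis on \<open>a\<close> makes Chebyshev's bound for every increment at most one half.\<close>

lemma maximal_inequality:
  assumes a: "a > 0" and m: "2 * m * \<sigma>\<^sup>2 \<le> a\<^sup>2"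
  shows "prob {\<omega>\<in>space M. \<exists>k\<le>m. 2 * a \<le> \<bar>\<Sum>i<k. X i \<omega>\<bar>} \<le> 2 * prob {\<omega>\<in>space M. a \<le> \<bar>\<Sum>i<m. X i \<omega>\<bar>}"
proof (rule Ottaviani_inequality[OF indep a])
  fix k assume "k \<le> m"
  have "prob {\<omega>\<in>space M. a < \<bar>\<Sum>i=k..<m. X i \<omega>\<bar>} \<le> prob {\<omega>\<in>space M. a \<le> \<bar>\<Sum>i=k..<m. X i \<omega>\<bar>}"
    by (intro finite_measure_mono) auto
  also have "\<dots> \<le> card {k..<m} * \<sigma>\<^sup>2 / a\<^sup>2" using a by (intro sum_Chebyshev) auto
  also have "\<dots> \<le> m * \<sigma>\<^sup>2 / a\<^sup>2" by (intro divide_right_mono mult_right_mono) auto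
  also have "\<dots> \<le> 1 / 2" using m a by (simp add: divide_simps)
  finally show "prob {\<omega>\<in>space M. a < \<bar>\<Sum>i=k..<m. X i \<omega>\<bar>} \<le> 1 / 2" .
qed

lemma CLT: "weak_conv_m (\<lambda>n. distr M borel (\<lambda>\<omega>. (\<Sum>i<n. X i \<omega>) / sqrt (n * \<sigma>\<^sup>2))) std_normal_distribution"
proof (rule central_limit_theorem_zero_mean[OF indep mean_zero \<sigma>_pos square_integrable_all])
  show "variance (X n) = \<sigma>\<^sup>2" for n
    using expectation_ident[of "\<lambda>x. x\<^sup>2" n] second_moment mean_zero[of n] by simp
  show "distr M borel (X n) = distr M borel (X 0)" for n by (rule ident)
qed

end

section \<open>The invariance principle for tied-down partial sums\<close>

text \<open>The grid points next to a maximiser converge to it.\<close>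

lemma continuous_grid_max_tendsto_SUP:
  fixes h :: "real \<Rightarrow> real"
  assumes h: "continuous_on {0..1} h"
  shows "(\<lambda>L. MAX j\<in>{..Suc L}. h (real j / real (Suc L))) \<longlonglongrightarrow> (SUP t\<in>{0..1}. h t)"
proof -
  obtain t where t: "t \<in> {0..1}" "\<And>s. s \<in> {0..1} \<Longrightarrow> h s \<le> h t"
    using continuous_attains_sup[of "{0..1::real}" h] h by auto
  have sup: "(SUP t\<in>{0..1}. h t) = h t"
    using t by (intro cSup_eq_maximum) auto
  define j where "j L = nat \<lfloor>t * real (Suc L)\<rfloor>" for L
  have jr: "real (j L) = of_int \<lfloor>t * real (Suc L)\<rfloor>" for L
    using t by (simp add: j_def)
  have jle: "j L \<le> Suc L" for L
  proof -
    have "t * real (Suc L) \<le> 1 * real (Suc L)" using t by (intro mult_right_mono) auto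
    then have "real (j L) \<le> real (Suc L)"
      unfolding jr using of_int_floor_le[of "t * real (Suc L)"] by (simp only: mult_1_left)
    then show ?thesis by simp
  qed
  have jt: "(\<lambda>L. real (j L) / real (Suc L)) \<longlonglongrightarrow> t"
  proof (rule LIM_zero_cancel, rule Lim_null_comparison[OF _ LIMSEQ_inverse_real_of_nat])
    show "\<forall>\<^sub>F L in sequentially. norm (real (j L) / real (Suc L) - t) \<le> inverse (real (Suc L))"
    proof (rule always_eventually, rule allI)
      fix L
      have "\<bar>real (j L) - t * real (Suc L)\<bar> \<le> 1" unfolding jr by linarith
      then have "\<bar>real (j L) - t * real (Suc L)\<bar> / real (Suc L) \<le> 1 / real (Suc L)"
        by (intro divide_right_mono) auto
      also have "\<bar>real (j L) - t * real (Suc L)\<bar> / real (Suc L) = \<bar>real (j L) / real (Suc L) - t\<bar>"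
      proof -
        have "real (j L) / real (Suc L) - t = (real (j L) - t * real (Suc L)) / real (Suc L)"
          by (simp add: diff_divide_distrib del: of_nat_Suc)
        then show ?thesis by (simp only: abs_divide abs_of_nat)
      qed
      finally show "norm (real (j L) / real (Suc L) - t) \<le> inverse (real (Suc L))" by (simp add: inverse_eq_divide)
    qed
  qed
  have grid: "real i / real (Suc L) \<in> {0..1}" if "i \<le> Suc L" for i L
    using that by (auto simp: divide_simps)
  have lim: "(\<lambda>L. h (real (j L) / real (Suc L))) \<longlonglongrightarrow> h t"
    by (rule continuous_on_tendsto_compose[OF h jt t(1)]) (intro always_eventually allI grid jle)
  show ?thesis unfolding sup
  proof (rule tendsto_sandwich[OF _ _ lim tendsto_const])
    show "\<forall>\<^sub>F L in sequentially. h (real (j L) / real (Suc L)) \<le> (MAX j\<in>{..Suc L}. h (real j / real (Suc L)))"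
      using jle by (intro always_eventually allI Max_ge) auto
    show "\<forall>\<^sub>F L in sequentially. (MAX j\<in>{..Suc L}. h (real j / real (Suc L))) \<le> h t"
      using t grid by (intro always_eventually allI Max.boundedI) auto
  qed
qed

lemma Max_diff_le:
  fixes f :: "'i \<Rightarrow> real" and g :: "'j \<Rightarrow> real"
  assumes "finite A" "A \<noteq> {}" "finite B" "B \<noteq> {}"
    and "\<And>a. a \<in> A \<Longrightarrow> \<exists>b\<in>B. f a \<le> g b + e" and "\<And>b. b \<in> B \<Longrightarrow> \<exists>a\<in>A. g b \<le> f a + e"
  shows "\<bar>Max (f ` A) - Max (g ` B)\<bar> \<le> e"
proof -
  have "Max (f ` A) \<le> Max (g ` B) + e"
  proof (rule Max.boundedI)
    fix x assume "x \<in> f ` A"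
    then obtain a where a: "a \<in> A" "x = f a" by auto
    then obtain b where b: "b \<in> B" "f a \<le> g b + e" using assms by auto
    have "g b \<le> Max (g ` B)" using b assms by (intro Max_ge) auto
    then show "x \<le> Max (g ` B) + e" using a b by simp
  qed (use assms in auto)
  moreover have "Max (g ` B) \<le> Max (f ` A) + e"
  proof (rule Max.boundedI)
    fix x assume "x \<in> g ` B"
    then obtain b where b: "b \<in> B" "x = g b" by auto
    then obtain a where a: "a \<in> A" "g b \<le> f a + e" using assms by auto
    have "f a \<le> Max (f ` A)" using a assms by (intro Max_ge) auto
    then show "x \<le> Max (f ` A) + e" using a b by simp
  qed (use assms in auto)
  ultimately show ?thesis by linarith
qed

lemma tendsto_Max_finite:
  fixes f :: "'i \<Rightarrow> 'c \<Rightarrow> real"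
  assumes "finite A" "A \<noteq> {}" "\<And>a. a \<in> A \<Longrightarrow> (f a \<longlongrightarrow> l a) F"
  shows "((\<lambda>x. MAX a\<in>A. f a x) \<longlongrightarrow> (MAX a\<in>A. l a)) F"
  using assms
proof (induction rule: finite_ne_induct)
  case (insert a A)
  have "((\<lambda>x. max (f a x) (MAX a\<in>A. f a x)) \<longlongrightarrow> max (l a) (MAX a\<in>A. l a)) F"
    by (intro tendsto_max insert) auto
  then show ?case using insert.hyps by simp
qed simp

text \<open>The deterministic comparison of all \<open>n\<close> points with the \<open>L\<close> block ends. A block has length
  \<open>m = n div L\<close>, and less than \<open>L\<close> further points follow the last one; as \<open>L \<le> m\<close>, they fit into one more
  block, and this is why the oscillation is assumed for \<open>j = L\<close> as well. The point \<open>k\<close> is compared with the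
  end \<open>k div m\<close>. Four errors of \<open>\<rho>\<close> come from replacing \<open>k\<close> by that block end and \<open>S n\<close> by \<open>S (L * m)\<close>,
  two come from the change of normalisation from \<open>\<surd>n\<close> to \<open>\<surd>(L m)\<close>, and \<open>\<delta>\<close> is due to the drift.\<close>

lemma bridge_discretization_error:
  fixes S :: "nat \<Rightarrow> real" and d :: "real \<Rightarrow> real" and n L :: nat
  defines "m \<equiv> n div L"
  assumes L: "L > 0" and Lm: "L \<le> m" and S0: "S 0 = 0"
    and osc: "\<And>j i. j \<le> L \<Longrightarrow> i \<le> m \<Longrightarrow> \<bar>S (j * m + i) - S (j * m)\<bar> \<le> \<rho> * sqrt n"
    and d: "\<And>s t. s \<in> {0..1} \<Longrightarrow> t \<in> {0..1} \<Longrightarrow> \<bar>s - t\<bar> \<le> 1 / L \<Longrightarrow> \<bar>d s - d t\<bar> \<le> \<delta>"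
  shows "\<bar>(MAX k\<in>{..n}. \<bar>(S k - k / n * S n) / sqrt n + d (k / n)\<bar>)
         - (MAX j\<in>{..L}. \<bar>(S (j * m) - j / L * S (L * m)) / sqrt (L * m) + d (j / L)\<bar>)\<bar> \<le> 6 * \<rho> + \<delta>"
proof -
  define q where "q = sqrt n"
  define p where "p = sqrt (real (L * m))"
  have m: "m > 0" using L Lm by simp
  have nm: "n = L * m + n mod L" by (simp add: m_def)
  have nmod: "n mod L < L" using L by simp
  have Lmn: "L * m \<le> n" "n \<le> L * m + L" using nm nmod by linarith+
  have n: "n > 0" using Lmn m L by (metis less_le_trans nat_0_less_mult_iff)
  have p: "p > 0" and pq: "p \<le> q" and p2: "p\<^sup>2 = L * m" and q2: "q\<^sup>2 = n"
    using m L Lmn by (auto simp: p_def q_def simp del: of_nat_mult)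
  have q: "q > 0" using p pq by simp
  have osc': "\<bar>S (j * m + i) - S (j * m)\<bar> \<le> \<rho> * q" if "j \<le> L" "i \<le> m" for i j
    using osc[OF that] by (simp add: q_def)
  have \<rho>: "\<rho> \<ge> 0" using osc'[of 0 0] q by (simp add: zero_le_mult_iff)
  have Sj: "\<bar>S (j * m)\<bar> \<le> j * \<rho> * q" if "j \<le> L" for j
    using that
  proof (induction j)
    case (Suc j)
    have "\<bar>S (Suc j * m)\<bar> \<le> \<bar>S (j * m)\<bar> + \<bar>S (j * m + m) - S (j * m)\<bar>"
      by (simp add: add.commute)
    also have "\<dots> \<le> j * \<rho> * q + \<rho> * q" using Suc osc'[of j m] by (intro add_mono) auto
    finally show ?case by (simp add: algebra_simps)
  qed (simp add: S0)
  \<comment> \<open>The oscillation bound also controls the walk itself; the factor \<open>L\<close> is absorbed by \<open>1 / L\<close> below.\<close>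
  have SjL: "\<bar>S (j * m)\<bar> \<le> L * \<rho> * q" if "j \<le> L" for j
  proof -
    have "j * \<rho> * q \<le> L * \<rho> * q" using that \<rho> q by (intro mult_right_mono) auto
    then show ?thesis using Sj[OF that] by simp
  qed
  have SnL: "\<bar>S n - S (L * m)\<bar> \<le> \<rho> * q"
    using osc'[of L "n mod L"] nm nmod Lm by simp
  have Sn: "\<bar>S n\<bar> \<le> (L + 1) * \<rho> * q"
    using SjL[of L] SnL by (simp add: algebra_simps)
  \<comment> \<open>Here \<open>q / p - 1 \<le> q\<^sup>2 / p\<^sup>2 - 1 \<le> 1 / m\<close>.\<close>
  have ratio: "L * (q / p - 1) \<le> 1"
  proof -
    have qp: "1 \<le> q / p" using p pq by simp
    have "q / p * 1 \<le> q / p * (q / p)" using qp by (intro mult_left_mono) auto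
    then have "q / p - 1 \<le> q\<^sup>2 / p\<^sup>2 - 1" by (simp add: power2_eq_square)
    also have "\<dots> = (n - real (L * m)) / (L * m)" unfolding p2 q2 using L m by (simp add: field_simps)
    also have "\<dots> \<le> L / (L * m)"
    proof (rule divide_right_mono)
      have "real n \<le> real (L * m + L)" using Lmn(2) by (simp only: of_nat_le_iff)
      then show "real n - real (L * m) \<le> real L" by simp
    qed simp
    also have "\<dots> = 1 / m" using L by simp
    finally have "L * (q / p - 1) \<le> L * (1 / m)" by (intro mult_left_mono) auto
    also have "\<dots> \<le> 1" using Lm m by simp
    finally show ?thesis .
  qed
  define a where "a k = (S k - k / n * S n) / q + d (k / n)" for k :: nat
  define b where "b j = (S (j * m) - j / L * S (L * m)) / p + d (j / L)" for j :: nat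
  have close: "\<bar>a k - b (k div m)\<bar> \<le> 6 * \<rho> + \<delta>" and jL: "k div m \<le> L" if k: "k \<le> n" for k
  proof -
    define j where "j = k div m"
    have "k < (L + 1) * m" using k nm nmod Lm by simp
    then have j: "j \<le> L" unfolding j_def by (metis Suc_eq_plus1 less_Suc_eq_le less_mult_imp_div_less)
    then show "k div m \<le> L" by (simp add: j_def)
    have kj: "k = j * m + k mod m" "k mod m < m" using m by (auto simp: j_def)
    have 1: "\<bar>S k - S (j * m)\<bar> \<le> \<rho> * q" using osc'[of j "k mod m"] j kj by auto
    have kn: "\<bar>real k / n - j / L\<bar> \<le> 1 / L"
    proof -
      have u: "real k / n \<le> j / L + 1 / L"
      proof -
        have "k \<le> j * m + m" using kj by linarith
        then have "real k \<le> real (j * m + m)" by (simp only: of_nat_le_iff)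
        then have "real k / n \<le> real (j * m + m) / n" by (intro divide_right_mono) auto
        also have "\<dots> \<le> real (j * m + m) / real (L * m)" using Lmn L m n by (intro divide_left_mono mult_pos_pos) (auto simp del: of_nat_mult)
        also have "\<dots> = j / L + 1 / L" using m L by (simp add: field_simps)
        finally show ?thesis .
      qed
      have l: "j / L - 1 / L \<le> real k / n"
      proof -
        have "real j * real n \<le> real j * (L * m + L)"
          using Lmn(2) by (intro mult_left_mono) (auto simp only: of_nat_le_iff of_nat_mult[symmetric] of_nat_add[symmetric] of_nat_0_le_iff)
        also have "\<dots> = L * (j * m) + real j * L" by (simp add: algebra_simps)
        also have "\<dots> \<le> L * k + real L * L"
        proof -
          have "j * m \<le> k" using kj(1) by linarith
          then have "L * (j * m) \<le> L * k" "j * L \<le> L * L" using j by (auto intro: mult_le_mono)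
          then show ?thesis by (intro add_mono) (simp_all only: of_nat_le_iff of_nat_mult[symmetric])
        qed
        also have "real L * L \<le> n"
        proof -
          have "L * L \<le> n" using mult_left_mono[OF Lm, of L] Lmn(1) by linarith
          then show ?thesis by (simp only: of_nat_le_iff of_nat_mult[symmetric])
        qed
        finally have "real j * n \<le> L * k + n" by simp
        then have "(real j - 1) * n \<le> k * L" by (simp add: algebra_simps)
        then have "(real j - 1) / L \<le> k / n" using n L by (simp add: divide_simps mult.commute)
        then show ?thesis by (simp add: diff_divide_distrib)
      qed
      from u l show ?thesis by linarith
    qed
    have 2: "\<bar>(real k / n - j / L) * S n\<bar> \<le> 2 * \<rho> * q"
    proof -
      have "\<bar>(real k / n - j / L) * S n\<bar> \<le> 1 / L * ((L + 1) * \<rho> * q)"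
        unfolding abs_mult using kn Sn by (intro mult_mono) auto
      also have "\<dots> = ((real L + 1) / L) * (\<rho> * q)" by simp
      also have "\<dots> \<le> 2 * (\<rho> * q)" using L \<rho> q by (intro mult_right_mono) (auto simp: divide_simps)
      finally show ?thesis by simp
    qed
    have 3: "\<bar>j / L * (S n - S (L * m))\<bar> \<le> \<rho> * q"
    proof -
      have "\<bar>j / L * (S n - S (L * m))\<bar> \<le> 1 * (\<rho> * q)"
        unfolding abs_mult using SnL j L by (intro mult_mono) auto
      then show ?thesis by simp
    qed
    define T where "T = S (j * m) - j / L * S (L * m)"
    have T: "\<bar>T\<bar> \<le> 2 * L * \<rho> * q"
    proof -
      have "\<bar>real j / L * S (L * m)\<bar> \<le> 1 * (L * \<rho> * q)"
        unfolding abs_mult using SjL[of L] j L by (intro mult_mono) auto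
      then have "\<bar>real j / L * S (L * m)\<bar> \<le> L * \<rho> * q" by (simp only: mult_1_left)
      then have "\<bar>T\<bar> \<le> L * \<rho> * q + L * \<rho> * q"
        unfolding T_def mult_1_left by (rule order_trans[OF abs_triangle_ineq4 add_mono[OF SjL[OF j]]])
      then show ?thesis by (simp add: algebra_simps)
    qed
    have 4: "\<bar>T / q - T / p\<bar> \<le> 2 * \<rho>"
    proof -
      have "\<bar>T / q - T / p\<bar> = \<bar>T\<bar> / q * (q / p - 1)"
      proof -
        have "T / q - T / p = - (T / q * (q / p - 1))" using p q by (simp add: field_simps)
        then have "\<bar>T / q - T / p\<bar> = \<bar>T\<bar> / q * \<bar>q / p - 1\<bar>" using q by (simp add: abs_mult)
        also have "\<bar>q / p - 1\<bar> = q / p - 1" using p pq by simp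
        finally show ?thesis .
      qed
      also have "\<dots> \<le> (2 * L * \<rho>) * (q / p - 1)"
        using T p pq q by (intro mult_right_mono) (auto simp: divide_simps)
      also have "\<dots> = 2 * \<rho> * (L * (q / p - 1))" by simp
      also have "\<dots> \<le> 2 * \<rho> * 1" using ratio \<rho> by (intro mult_left_mono) auto
      finally show ?thesis by simp
    qed
    have 5: "\<bar>d (k / n) - d (j / L)\<bar> \<le> \<delta>"
      using kn k n j L by (intro d) auto
    have dec: "a k - b j = ((S k - S (j * m)) - (real k / n - j / L) * S n - j / L * (S n - S (L * m))) / q
        + (T / q - T / p) + (d (k / n) - d (j / L))"
    proof -
      have "(S k - S (j * m)) - (real k / n - j / L) * S n - j / L * (S n - S (L * m)) = (S k - k / n * S n) - T"
        by (simp add: T_def algebra_simps)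
      then show ?thesis unfolding a_def b_def T_def[symmetric] by (simp only: diff_divide_distrib)
    qed
    have tri: "\<bar>x - y - z\<bar> \<le> 4 * \<rho> * q" if "\<bar>x\<bar> \<le> \<rho> * q" "\<bar>y\<bar> \<le> 2 * \<rho> * q" "\<bar>z\<bar> \<le> \<rho> * q" for x y z
      using that by linarith
    have "\<bar>((S k - S (j * m)) - (real k / n - j / L) * S n - j / L * (S n - S (L * m))) / q\<bar> \<le> (4 * \<rho> * q) / q"
      unfolding abs_divide abs_of_pos[OF q] using q by (intro divide_right_mono tri 1 2 3) auto
    then have "\<bar>((S k - S (j * m)) - (real k / n - j / L) * S n - j / L * (S n - S (L * m))) / q\<bar> \<le> 4 * \<rho>" using q by simp
    moreover have "\<bar>x + y + z\<bar> \<le> 6 * \<rho> + \<delta>" if "\<bar>x\<bar> \<le> 4 * \<rho>" "\<bar>y\<bar> \<le> 2 * \<rho>" "\<bar>z\<bar> \<le> \<delta>" for x y z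
      using that by linarith
    ultimately show "\<bar>a k - b (k div m)\<bar> \<le> 6 * \<rho> + \<delta>"
      unfolding j_def[symmetric] dec using 4 5 by blast
  qed
  have "\<bar>(MAX k\<in>{..n}. \<bar>a k\<bar>) - (MAX j\<in>{..L}. \<bar>b j\<bar>)\<bar> \<le> 6 * \<rho> + \<delta>"
  proof (rule Max_diff_le)
    fix k assume "k \<in> {..n}"
    then show "\<exists>j\<in>{..L}. \<bar>a k\<bar> \<le> \<bar>b j\<bar> + (6 * \<rho> + \<delta>)"
      using close[of k] jL[of k] by (intro bexI[of _ "k div m"]) auto
  next
    fix j assume j: "j \<in> {..L}"
    then have "j * m \<le> L * m" by (intro mult_le_mono1) simp
    then have "j * m \<le> n" using Lmn(1) by (rule le_trans)
    then show "\<exists>k\<in>{..n}. \<bar>b j\<bar> \<le> \<bar>a k\<bar> + (6 * \<rho> + \<delta>)"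
      using close[of "j * m"] m by (intro bexI[of _ "j * m"]) auto
  qed auto
  then show ?thesis unfolding a_def b_def q_def p_def by simp
qed


text \<open>Continuity of all paths exhibits the supremum as a limit of grid maxima, which gives its
  measurability.\<close>

lemma bridge_sup_limit:
  fixes d :: "real \<Rightarrow> real" and \<sigma> :: real
  assumes W: "std_brownian_bridge N W" and d: "continuous_on {0..1} d"
  shows "\<And>L::nat. (\<lambda>\<omega>. MAX j\<in>{..Suc L}. \<bar>\<sigma> * W (j / Suc L) \<omega> + d (j / Suc L)\<bar>) \<in> borel_measurable N"
    and "\<And>\<omega>. \<omega> \<in> space N \<Longrightarrow> (\<lambda>L. MAX j\<in>{..Suc L}. \<bar>\<sigma> * W (j / Suc L) \<omega> + d (j / Suc L)\<bar>)
          \<longlonglongrightarrow> (SUP t\<in>{0..1}. \<bar>\<sigma> * W t \<omega> + d t\<bar>)"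
    and "(\<lambda>\<omega>. SUP t\<in>{0..1}. \<bar>\<sigma> * W t \<omega> + d t\<bar>) \<in> borel_measurable N"
proof -
  have Wm: "\<And>t. t \<in> {0..1} \<Longrightarrow> W t \<in> borel_measurable N"
    and Wc: "\<And>\<omega>. \<omega> \<in> space N \<Longrightarrow> continuous_on {0..1} (\<lambda>t. W t \<omega>)"
    using W by (auto simp: std_brownian_bridge_def)
  show m: "(\<lambda>\<omega>. MAX j\<in>{..Suc L}. \<bar>\<sigma> * W (j / Suc L) \<omega> + d (j / Suc L)\<bar>) \<in> borel_measurable N" for L :: nat
  proof (intro borel_measurable_Max)
    fix j assume "j \<in> {..Suc L}"
    then have "W (j / Suc L) \<in> borel_measurable N" by (intro Wm) (auto simp: divide_simps)
    then show "(\<lambda>\<omega>. \<bar>\<sigma> * W (j / Suc L) \<omega> + d (j / Suc L)\<bar>) \<in> borel_measurable N" by measurable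
  qed simp
  show l: "(\<lambda>L. MAX j\<in>{..Suc L}. \<bar>\<sigma> * W (j / Suc L) \<omega> + d (j / Suc L)\<bar>)
          \<longlonglongrightarrow> (SUP t\<in>{0..1}. \<bar>\<sigma> * W t \<omega> + d t\<bar>)" if "\<omega> \<in> space N" for \<omega>
    by (intro continuous_grid_max_tendsto_SUP continuous_intros Wc that d)
  show "(\<lambda>\<omega>. SUP t\<in>{0..1}. \<bar>\<sigma> * W t \<omega> + d t\<bar>) \<in> borel_measurable N"
    by (rule borel_measurable_LIMSEQ_real[OF l m])
qed

context centred_iid_sequence begin

text \<open>The normalised block sums are i.i.d., and the central limit theorem gives their common limit law. The
  grid values of the tied-down walk are continuous functions of them.\<close>

lemma grid_max_weak_conv:
  fixes L :: nat
  assumes W: "std_brownian_bridge N W" and L: "L > 0"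
  shows "weak_conv_m
     (\<lambda>n. distr M borel (\<lambda>\<omega>. MAX j\<in>{..L}.
        \<bar>((\<Sum>i<j * (n div L). X i \<omega>) - j / L * (\<Sum>i<L * (n div L). X i \<omega>)) / sqrt (L * (n div L)) + d (j / L)\<bar>))
     (distr N borel (\<lambda>\<omega>. MAX j\<in>{..L}. \<bar>\<sigma> * W (j / L) \<omega> + d (j / L)\<bar>))"
proof -
  define m where "m n = n div L" for n
  define Y where "Y n i \<omega> = (\<Sum>l<m n. X (i * m n + l) \<omega>) / sqrt (m n * \<sigma>\<^sup>2)" for n i \<omega>
  define G where "G y = (MAX j\<in>{..L}. \<bar>\<sigma> * y j + d (j / L)\<bar>)" for y :: "nat \<Rightarrow> real"
  define V where "V z j = ((\<Sum>i<j. z i) - j / L * (\<Sum>i<L. z i)) / sqrt L" for z and j :: nat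
  define F where "F z = G (\<lambda>j\<in>{..L}. V z j)" for z
  have Gm[measurable]: "G \<in> borel_measurable (PiM {..L} (\<lambda>_. borel))"
    unfolding G_def by measurable
  have zs: "(\<lambda>z. \<Sum>i<j. z i) \<in> borel_measurable (PiM {..<L} (\<lambda>_. borel :: real measure))" if "j \<le> L" for j
  proof (rule borel_measurable_sum)
    fix i assume "i \<in> {..<j}"
    then have "i \<in> {..<L}" using that by auto
    then show "(\<lambda>z. z i) \<in> borel_measurable (PiM {..<L} (\<lambda>_. borel :: real measure))"
      by (rule measurable_component_singleton)
  qed
  have Vm: "(\<lambda>z. \<lambda>j\<in>{..L}. V z j) \<in> measurable (PiM {..<L} (\<lambda>_. borel)) (PiM {..L} (\<lambda>_. borel))"
    unfolding V_def
    by (intro measurable_restrict borel_measurable_divide borel_measurable_diff borel_measurable_times zs) auto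
  have Fm: "F \<in> borel_measurable (PiM {..<L} (\<lambda>_. borel))"
    unfolding F_def using measurable_compose[OF Vm Gm] .
  have Yi: "indep_vars (\<lambda>_. borel) (Y n) {..<L}" for n
  proof -
    let ?K = "\<lambda>i. {i * m n..<i * m n + m n}"
    have "disjoint_family_on ?K {..<L}"
      unfolding disjoint_family_on_def
    proof (intro ballI impI)
      fix i j :: nat assume "i \<noteq> j"
      then have "Suc i \<le> j \<or> Suc j \<le> i" by linarith
      then have "Suc i * m n \<le> j * m n \<or> Suc j * m n \<le> i * m n" using mult_le_mono1 by blast
      then have "i * m n + m n \<le> j * m n \<or> j * m n + m n \<le> i * m n" by (simp add: add.commute)
      then show "?K i \<inter> ?K j = {}" by auto
    qed
    then have "indep_vars (\<lambda>i. PiM (?K i) (\<lambda>_. borel)) (\<lambda>i \<omega>. restrict (\<lambda>l. X l \<omega>) (?K i)) {..<L}"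
      by (intro indep_vars_restrict[OF indep]) auto
    then have "indep_vars (\<lambda>_. borel) (\<lambda>i \<omega>. (\<lambda>x. (\<Sum>l<m n. x (i * m n + l)) / sqrt (m n * \<sigma>\<^sup>2)) (restrict (\<lambda>l. X l \<omega>) (?K i))) {..<L}"
    proof (rule indep_vars_compose2)
      fix i
      show "(\<lambda>x. (\<Sum>l<m n. x (i * m n + l)) / sqrt (m n * \<sigma>\<^sup>2)) \<in> borel_measurable (PiM (?K i) (\<lambda>_. borel))"
        by (intro borel_measurable_divide borel_measurable_sum borel_measurable_const measurable_component_singleton) auto
    qed
    then show ?thesis by (simp add: Y_def[abs_def])
  qed
  define \<mu> where "\<mu> m = distr M borel (\<lambda>\<omega>. (\<Sum>i<m. X i \<omega>) / sqrt (m * \<sigma>\<^sup>2))" for m :: nat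
  have Yl: "distr M borel (Y n i) = \<mu> (m n)" for n i
  proof -
    have "distr M borel (Y n i) = distr (distr M borel (\<lambda>\<omega>. \<Sum>l<m n. X (i * m n + l) \<omega>)) borel (\<lambda>x. x / sqrt (m n * \<sigma>\<^sup>2))"
      by (subst distr_distr) (auto simp: o_def Y_def[abs_def])
    also have "distr M borel (\<lambda>\<omega>. \<Sum>l<m n. X (i * m n + l) \<omega>) = distr M borel (\<lambda>\<omega>. \<Sum>l<m n. X l \<omega>)"
      by (rule sum_law) (auto simp: inj_on_def)
    also have "distr \<dots> borel (\<lambda>x. x / sqrt (m n * \<sigma>\<^sup>2)) = \<mu> (m n)"
      by (subst distr_distr) (auto simp: o_def \<mu>_def)
    finally show ?thesis .
  qed
  have mlim: "filterlim m sequentially sequentially"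
    unfolding m_def using L by (rule filterlim_at_top_div_const_nat)
  have conv: "weak_conv_m (\<lambda>n. \<mu> (m n)) std_normal_distribution"
    using CLT unfolding weak_conv_m_def weak_conv_def \<mu>_def[symmetric]
    by (auto intro: filterlim_compose[OF _ mlim])
  have FY: "F (\<lambda>i\<in>{..<L}. Y n i \<omega>) = (MAX j\<in>{..L}.
        \<bar>((\<Sum>i<j * m n. X i \<omega>) - j / L * (\<Sum>i<L * m n. X i \<omega>)) / sqrt (L * m n) + d (j / L)\<bar>)" for n \<omega>
  proof -
    have part: "(\<Sum>i<j. Y n i \<omega>) = (\<Sum>i<j * m n. X i \<omega>) / (sqrt (m n) * \<sigma>)" for j
    proof -
      have "(\<Sum>i<j. Y n i \<omega>) = (\<Sum>i<j. \<Sum>l = i * m n..<i * m n + m n. X l \<omega>) / (sqrt (m n) * \<sigma>)"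
        using \<sigma>_pos by (simp add: Y_def sum_divide_distrib[symmetric] real_sqrt_mult sum.shift_bounds_nat_ivl[of _ 0 _ "m n", simplified]
           lessThan_atLeast0 sum.atLeastLessThan_shift_0[of "\<lambda>l. X l \<omega>" "_ * m n"])
      then show ?thesis by (simp add: sum.nat_group)
    qed
    have *: "\<sigma> * V (\<lambda>i\<in>{..<L}. Y n i \<omega>) j
       = ((\<Sum>i<j * m n. X i \<omega>) - j / L * (\<Sum>i<L * m n. X i \<omega>)) / sqrt (L * m n)" if "j \<le> L" for j
    proof -
      have "V (\<lambda>i\<in>{..<L}. Y n i \<omega>) j = ((\<Sum>i<j. Y n i \<omega>) - j / L * (\<Sum>i<L. Y n i \<omega>)) / sqrt L"
        unfolding V_def using that by (intro arg_cong2[where f = "(/)"] arg_cong2[where f = "(-)"] arg_cong2[where f = "(*)"] sum.cong) auto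
      also have "\<dots> = (((\<Sum>i<j * m n. X i \<omega>) - j / L * (\<Sum>i<L * m n. X i \<omega>)) / (sqrt (m n) * \<sigma>)) / sqrt L"
        unfolding part by (simp add: diff_divide_distrib)
      finally show ?thesis using \<sigma>_pos by (simp add: real_sqrt_mult mult.commute)
    qed
    show ?thesis unfolding F_def G_def
      by (intro arg_cong[where f = Max] image_cong refl) (simp add: *)
  qed
  have "weak_conv_m (\<lambda>n. distr M borel (\<lambda>\<omega>. F (\<lambda>i\<in>{..<L}. Y n i \<omega>))) (distr (PiM {..<L} (\<lambda>_. std_normal_distribution)) borel F)"
  proof (rule weak_conv_continuous_functional_of_iid[OF prob_space_axioms _ _ Yi Yl real_dist_normal_dist conv Fm])
    fix x :: "nat \<Rightarrow> nat \<Rightarrow> real" and z :: "nat \<Rightarrow> real"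
    assume xz: "\<And>i. i \<in> {..<L} \<Longrightarrow> (\<lambda>n. x n i) \<longlonglongrightarrow> z i"
    have V: "(\<lambda>n. V (restrict (x n) {..<L}) j) \<longlonglongrightarrow> V (restrict z {..<L}) j" if "j \<le> L" for j
      unfolding V_def using L that xz by (intro tendsto_intros) auto
    show "(\<lambda>n. F (restrict (x n) {..<L})) \<longlonglongrightarrow> F (restrict z {..<L})"
      unfolding F_def G_def
    proof (rule tendsto_Max_finite)
      fix j assume "j \<in> {..L}"
      then show "(\<lambda>n. \<bar>\<sigma> * (\<lambda>j\<in>{..L}. V (restrict (x n) {..<L}) j) j + d (j / L)\<bar>)
          \<longlonglongrightarrow> \<bar>\<sigma> * (\<lambda>j\<in>{..L}. V (restrict z {..<L}) j) j + d (j / L)\<bar>"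
        using V[of j] by (simp) (intro tendsto_intros)
    qed auto
  qed (use L in auto)
  also have "distr (PiM {..<L} (\<lambda>_. std_normal_distribution)) borel F = distr N borel (\<lambda>\<omega>. MAX j\<in>{..L}. \<bar>\<sigma> * W (j / L) \<omega> + d (j / L)\<bar>)"
  proof -
    let ?P = "PiM {..<L} (\<lambda>_. std_normal_distribution)"
    have sP: "sets ?P = sets (PiM {..<L} (\<lambda>_. borel))" by (intro sets_PiM_cong) auto
    have Vm': "(\<lambda>z. \<lambda>j\<in>{..L}. V z j) \<in> measurable ?P (PiM {..L} (\<lambda>_. borel))"
      using Vm by (simp add: measurable_cong_sets[OF sP refl])
    have Wm: "(\<lambda>\<omega>. \<lambda>j\<in>{..L}. W (j / L) \<omega>) \<in> measurable N (PiM {..L} (\<lambda>_. borel))"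
      using W L by (intro measurable_restrict) (auto simp: std_brownian_bridge_def)
    have "distr ?P borel F = distr (distr ?P (PiM {..L} (\<lambda>_. borel)) (\<lambda>z. \<lambda>j\<in>{..L}. V z j)) borel G"
      by (subst distr_distr[OF Gm Vm']) (simp add: o_def F_def[abs_def])
    also have "distr ?P (PiM {..L} (\<lambda>_. borel)) (\<lambda>z. \<lambda>j\<in>{..L}. V z j) = distr N (PiM {..L} (\<lambda>_. borel)) (\<lambda>\<omega>. \<lambda>j\<in>{..L}. W (j / L) \<omega>)"
      unfolding V_def by (rule bridge_grid_law[OF W L])
    also have "distr \<dots> borel G = distr N borel (\<lambda>\<omega>. G (\<lambda>j\<in>{..L}. W (j / L) \<omega>))"
      by (subst distr_distr[OF Gm Wm]) (simp add: o_def)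
    also have "(\<lambda>\<omega>. G (\<lambda>j\<in>{..L}. W (j / L) \<omega>)) = (\<lambda>\<omega>. MAX j\<in>{..L}. \<bar>\<sigma> * W (j / L) \<omega> + d (j / L)\<bar>)"
      unfolding G_def by (intro ext arg_cong[where f = Max] image_cong refl) simp
    finally show ?thesis .
  qed
  finally show ?thesis unfolding FY by (simp add: m_def)
qed


lemma initial_partial_sums_negligible:
  fixes m :: "nat \<Rightarrow> nat"
  assumes m: "(\<lambda>n. real (m n) / n) \<longlonglongrightarrow> 0" and \<rho>: "\<rho> > 0"
  shows "(\<lambda>n. prob {\<omega>\<in>space M. \<exists>k\<le>m n. \<rho> * sqrt n \<le> \<bar>\<Sum>i<k. X i \<omega>\<bar>}) \<longlonglongrightarrow> 0"
proof (rule tendsto_sandwich[OF _ _ tendsto_const])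
  have "(\<lambda>n. 8 * \<sigma>\<^sup>2 / \<rho>\<^sup>2 * (real (m n) / n)) \<longlonglongrightarrow> 8 * \<sigma>\<^sup>2 / \<rho>\<^sup>2 * 0"
    by (intro tendsto_intros m)
  then show "(\<lambda>n. 8 * \<sigma>\<^sup>2 / \<rho>\<^sup>2 * (real (m n) / n)) \<longlonglongrightarrow> 0" by simp
  have "\<forall>\<^sub>F n in sequentially. real (m n) / n < \<rho>\<^sup>2 / (8 * \<sigma>\<^sup>2)"
    by (rule order_tendstoD[OF m]) (use \<rho> \<sigma>_pos in simp)
  then show "\<forall>\<^sub>F n in sequentially. prob {\<omega>\<in>space M. \<exists>k\<le>m n. \<rho> * sqrt n \<le> \<bar>\<Sum>i<k. X i \<omega>\<bar>} \<le> 8 * \<sigma>\<^sup>2 / \<rho>\<^sup>2 * (real (m n) / n)"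
    using eventually_gt_at_top[of 0]
  proof eventually_elim
    case (elim n)
    define a where "a = \<rho> * sqrt n / 2"
    have a: "a > 0" using \<rho> elim(2) by (simp add: a_def)
    have a2: "a\<^sup>2 = \<rho>\<^sup>2 * n / 4" by (simp add: a_def power_mult_distrib power_divide)
    have "8 * \<sigma>\<^sup>2 * m n \<le> \<rho>\<^sup>2 * n" using elim \<sigma>_pos by (simp add: divide_simps mult_ac)
    then have am: "2 * m n * \<sigma>\<^sup>2 \<le> a\<^sup>2" unfolding a2 by (simp add: mult_ac)
    have "prob {\<omega>\<in>space M. \<exists>k\<le>m n. \<rho> * sqrt n \<le> \<bar>\<Sum>i<k. X i \<omega>\<bar>} \<le> 2 * prob {\<omega>\<in>space M. a \<le> \<bar>\<Sum>i<m n. X i \<omega>\<bar>}"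
      using maximal_inequality[OF a, of "m n"] am by (simp add: a_def)
    also have "\<dots> \<le> 2 * (m n * \<sigma>\<^sup>2 / a\<^sup>2)" using sum_Chebyshev[of "{..<m n}" a] a by simp
    also have "\<dots> = 8 * \<sigma>\<^sup>2 / \<rho>\<^sup>2 * (real (m n) / n)" unfolding a2 by simp
    finally show ?case .
  qed
qed (auto intro: always_eventually)

text \<open>A bound by the expectation of a bounded continuous function of the normalised sum, since such
  expectations converge under the central limit theorem. The fourth power makes the bound small enough
  to be summed over all blocks.\<close>

lemma block_oscillation_prob:
  fixes m j :: nat
  assumes a: "a > 0" and m: "2 * m * \<sigma>\<^sup>2 \<le> a\<^sup>2" and x: "x > 0" "x * sqrt (m * \<sigma>\<^sup>2) \<le> a"
  shows "prob {\<omega>\<in>space M. \<exists>i\<le>m. 2 * a \<le> \<bar>\<Sum>l<i. X (j * m + l) \<omega>\<bar>}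
      \<le> 2 * expectation (\<lambda>\<omega>. min 1 (((\<Sum>i<m. X i \<omega>) / sqrt (m * \<sigma>\<^sup>2) / x) ^ 4))"
proof (cases "m = 0")
  case True
  then show ?thesis using a by simp
next
  case False
  interpret C: centred_iid_sequence M "\<lambda>l. X (j * m + l)" \<sigma>
    by (rule centred_reindex) (simp add: inj_def)
  let ?Z = "\<lambda>\<omega>. (\<Sum>i<m. X i \<omega>) / sqrt (m * \<sigma>\<^sup>2)"
  have sq: "sqrt (m * \<sigma>\<^sup>2) > 0" using False \<sigma>_pos by simp
  have "prob {\<omega>\<in>space M. \<exists>i\<le>m. 2 * a \<le> \<bar>\<Sum>l<i. X (j * m + l) \<omega>\<bar>} \<le> 2 * prob {\<omega>\<in>space M. a \<le> \<bar>\<Sum>l<m. X (j * m + l) \<omega>\<bar>}"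
    using C.maximal_inequality[OF a, of m] m by simp
  also have "prob {\<omega>\<in>space M. a \<le> \<bar>\<Sum>l<m. X (j * m + l) \<omega>\<bar>} = measure (distr M borel (\<lambda>\<omega>. \<Sum>l<m. X (j * m + l) \<omega>)) {y. a \<le> \<bar>y\<bar>}"
    by (subst measure_distr) (auto simp: vimage_def Int_def conj_commute)
  also have "distr M borel (\<lambda>\<omega>. \<Sum>l<m. X (j * m + l) \<omega>) = distr M borel (\<lambda>\<omega>. \<Sum>l<m. X l \<omega>)"
    by (rule sum_law) (auto simp: inj_on_def)
  also have "measure \<dots> {y. a \<le> \<bar>y\<bar>} = expectation (indicator {\<omega>\<in>space M. a \<le> \<bar>\<Sum>l<m. X l \<omega>\<bar>})"
    by (subst measure_distr) (auto simp: vimage_def Int_def conj_commute)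
  also have "\<dots> \<le> expectation (\<lambda>\<omega>. min 1 ((?Z \<omega> / x) ^ 4))"
  proof (rule integral_mono)
    show "integrable M (indicat_real {\<omega>\<in>space M. a \<le> \<bar>\<Sum>l<m. X l \<omega>\<bar>})"
      by (intro integrable_const_bound[of _ 1]) auto
    show "integrable M (\<lambda>\<omega>. min 1 ((?Z \<omega> / x) ^ 4))"
      by (intro integrable_const_bound[of _ 1]) (auto simp: min_def)
    fix \<omega> assume "\<omega> \<in> space M"
    show "indicator {\<omega>\<in>space M. a \<le> \<bar>\<Sum>l<m. X l \<omega>\<bar>} \<omega> \<le> min 1 ((?Z \<omega> / x) ^ 4)"
    proof (cases "a \<le> \<bar>\<Sum>l<m. X l \<omega>\<bar>")
      case True
      then have "x * sqrt (m * \<sigma>\<^sup>2) \<le> \<bar>\<Sum>l<m. X l \<omega>\<bar>" using x by simp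
      then have "x \<le> \<bar>?Z \<omega>\<bar>" using sq by (simp add: abs_divide pos_le_divide_eq)
      then have "1 \<le> \<bar>?Z \<omega>\<bar> / x" using x(1) by (simp only: pos_le_divide_eq mult_1_left)
      also have "\<dots> = \<bar>?Z \<omega> / x\<bar>" using x(1) by (simp only: abs_divide abs_of_pos)
      finally have "1 \<le> \<bar>?Z \<omega> / x\<bar>" .
      then have "1 \<le> \<bar>?Z \<omega> / x\<bar> ^ 4" by (rule one_le_power)
      then have "1 \<le> (?Z \<omega> / x) ^ 4" by (simp only: power_even_abs_numeral even_numeral)
      then have "min 1 ((?Z \<omega> / x) ^ 4) = 1" by (rule min_absorb1)
      then show ?thesis by (simp only: indicator_le_1)
    next
      case False
      then show ?thesis by simp
    qed
  qed
  finally show ?thesis by simp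
qed

text \<open>Donsker's theorem, for the functional that matters here. Tightness is needed in the form that
  the oscillation within the blocks is small, uniformly over about \<open>L\<close> blocks. The probability of a large
  oscillation in one block is \<open>O(L\<^sup>-\<^sup>2)\<close>: in the limit it is a fourth-moment bound at the level
  \<open>x\<close>, which is of the order \<open>\<surd>L\<close>.\<close>

theorem bridge_invariance_principle:
  assumes W: "std_brownian_bridge N W" and d: "continuous_on {0..1} d"
  shows "weak_conv_m
     (\<lambda>n. distr M borel (\<lambda>\<omega>. MAX k\<in>{..n}. \<bar>((\<Sum>i<k. X i \<omega>) - k / n * (\<Sum>i<n. X i \<omega>)) / sqrt n + d (k / n)\<bar>))
     (distr N borel (\<lambda>\<omega>. SUP t\<in>{0..1}. \<bar>\<sigma> * W t \<omega> + d t\<bar>))"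
proof -
  define T where "T n \<omega> = (MAX k\<in>{..n}. \<bar>((\<Sum>i<k. X i \<omega>) - k / n * (\<Sum>i<n. X i \<omega>)) / sqrt n + d (k / n)\<bar>)" for n :: nat and \<omega>
  define A where "A L n \<omega> = (MAX j\<in>{..Suc L}.
        \<bar>((\<Sum>i<j * (n div Suc L). X i \<omega>) - j / Suc L * (\<Sum>i<Suc L * (n div Suc L). X i \<omega>)) / sqrt (Suc L * (n div Suc L)) + d (j / Suc L)\<bar>)"
    for L n :: nat and \<omega>
  define B where "B L \<omega> = (MAX j\<in>{..Suc L}. \<bar>\<sigma> * W (j / Suc L) \<omega> + d (j / Suc L)\<bar>)" for L :: nat and \<omega>
  have N: "prob_space N" using W by (auto simp: std_brownian_bridge_def)
  have Tm: "T n \<in> borel_measurable M" for n unfolding T_def[abs_def] by measurable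
  have Am: "A L n \<in> borel_measurable M" for L n unfolding A_def[abs_def] by measurable
  have Bm: "B L \<in> borel_measurable N" for L
    unfolding B_def[abs_def] by (rule bridge_sup_limit(1)[OF W d])
  have BY: "(\<lambda>L. B L \<omega>) \<longlonglongrightarrow> (SUP t\<in>{0..1}. \<bar>\<sigma> * W t \<omega> + d t\<bar>)" if "\<omega> \<in> space N" for \<omega>
    unfolding B_def by (rule bridge_sup_limit(2)[OF W d that])
  have Ym: "(\<lambda>\<omega>. SUP t\<in>{0..1}. \<bar>\<sigma> * W t \<omega> + d t\<bar>) \<in> borel_measurable N"
    by (rule bridge_sup_limit(3)[OF W d])
  have "weak_conv_m (\<lambda>n. distr M borel (T n)) (distr N borel (\<lambda>\<omega>. SUP t\<in>{0..1}. \<bar>\<sigma> * W t \<omega> + d t\<bar>))"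
  proof (rule weak_conv_by_approximation[OF prob_space_axioms N Tm Am Ym Bm _ BY])
    show "weak_conv_m (\<lambda>n. distr M borel (A L n)) (distr N borel (B L))" for L
      using grid_max_weak_conv[OF W, of "Suc L" d] unfolding A_def[abs_def] B_def[abs_def] by simp
    fix e :: real assume e: "e > 0"
    \<comment> \<open>This makes the error \<open>6 \<rho> + \<delta>\<close> of \<open>bridge_discretization_error\<close> equal to \<open>e\<close> when \<open>\<delta> = e / 2\<close>.\<close>
    define \<rho> where "\<rho> = e / 12"
    have \<rho>: "\<rho> > 0" using e by (simp add: \<rho>_def)
    have "uniformly_continuous_on {0..1} d" by (rule compact_uniformly_continuous[OF d]) simp
    then obtain \<eta> where \<eta>: "\<eta> > 0" "\<And>s t. s \<in> {0..1} \<Longrightarrow> t \<in> {0..1} \<Longrightarrow> \<bar>s - t\<bar> < \<eta> \<Longrightarrow> \<bar>d s - d t\<bar> < e / 2"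
      using e unfolding uniformly_continuous_on_def dist_real_def by (metis half_gt_zero)
    \<comment> \<open>The three summands make \<open>L\<close> large enough for the continuity of \<open>d\<close>, for
      the hypothesis of the maximal inequality, and for the sum of the block
      probabilities: a standard normal variable has fourth moment \<open>3\<close>, and
      \<open>2 (L + 1) \<cdot> 3 / x\<^sup>4 \<le> 192 \<sigma>\<^sup>4 / (\<rho>\<^sup>4 L)\<close>.\<close>
    define c where "c = 1 / \<eta> + 8 * \<sigma>\<^sup>2 / \<rho>\<^sup>2 + 192 * \<sigma> ^ 4 / (\<rho> ^ 4 * e)"
    obtain L0 :: nat where L0: "c < L0" using reals_Archimedean2 by blast
    show "\<forall>\<^sub>F L in sequentially. \<forall>\<^sub>F n in sequentially. prob {\<omega>\<in>space M. e < \<bar>A L n \<omega> - T n \<omega>\<bar>} \<le> e"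
    proof (rule eventually_sequentiallyI)
      fix L' assume L': "L0 \<le> L'"
      define L where "L = Suc L'"
      have L: "L > 0" and cL: "c < L" using L' L0 by (auto simp: L_def)
      have nn: "0 < 1 / \<eta>" "0 \<le> 8 * \<sigma>\<^sup>2 / \<rho>\<^sup>2" "0 \<le> 192 * \<sigma> ^ 4 / (\<rho> ^ 4 * e)"
        using \<eta> e \<rho> by auto
      have L1: "1 / L < \<eta>"
      proof -
        have "1 / \<eta> < L" using cL nn unfolding c_def by linarith
        then show ?thesis using \<eta> L by (simp add: divide_simps mult.commute)
      qed
      have L2: "8 * \<sigma>\<^sup>2 \<le> L * \<rho>\<^sup>2"
      proof -
        have "8 * \<sigma>\<^sup>2 / \<rho>\<^sup>2 \<le> L" using cL nn unfolding c_def by linarith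
        then show ?thesis using \<rho> by (simp add: pos_divide_le_eq)
      qed
      have L3: "192 * \<sigma> ^ 4 < L * (\<rho> ^ 4 * e)"
      proof -
        have "192 * \<sigma> ^ 4 / (\<rho> ^ 4 * e) < L" using cL nn unfolding c_def by linarith
        then show ?thesis using \<rho> e by (simp add: pos_divide_less_eq)
      qed
      define x where "x = \<rho> * sqrt L / (2 * \<sigma>)"
      have x: "x > 0" using \<rho> L \<sigma>_pos by (simp add: x_def)
      define f where "f y = min 1 ((y / x) ^ 4)" for y :: real
      have fc: "isCont f y" for y unfolding f_def using x by (intro continuous_intros) auto
      have fb: "norm (f y) \<le> 1" for y by (auto simp: f_def min_def)
      have Ef: "integral\<^sup>L std_normal_distribution f \<le> 3 / x ^ 4"
      proof -
        have i4: "integrable std_normal_distribution (\<lambda>y. y ^ 4)" by (rule integrable_std_normal_distribution_moment)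
        have "integral\<^sup>L std_normal_distribution f \<le> integral\<^sup>L std_normal_distribution (\<lambda>y. y ^ 4 / x ^ 4)"
        proof (rule integral_mono)
          interpret S: prob_space std_normal_distribution by (rule prob_space_normal_density) simp
          show "integrable std_normal_distribution f"
            using fb fc by (intro S.integrable_const_bound[of _ 1]) (auto intro!: borel_measurable_continuous_onI continuous_at_imp_continuous_on)
          show "integrable std_normal_distribution (\<lambda>y. y ^ 4 / x ^ 4)" using i4 by simp
        qed (simp add: f_def power_divide)
        also have "\<dots> = 3 / x ^ 4"
          using std_normal_distribution_even_moments(1)[of 2] by (simp add: fact_numeral)
        finally show ?thesis .
      qed
      have small: "2 * (L + 1) * (3 / x ^ 4) < e"
      proof -
        have x4: "x ^ 4 = \<rho> ^ 4 * real L ^ 2 / (16 * \<sigma> ^ 4)"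
        proof -
          have "sqrt L ^ 4 = (sqrt L ^ 2) ^ 2" using power_mult[of "sqrt L" 2 2] by simp
          also have "\<dots> = real L ^ 2" by simp
          finally show ?thesis by (simp add: x_def power_mult_distrib power_divide)
        qed
        have "2 * (real L + 1) * (3 / x ^ 4) \<le> 4 * real L * (3 / x ^ 4)"
          using x L by (intro mult_right_mono) auto
        also have "\<dots> = 192 * \<sigma> ^ 4 / (\<rho> ^ 4 * real L)"
          unfolding x4 using \<rho> L \<sigma>_pos by (simp add: field_simps power2_eq_square)
        also have "\<dots> < e" using L3 \<rho> L by (simp add: pos_divide_less_eq mult_ac)
        finally show ?thesis by (simp add: add.commute)
      qed
      define m where "m n = n div L" for n
      have mlim: "filterlim m sequentially sequentially"
        unfolding m_def using L by (rule filterlim_at_top_div_const_nat)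
      define E where "E m = expectation (\<lambda>\<omega>. f ((\<Sum>i<m. X i \<omega>) / sqrt (m * \<sigma>\<^sup>2)))" for m :: nat
      have "(\<lambda>m. integral\<^sup>L (distr M borel (\<lambda>\<omega>. (\<Sum>i<m. X i \<omega>) / sqrt (m * \<sigma>\<^sup>2))) f) \<longlonglongrightarrow> integral\<^sup>L std_normal_distribution f"
        by (rule weak_conv_imp_integral_bdd_continuous_conv[OF _ real_dist_normal_dist CLT fc fb])
           (intro real_distribution_distr, simp)
      moreover have "f \<in> borel_measurable borel"
        using fc by (auto intro!: borel_measurable_continuous_onI continuous_at_imp_continuous_on)
      ultimately have "E \<longlonglongrightarrow> integral\<^sup>L std_normal_distribution f"
        unfolding E_def by (subst (asm) integral_distr) simp_all
      then have "(\<lambda>n. 2 * (L + 1) * E (m n)) \<longlonglongrightarrow> 2 * (L + 1) * integral\<^sup>L std_normal_distribution f"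
        by (intro tendsto_mult tendsto_const filterlim_compose[OF _ mlim])
      moreover have "2 * (L + 1) * integral\<^sup>L std_normal_distribution f < e"
        using mult_left_mono[OF Ef, of "2 * (1 + real L)"] small by simp
      ultimately have ev1: "\<forall>\<^sub>F n in sequentially. 2 * (L + 1) * E (m n) < e"
        by (rule order_tendstoD)
      have ev2: "\<forall>\<^sub>F n in sequentially. L \<le> m n"
        using mlim by (simp add: filterlim_at_top)
      show "\<forall>\<^sub>F n in sequentially. prob {\<omega>\<in>space M. e < \<bar>A L' n \<omega> - T n \<omega>\<bar>} \<le> e"
        using ev1 ev2
      proof eventually_elim
        case (elim n)
        define a where "a = \<rho> * sqrt n / 2"
        have mn: "L * m n \<le> n" by (simp add: m_def)
        have n: "n > 0" using mn elim(2) L by (metis less_le_trans nat_0_less_mult_iff)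
        have a: "a > 0" using \<rho> n by (simp add: a_def)
        have Lmn: "real L * m n \<le> n" using mn by (simp only: of_nat_le_iff of_nat_mult[symmetric])
        have a2: "a\<^sup>2 = \<rho>\<^sup>2 * n / 4" by (simp add: a_def power_mult_distrib power_divide)
        have am: "2 * m n * \<sigma>\<^sup>2 \<le> a\<^sup>2"
        proof -
          have "8 * \<sigma>\<^sup>2 * m n \<le> L * \<rho>\<^sup>2 * m n" using L2 by (intro mult_right_mono) auto
          also have "\<dots> \<le> \<rho>\<^sup>2 * n" using mult_left_mono[OF Lmn, of "\<rho>\<^sup>2"] by (simp add: mult_ac)
          finally show ?thesis unfolding a2 by (simp add: mult_ac)
        qed
        have ax: "x * sqrt (m n * \<sigma>\<^sup>2) \<le> a"
        proof -
          have "x * sqrt (m n * \<sigma>\<^sup>2) = \<rho> / 2 * sqrt (real L * m n)"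
            using \<sigma>_pos by (simp add: x_def real_sqrt_mult)
          also have "\<dots> \<le> \<rho> / 2 * sqrt n" using Lmn \<rho> by (intro mult_left_mono real_sqrt_le_mono) auto
          finally show ?thesis by (simp add: a_def)
        qed
        define Osc where "Osc j = {\<omega>\<in>space M. \<exists>i\<le>m n. 2 * a \<le> \<bar>\<Sum>l<i. X (j * m n + l) \<omega>\<bar>}" for j
        have Osc_meas: "Osc j \<in> events" for j unfolding Osc_def by measurable
        have pOsc: "prob (Osc j) \<le> 2 * E (m n)" for j
          unfolding Osc_def E_def f_def by (rule block_oscillation_prob[OF a am x ax])
        have "{\<omega>\<in>space M. e < \<bar>A L' n \<omega> - T n \<omega>\<bar>} \<subseteq> (\<Union>j\<le>L. Osc j)"
        proof
          fix \<omega> assume w: "\<omega> \<in> {\<omega>\<in>space M. e < \<bar>A L' n \<omega> - T n \<omega>\<bar>}"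
          show "\<omega> \<in> (\<Union>j\<le>L. Osc j)"
          proof (rule ccontr)
            assume no: "\<omega> \<notin> (\<Union>j\<le>L. Osc j)"
            define S where "S k = (\<Sum>i<k. X i \<omega>)" for k
            have "\<bar>T n \<omega> - A L' n \<omega>\<bar> \<le> 6 * \<rho> + e / 2"
              unfolding T_def A_def S_def[symmetric] L_def[symmetric]
            proof (rule bridge_discretization_error)
              show "L > 0" "L \<le> n div L" using L elim(2) by (auto simp: m_def)
              show "S 0 = 0" by (simp add: S_def)
              show "\<bar>d s - d t\<bar> \<le> e / 2" if "s \<in> {0..1}" "t \<in> {0..1}" "\<bar>s - t\<bar> \<le> 1 / L" for s t
                using \<eta>(2)[of s t] that L1 by auto
              fix j i assume j: "j \<le> L" and i: "i \<le> n div L"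
              have "{..<j * (n div L) + i} = {..<j * (n div L)} \<union> {j * (n div L)..<j * (n div L) + i}" by auto
              then have "S (j * (n div L) + i) - S (j * (n div L)) = (\<Sum>l = j * (n div L)..<j * (n div L) + i. X l \<omega>)"
                unfolding S_def by (simp add: sum.union_disjoint ivl_disj_int)
              also have "\<dots> = (\<Sum>l<i. X (j * (n div L) + l) \<omega>)"
                by (simp add: sum.atLeastLessThan_shift_0[of _ "j * (n div L)"] lessThan_atLeast0)
              finally show "\<bar>S (j * (n div L) + i) - S (j * (n div L))\<bar> \<le> \<rho> * sqrt n"
                using no w j i by (force simp: Osc_def m_def a_def)
            qed
            then show False using w by (auto simp: \<rho>_def)
          qed
        qed
        then have "prob {\<omega>\<in>space M. e < \<bar>A L' n \<omega> - T n \<omega>\<bar>} \<le> prob (\<Union>j\<le>L. Osc j)"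
          using Osc_meas by (intro finite_measure_mono) auto
        also have "\<dots> \<le> (\<Sum>j\<le>L. prob (Osc j))"
          using Osc_meas by (intro finite_measure_subadditive_finite) auto
        also have "\<dots> \<le> (\<Sum>j\<le>L. 2 * E (m n))" by (intro sum_mono pOsc)
        also have "\<dots> = 2 * (L + 1) * E (m n)" by (simp add: algebra_simps)
        also have "\<dots> \<le> e" using elim(1) by simp
        finally show ?case .
      qed
    qed
  qed
  then show ?thesis unfolding T_def[abs_def] .
qed

end

section \<open>Two-sample sums of an integrable kernel\<close>

context iid_sequence begin

abbreviation "law \<equiv> distr M borel (X 0)"

lemma pair_law:
  assumes "i \<noteq> j"
  shows "distr M (borel \<Otimes>\<^sub>M borel) (\<lambda>\<omega>. (X i \<omega>, X j \<omega>)) = law \<Otimes>\<^sub>M law"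
  using indep_pair[OF assms] ident[of i] ident[of j] by (simp add: indep_var_distribution_eq)

lemma pair_kernel:
  assumes [measurable]: "case_prod H \<in> borel_measurable (borel \<Otimes>\<^sub>M borel)" and ij: "i \<noteq> j"
  shows integrable_pair: "integrable M (\<lambda>\<omega>. H (X i \<omega>) (X j \<omega>) :: real) \<longleftrightarrow> integrable (law \<Otimes>\<^sub>M law) (case_prod H)"
    and expectation_pair: "expectation (\<lambda>\<omega>. H (X i \<omega>) (X j \<omega>)) = (\<integral>z. case_prod H z \<partial>(law \<Otimes>\<^sub>M law))"
proof -
  show "integrable M (\<lambda>\<omega>. H (X i \<omega>) (X j \<omega>) :: real) \<longleftrightarrow> integrable (law \<Otimes>\<^sub>M law) (case_prod H)"
    unfolding pair_law[OF ij, symmetric] by (subst integrable_distr_eq) auto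
  show "expectation (\<lambda>\<omega>. H (X i \<omega>) (X j \<omega>)) = (\<integral>z. case_prod H z \<partial>(law \<Otimes>\<^sub>M law))"
    unfolding pair_law[OF ij, symmetric] by (subst integral_distr) auto
qed

lemma measurable_pair:
  assumes "case_prod H \<in> borel_measurable (borel \<Otimes>\<^sub>M borel)"
  shows "(\<lambda>\<omega>. H (X i \<omega>) (X j \<omega>)) \<in> borel_measurable M"
  using measurable_compose[OF _ assms, of "\<lambda>\<omega>. (X i \<omega>, X j \<omega>)" M] by simp

lemma uncorrelated_disjoint_pairs:
  fixes h :: "real \<Rightarrow> real \<Rightarrow> real"
  assumes h: "case_prod h \<in> borel_measurable (borel \<Otimes>\<^sub>M borel)"
    and bound: "\<And>x y. \<bar>h x y\<bar> \<le> K" and mean: "expectation (\<lambda>\<omega>. h (X 0 \<omega>) (X 1 \<omega>)) = 0"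
    and ne: "i \<noteq> j" "i' \<noteq> j'" "{i, j} \<inter> {i', j'} = {}"
  shows "expectation (\<lambda>\<omega>. h (X i \<omega>) (X j \<omega>) * h (X i' \<omega>) (X j' \<omega>)) = 0"
proof -
  have m: "(\<lambda>x. h (x a) (x b)) \<in> borel_measurable (PiM {a, b} (\<lambda>_. borel))" for a b :: nat
  proof -
    have "(\<lambda>x. (x a, x b)) \<in> measurable (PiM {a, b} (\<lambda>_. borel)) (borel \<Otimes>\<^sub>M borel :: (real \<times> real) measure)"
      by (intro measurable_Pair measurable_component_singleton) auto
    from measurable_compose[OF this h] show ?thesis by simp
  qed
  have "indep_var (PiM {i, j} (\<lambda>_. borel)) (\<lambda>\<omega>. restrict (\<lambda>i. X i \<omega>) {i, j}) (PiM {i', j'} (\<lambda>_. borel)) (\<lambda>\<omega>. restrict (\<lambda>i. X i \<omega>) {i', j'})"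
    using ne by (intro indep_var_restrict[OF indep]) auto
  then have "indep_var borel ((\<lambda>x. h (x i) (x j)) \<circ> (\<lambda>\<omega>. restrict (\<lambda>i. X i \<omega>) {i, j})) borel ((\<lambda>x. h (x i') (x j')) \<circ> (\<lambda>\<omega>. restrict (\<lambda>i. X i \<omega>) {i', j'}))"
    by (rule indep_var_compose) (rule m)+
  then have iv: "indep_var borel (\<lambda>\<omega>. h (X i \<omega>) (X j \<omega>)) borel (\<lambda>\<omega>. h (X i' \<omega>) (X j' \<omega>))"
    by (simp add: o_def)
  have int: "integrable M (\<lambda>\<omega>. h (X a \<omega>) (X b \<omega>))" for a b
    using bound measurable_pair[OF h] by (intro integrable_const_bound[of _ K]) auto
  have "expectation (\<lambda>\<omega>. h (X i \<omega>) (X j \<omega>)) = 0"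
    using expectation_pair[OF h ne(1)] expectation_pair[OF h, of 0 1] mean by simp
  then show ?thesis using indep_var_lebesgue_integral[OF iv int int] by simp
qed

text \<open>Among the pairs of index pairs, only those with a common index contribute.\<close>

lemma bounded_two_sample_second_moment:
  fixes h :: "real \<Rightarrow> real \<Rightarrow> real"
  assumes h: "case_prod h \<in> borel_measurable (borel \<Otimes>\<^sub>M borel)"
    and bound: "\<And>x y. \<bar>h x y\<bar> \<le> K" and mean: "expectation (\<lambda>\<omega>. h (X 0 \<omega>) (X 1 \<omega>)) = 0"
    and A: "finite A" and B: "finite B" and AB: "A \<inter> B = {}"
  shows "integrable M (\<lambda>\<omega>. (\<Sum>i\<in>A. \<Sum>j\<in>B. h (X i \<omega>) (X j \<omega>))\<^sup>2)"
    and "expectation (\<lambda>\<omega>. (\<Sum>i\<in>A. \<Sum>j\<in>B. h (X i \<omega>) (X j \<omega>))\<^sup>2) \<le> K\<^sup>2 * (card A * card B * (card A + card B))"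
proof -
  let ?h = "\<lambda>p \<omega>. h (X (fst p) \<omega>) (X (snd p) \<omega>)" and ?C = "A \<times> B"
  have K: "K \<ge> 0" using bound[of 0 0] by simp
  have s: "(\<Sum>i\<in>A. \<Sum>j\<in>B. h (X i \<omega>) (X j \<omega>))\<^sup>2 = (\<Sum>p\<in>?C. \<Sum>p'\<in>?C. ?h p \<omega> * ?h p' \<omega>)" for \<omega>
    by (simp add: sum.cartesian_product case_prod_beta power2_eq_square sum_product)
  have pb: "\<bar>?h p \<omega> * ?h p' \<omega>\<bar> \<le> K\<^sup>2" for p p' \<omega>
    unfolding abs_mult power2_eq_square using bound K by (intro mult_mono) auto
  have hm: "?h p \<in> borel_measurable M" for p by (rule measurable_pair[OF h])
  have int: "integrable M (\<lambda>\<omega>. ?h p \<omega> * ?h p' \<omega>)" for p p'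
    using pb hm by (intro integrable_const_bound[of _ "K\<^sup>2"]) auto
  show "integrable M (\<lambda>\<omega>. (\<Sum>i\<in>A. \<Sum>j\<in>B. h (X i \<omega>) (X j \<omega>))\<^sup>2)"
    unfolding s by (intro Bochner_Integration.integrable_sum int)
  have e: "expectation (\<lambda>\<omega>. ?h p \<omega> * ?h p' \<omega>) \<le> K\<^sup>2 * ((if fst p' = fst p then 1 else 0) + (if snd p' = snd p then 1 else 0))"
    if "p \<in> ?C" "p' \<in> ?C" for p p'
  proof (cases "fst p' = fst p \<or> snd p' = snd p")
    case True
    have "expectation (\<lambda>\<omega>. ?h p \<omega> * ?h p' \<omega>) \<le> expectation (\<lambda>\<omega>. K\<^sup>2)"
      using pb[of p _ p'] by (intro integral_mono int integrable_const) (simp add: abs_le_iff)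
    also have "\<dots> = K\<^sup>2 * 1" by (simp add: prob_space)
    also have "\<dots> \<le> K\<^sup>2 * ((if fst p' = fst p then 1 else 0) + (if snd p' = snd p then 1 else 0))"
      using True by (intro mult_left_mono) auto
    finally show ?thesis .
  next
    case False
    then have "expectation (\<lambda>\<omega>. ?h p \<omega> * ?h p' \<omega>) = 0"
      using that AB by (intro uncorrelated_disjoint_pairs[OF h bound mean]) auto
    then show ?thesis by simp
  qed
  have c: "(\<Sum>p'\<in>?C. (if fst p' = fst p then 1 else 0) + (if snd p' = snd p then 1 else 0)) = real (card A + card B)"
    if "p \<in> ?C" for p
  proof -
    have "(\<Sum>p'\<in>?C. (if fst p' = fst p then 1 else 0)) = (\<Sum>i\<in>A. \<Sum>j\<in>B. if i = fst p then 1 else (0::real))"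
      by (subst sum.cartesian_product) (auto intro!: sum.cong)
    also have "\<dots> = card B" using that A by (subst sum.swap) auto
    finally have 1: "(\<Sum>p'\<in>?C. (if fst p' = fst p then 1 else 0)) = real (card B)" .
    have "(\<Sum>p'\<in>?C. (if snd p' = snd p then 1 else 0)) = (\<Sum>i\<in>A. \<Sum>j\<in>B. if j = snd p then 1 else (0::real))"
      by (subst sum.cartesian_product) (auto intro!: sum.cong)
    also have "\<dots> = card A" using that B by auto
    finally have 2: "(\<Sum>p'\<in>?C. (if snd p' = snd p then 1 else 0)) = real (card A)" .
    show ?thesis unfolding sum.distrib 1 2 by simp
  qed
  have "expectation (\<lambda>\<omega>. (\<Sum>i\<in>A. \<Sum>j\<in>B. h (X i \<omega>) (X j \<omega>))\<^sup>2) = (\<Sum>p\<in>?C. \<Sum>p'\<in>?C. expectation (\<lambda>\<omega>. ?h p \<omega> * ?h p' \<omega>))"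
    unfolding s by (simp add: Bochner_Integration.integral_sum int)
  also have "\<dots> \<le> (\<Sum>p\<in>?C. \<Sum>p'\<in>?C. K\<^sup>2 * ((if fst p' = fst p then 1 else 0) + (if snd p' = snd p then 1 else 0)))"
    by (intro sum_mono e)
  also have "\<dots> = (\<Sum>p\<in>?C. K\<^sup>2 * (card A + card B))"
    unfolding sum_distrib_left[symmetric] by (intro sum.cong refl arg_cong2[where f = "(*)"] c)
  also have "\<dots> = K\<^sup>2 * (card A * card B * (card A + card B))" by (simp add: card_cartesian_product)
  finally show "expectation (\<lambda>\<omega>. (\<Sum>i\<in>A. \<Sum>j\<in>B. h (X i \<omega>) (X j \<omega>))\<^sup>2) \<le> K\<^sup>2 * (card A * card B * (card A + card B))" by simp
qed

end

text \<open>Rounding down the corner of a rectangle to a grid of \<open>L\<close> by \<open>L\<close> points changes the sum of a bounded array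
  by at most a fraction \<open>4 / L\<close> of the trivial bound. The column bound \<open>q\<close> is not rounded below \<open>m\<close>, which
  keeps the row and column indices disjoint.\<close>

lemma rectangle_sum_rounding:
  fixes h :: "nat \<Rightarrow> nat \<Rightarrow> real" and L m n p q :: nat
  assumes h: "\<And>i j. \<bar>h i j\<bar> \<le> K" and L: "0 < L" "L \<le> m" and mn: "m \<le> n"
    and p: "p \<le> m" and q: "m \<le> q" "q \<le> n"
  defines "b \<equiv> m div L + 1" and "b' \<equiv> n div L + 1"
  shows "p div b < L" "q div b' < L"
    and "\<bar>(\<Sum>i<p. \<Sum>j=q..<n. h i j) - (\<Sum>i<p div b * b. \<Sum>j=max m (q div b' * b')..<n. h i j)\<bar> \<le> 4 * K * m * n / L"
proof -
  have K: "K \<ge> 0" using h[of 0 0] by simp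
  have bnd: "x < L * (x div L + 1)" for x
    using L by (simp add: dividend_less_times_div)
  show "p div b < L" unfolding b_def using p bnd[of m] by (intro less_mult_imp_div_less) simp
  show "q div b' < L" unfolding b'_def using q bnd[of n] by (intro less_mult_imp_div_less) simp
  have size: "real (x div L + 1) \<le> 2 * x / L" if "L \<le> x" for x
  proof -
    have "L * (x div L + 1) \<le> 2 * x" 
    proof -
      have "L * (x div L) \<le> x" by simp
      then show ?thesis using that by (simp only: distrib_left mult_1_right)
    qed
    then have "real (L * (x div L + 1)) \<le> real (2 * x)" by (simp only: of_nat_le_iff)
    then have "real (x div L + 1) * real L \<le> 2 * real x" by (simp only: of_nat_mult of_nat_numeral mult.commute)
    then show ?thesis using L by (simp only: pos_le_divide_eq of_nat_0_less_iff)
  qed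
  define p' where "p' = p div b * b"
  define q' where "q' = max m (q div b' * b')"
  have p': "p' \<le> p" "p - p' \<le> b"
  proof -
    show "p' \<le> p" unfolding p'_def by (rule div_times_less_eq_dividend)
    have "p - p' = p mod b" by (simp only: p'_def minus_div_mult_eq_mod)
    moreover have "p mod b < b" by (rule mod_less_divisor) (simp add: b_def)
    ultimately show "p - p' \<le> b" by simp
  qed
  have q': "q' \<le> q" "q - q' \<le> b'"
  proof -
    show "q' \<le> q" using q by (simp add: q'_def)
    have "q - q div b' * b' = q mod b'" by (rule minus_div_mult_eq_mod)
    moreover have "q mod b' < b'" by (rule mod_less_divisor) (simp add: b'_def)
    ultimately show "q - q' \<le> b'" by (auto simp: q'_def)
  qed
  have absle: "\<bar>\<Sum>i\<in>I. \<Sum>j\<in>J. h i j\<bar> \<le> K * (card I * card J)" for I J :: "nat set"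
  proof -
    have "\<bar>\<Sum>i\<in>I. \<Sum>j\<in>J. h i j\<bar> \<le> (\<Sum>i\<in>I. \<Sum>j\<in>J. K)"
      by (intro order_trans[OF sum_abs] sum_mono h) 
    then show ?thesis by (simp add: mult_ac)
  qed
  have e1: "(\<Sum>i<p. \<Sum>j=q..<n. h i j) = (\<Sum>i<p'. \<Sum>j=q..<n. h i j) + (\<Sum>i=p'..<p. \<Sum>j=q..<n. h i j)"
    using p' by (simp add: lessThan_atLeast0 sum.atLeastLessThan_concat)
  have e2: "(\<Sum>i<p'. \<Sum>j=q'..<n. h i j) = (\<Sum>i<p'. \<Sum>j=q'..<q. h i j) + (\<Sum>i<p'. \<Sum>j=q..<n. h i j)"
    using q' q by (simp add: sum.distrib[symmetric] sum.atLeastLessThan_concat)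
  have "\<bar>(\<Sum>i<p. \<Sum>j=q..<n. h i j) - (\<Sum>i<p'. \<Sum>j=q'..<n. h i j)\<bar>
      \<le> \<bar>\<Sum>i=p'..<p. \<Sum>j=q..<n. h i j\<bar> + \<bar>\<Sum>i<p'. \<Sum>j=q'..<q. h i j\<bar>"
    unfolding e1 e2 by linarith
  also have "\<dots> \<le> K * (real (p - p') * real (n - q)) + K * (real p' * real (q - q'))"
    by (rule add_mono[OF order_trans[OF absle] order_trans[OF absle]]) simp_all
  also have "\<dots> \<le> K * ((2 * m / L) * n) + K * (m * (2 * n / L))"
  proof (intro add_mono mult_left_mono mult_mono K)
    have "real (p - p') \<le> real b" using p' by simp
    then show "real (p - p') \<le> 2 * m / L" using size[OF L(2)] by (simp add: b_def)
    have "real (q - q') \<le> real b'" using q' by simp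
    then show "real (q - q') \<le> 2 * n / L" using size[of n] L mn by (simp add: b'_def)
  qed (use p p' in auto)
  also have "\<dots> = 4 * K * m * n / L" by (simp add: field_simps)
  finally show "\<bar>(\<Sum>i<p. \<Sum>j=q..<n. h i j) - (\<Sum>i<p div b * b. \<Sum>j=max m (q div b' * b')..<n. h i j)\<bar> \<le> 4 * K * m * n / L"
    by (simp add: p'_def q'_def)
qed


context iid_sequence begin

text \<open>The truncated and centred kernel is bounded, so Chebyshev's inequality on a finite grid of rectangles
  and \<open>rectangle_sum_rounding\<close> between the grid points give uniformity. The truncation error is bounded
  for all rectangles at once by its sum over the largest one, whose mean is small.\<close>

theorem uniform_two_sample_LLN:
  fixes H :: "real \<Rightarrow> real \<Rightarrow> real" and m :: "nat \<Rightarrow> nat" and \<epsilon> :: real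
  assumes H: "case_prod H \<in> borel_measurable (borel \<Otimes>\<^sub>M borel)"
    and int: "integrable M (\<lambda>\<omega>. H (X 0 \<omega>) (X 1 \<omega>))"
    and mn: "\<forall>\<^sub>F n in sequentially. m n \<le> n" and mlim: "filterlim m at_top sequentially" and \<epsilon>: "\<epsilon> > 0"
  defines "u \<equiv> expectation (\<lambda>\<omega>. H (X 0 \<omega>) (X 1 \<omega>))"
  shows "(\<lambda>n. prob {\<omega>\<in>space M. \<exists>p\<le>m n. \<exists>q\<in>{m n..n}. \<epsilon> * m n * n < \<bar>\<Sum>i<p. \<Sum>j=q..<n. H (X i \<omega>) (X j \<omega>) - u\<bar>}) \<longlonglongrightarrow> 0"
proof (rule tendstoI)
  fix \<gamma> :: real assume \<gamma>: "\<gamma> > 0"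
  define trunc where "trunc K x = max (- K) (min K x)" for K x :: real
  have trunc_meas[measurable]: "trunc K \<in> borel_measurable borel" for K unfolding trunc_def[abs_def] by measurable
  have trunc_bound: "\<bar>trunc K x\<bar> \<le> K" if "K \<ge> 0" for K x using that by (auto simp: trunc_def)
  have trunc_diff: "\<bar>x - trunc K x\<bar> \<le> \<bar>x\<bar>" if "K \<ge> 0" for K x using that by (auto simp: trunc_def)
  have Hm: "(\<lambda>\<omega>. H (X i \<omega>) (X j \<omega>)) \<in> borel_measurable M" for i j by (rule measurable_pair[OF H])
  note Hm[measurable]
  have "(\<lambda>K::nat. expectation (\<lambda>\<omega>. \<bar>H (X 0 \<omega>) (X 1 \<omega>) - trunc K (H (X 0 \<omega>) (X 1 \<omega>))\<bar>)) \<longlonglongrightarrow> expectation (\<lambda>\<omega>. 0)"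
  proof (rule integral_dominated_convergence[where w = "\<lambda>\<omega>. \<bar>H (X 0 \<omega>) (X 1 \<omega>)\<bar>"])
    have "(\<lambda>K::nat. \<bar>x - trunc K x\<bar>) \<longlonglongrightarrow> 0" for x
    proof (rule tendsto_eventually)
      obtain K0 :: nat where "\<bar>x\<bar> < K0" using reals_Archimedean2 by blast
      then show "\<forall>\<^sub>F K::nat in sequentially. \<bar>x - trunc K x\<bar> = 0"
        by (intro eventually_sequentiallyI[of K0]) (auto simp: trunc_def)
    qed
    then show "AE \<omega> in M. (\<lambda>K::nat. \<bar>H (X 0 \<omega>) (X 1 \<omega>) - trunc K (H (X 0 \<omega>) (X 1 \<omega>))\<bar>) \<longlonglongrightarrow> 0" by auto
    show "AE \<omega> in M. norm \<bar>H (X 0 \<omega>) (X 1 \<omega>) - trunc (real K) (H (X 0 \<omega>) (X 1 \<omega>))\<bar> \<le> \<bar>H (X 0 \<omega>) (X 1 \<omega>)\<bar>" for K :: nat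
      by (simp add: trunc_diff)
  qed (use int in auto)
  then have lim0: "(\<lambda>K::nat. expectation (\<lambda>\<omega>. \<bar>H (X 0 \<omega>) (X 1 \<omega>) - trunc K (H (X 0 \<omega>) (X 1 \<omega>))\<bar>)) \<longlonglongrightarrow> 0" by simp
  \<comment> \<open>The first bound controls the shift of the mean, the second one makes the
    truncation error exceed \<open>\<epsilon> / 4 * m n * n\<close> with probability at most \<open>\<gamma> / 4\<close>.\<close>
  define \<eta> where "\<eta> = min (\<epsilon> / 4) (\<gamma> * \<epsilon> / 16)"
  have \<eta>: "\<eta> > 0" "\<eta> \<le> \<epsilon> / 4" "\<eta> \<le> \<gamma> * \<epsilon> / 16" using \<epsilon> \<gamma> by (auto simp: \<eta>_def)
  obtain K :: nat where K: "expectation (\<lambda>\<omega>. \<bar>H (X 0 \<omega>) (X 1 \<omega>) - trunc K (H (X 0 \<omega>) (X 1 \<omega>))\<bar>) < \<eta>"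
    using order_tendstoD(2)[OF lim0 \<eta>(1)] unfolding eventually_sequentially by blast
  define T where "T x y = trunc K (H x y)" for x y
  define uT where "uT = expectation (\<lambda>\<omega>. T (X 0 \<omega>) (X 1 \<omega>))"
  define h where "h x y = T x y - uT" for x y
  define Q where "Q x y = \<bar>H x y - T x y\<bar>" for x y
  have TmP: "case_prod T \<in> borel_measurable (borel \<Otimes>\<^sub>M borel)"
  proof -
    have "case_prod T = (\<lambda>z. trunc K (case_prod H z))" by (auto simp: T_def)
    then show ?thesis using measurable_compose[OF H trunc_meas] by simp
  qed
  have hmP: "case_prod h \<in> borel_measurable (borel \<Otimes>\<^sub>M borel)"
  proof -
    have "case_prod h = (\<lambda>z. case_prod T z - uT)" by (auto simp: h_def)
    then show ?thesis using TmP by simp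
  qed
  have QmP: "case_prod Q \<in> borel_measurable (borel \<Otimes>\<^sub>M borel)"
  proof -
    have "case_prod Q = (\<lambda>z. \<bar>case_prod H z - case_prod T z\<bar>)" by (auto simp: Q_def)
    then show ?thesis using TmP H by simp
  qed
  note meas[measurable] = measurable_pair[OF TmP] measurable_pair[OF hmP] measurable_pair[OF QmP]
  have Tb: "\<bar>T x y\<bar> \<le> K" for x y by (simp add: T_def trunc_bound)
  have Tint: "integrable M (\<lambda>\<omega>. T (X 0 \<omega>) (X 1 \<omega>))"
    using Tb by (intro integrable_const_bound[of _ K]) auto
  have uTb: "\<bar>uT\<bar> \<le> K"
  proof -
    have "\<bar>uT\<bar> \<le> expectation (\<lambda>\<omega>. \<bar>T (X 0 \<omega>) (X 1 \<omega>)\<bar>)" unfolding uT_def by (rule integral_abs_bound)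
    also have "\<dots> \<le> expectation (\<lambda>\<omega>. K)" using Tb Tint by (intro integral_mono) auto
    finally show ?thesis by (simp add: prob_space)
  qed
  define C where "C = 2 * real K"
  have hb: "\<bar>h x y\<bar> \<le> C" for x y using Tb[of x y] uTb unfolding h_def C_def by linarith
  have hmean: "expectation (\<lambda>\<omega>. h (X 0 \<omega>) (X 1 \<omega>)) = 0"
    unfolding h_def using Tint by (simp add: uT_def prob_space)
  have Qint0: "integrable M (\<lambda>\<omega>. Q (X 0 \<omega>) (X 1 \<omega>))" unfolding Q_def using int Tint by auto
  have Qint: "integrable M (\<lambda>\<omega>. Q (X i \<omega>) (X j \<omega>))" and QE: "expectation (\<lambda>\<omega>. Q (X i \<omega>) (X j \<omega>)) \<le> \<eta>" if "i \<noteq> j" for i j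
  proof -
    show "integrable M (\<lambda>\<omega>. Q (X i \<omega>) (X j \<omega>))"
      using Qint0 integrable_pair[OF QmP, of 0 1] integrable_pair[OF QmP that] by simp
    have "expectation (\<lambda>\<omega>. Q (X i \<omega>) (X j \<omega>)) = expectation (\<lambda>\<omega>. Q (X 0 \<omega>) (X 1 \<omega>))"
      using expectation_pair[OF QmP, of 0 1] expectation_pair[OF QmP that] by simp
    then show "expectation (\<lambda>\<omega>. Q (X i \<omega>) (X j \<omega>)) \<le> \<eta>" using K unfolding Q_def T_def by simp
  qed
  have uu: "\<bar>uT - u\<bar> \<le> \<eta>"
  proof -
    have "uT - u = expectation (\<lambda>\<omega>. T (X 0 \<omega>) (X 1 \<omega>) - H (X 0 \<omega>) (X 1 \<omega>))"
      unfolding uT_def u_def using int Tint by simp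
    then have "\<bar>uT - u\<bar> \<le> expectation (\<lambda>\<omega>. \<bar>T (X 0 \<omega>) (X 1 \<omega>) - H (X 0 \<omega>) (X 1 \<omega>)\<bar>)" by (simp only: integral_abs_bound)
    also have "\<dots> = expectation (\<lambda>\<omega>. Q (X 0 \<omega>) (X 1 \<omega>))" by (simp add: Q_def abs_minus_commute)
    finally show ?thesis using QE[of 0 1] by simp
  qed
  \<comment> \<open>Rounding then costs at most \<open>\<epsilon> / 4 * m n * n\<close>.\<close>
  obtain L :: nat where L: "16 * C / \<epsilon> < L" using reals_Archimedean2 by blast
  have C0: "C \<ge> 0" by (simp add: C_def)
  have L0: "L > 0" using L C0 \<epsilon> by (cases "L = 0") (auto simp: divide_less_0_iff)
  have CL: "4 * C / L \<le> \<epsilon> / 4"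
    using L L0 \<epsilon> by (simp add: field_simps)
  \<comment> \<open>For \<open>m n\<close> beyond this value, the at most \<open>L\<^sup>2\<close> grid events together have probability at most \<open>\<gamma> / 4\<close>.\<close>
  obtain m0 :: nat where m0: "L\<^sup>2 * (32 * C\<^sup>2 / \<epsilon>\<^sup>2) * 4 / \<gamma> < m0" using reals_Archimedean2 by blast
  have "\<forall>\<^sub>F n in sequentially. max 1 (max L m0) \<le> m n"
    using mlim by (simp only: filterlim_at_top)
  with mn show "\<forall>\<^sub>F n in sequentially. dist (prob {\<omega>\<in>space M. \<exists>p\<le>m n. \<exists>q\<in>{m n..n}. \<epsilon> * m n * n < \<bar>\<Sum>i<p. \<Sum>j=q..<n. H (X i \<omega>) (X j \<omega>) - u\<bar>}) 0 < \<gamma>"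
  proof eventually_elim
    case (elim n)
    define m' where "m' = m n"
    have m': "m' \<ge> 1" "L \<le> m'" "m0 \<le> m'" "m' \<le> n" using elim by (auto simp: m'_def)
    have mpos: "real m' > 0" "real n > 0" using m' by auto
    define b where "b = m' div L + 1"
    define b' where "b' = n div L + 1"
    let ?mn = "real m' * real n"
    have mnpos: "?mn > 0" using mpos by simp
    define Bad1 where "Bad1 = {\<omega>\<in>space M. \<epsilon> / 4 * ?mn \<le> (\<Sum>i<m'. \<Sum>j=m'..<n. Q (X i \<omega>) (X j \<omega>))}"
    define D where "D a c \<omega> = (\<Sum>i<a * b. \<Sum>j=max m' (c * b')..<n. h (X i \<omega>) (X j \<omega>))" for a c \<omega>
    define Bad2 where "Bad2 a c = {\<omega>\<in>space M. \<epsilon> / 4 * ?mn \<le> \<bar>D a c \<omega>\<bar>}" for a c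
    define Adm where "Adm = {(a, c). a < L \<and> c < L \<and> a * b \<le> m'}"
    have Adm: "finite Adm" "card Adm \<le> L\<^sup>2"
    proof -
      have sub: "Adm \<subseteq> {..<L} \<times> {..<L}" by (auto simp: Adm_def)
      then show "finite Adm" by (rule finite_subset) simp
      show "card Adm \<le> L\<^sup>2" using card_mono[OF _ sub] by (simp add: card_cartesian_product power2_eq_square)
    qed
    have Dm[measurable]: "D a c \<in> borel_measurable M" for a c unfolding D_def[abs_def] by measurable
    have [measurable]: "Bad1 \<in> events" "Bad2 a c \<in> events" for a c unfolding Bad1_def Bad2_def by measurable
    have pB1: "prob Bad1 \<le> \<gamma> / 4"
    proof -
      have i: "integrable M (\<lambda>\<omega>. \<Sum>i<m'. \<Sum>j=m'..<n. Q (X i \<omega>) (X j \<omega>))"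
        by (intro Bochner_Integration.integrable_sum Qint) auto
      have "prob Bad1 \<le> expectation (\<lambda>\<omega>. \<Sum>i<m'. \<Sum>j=m'..<n. Q (X i \<omega>) (X j \<omega>)) / (\<epsilon> / 4 * ?mn)"
        unfolding Bad1_def using \<epsilon> mnpos i
        by (intro integral_Markov_inequality_measure[where A = "{}"]) (auto intro!: sum_nonneg simp: Q_def)
      also have "expectation (\<lambda>\<omega>. \<Sum>i<m'. \<Sum>j=m'..<n. Q (X i \<omega>) (X j \<omega>)) = (\<Sum>i<m'. \<Sum>j=m'..<n. expectation (\<lambda>\<omega>. Q (X i \<omega>) (X j \<omega>)))"
        by (subst Bochner_Integration.integral_sum)
           (auto intro!: Bochner_Integration.integrable_sum sum.cong Bochner_Integration.integral_sum Qint)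
      also have "\<dots> \<le> (\<Sum>i<m'. \<Sum>j=m'..<n. \<eta>)" by (intro sum_mono QE) auto
      also have "\<dots> = real m' * real (n - m') * \<eta>" by simp
      also have "\<dots> \<le> ?mn * \<eta>" using \<eta>(1) by (intro mult_right_mono mult_left_mono) auto
      finally have "prob Bad1 \<le> ?mn * \<eta> / (\<epsilon> / 4 * ?mn)" using \<epsilon> mnpos by (simp add: divide_right_mono)
      also have "\<dots> = 4 * \<eta> / \<epsilon>" using \<epsilon> mpos by simp
      also have "\<dots> \<le> \<gamma> / 4" using \<eta>(3) \<epsilon> by (simp add: pos_divide_le_eq)
      finally show ?thesis .
    qed
    have pB2: "prob (Bad2 a c) \<le> 32 * C\<^sup>2 / (\<epsilon>\<^sup>2 * m')" if "(a, c) \<in> Adm" for a c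
    proof -
      have ab: "a * b \<le> m'" using that by (simp add: Adm_def)
      have dis: "{..<a * b} \<inter> {max m' (c * b')..<n} = {}" using ab by auto
      note sm = bounded_two_sample_second_moment[OF hmP hb hmean _ _ dis, simplified]
      have "prob (Bad2 a c) \<le> expectation (\<lambda>\<omega>. (D a c \<omega>)\<^sup>2) / (\<epsilon> / 4 * ?mn)\<^sup>2"
        unfolding Bad2_def using \<epsilon> mnpos sm(1) by (intro second_moment_Markov) (auto simp: D_def[symmetric])
      also have "\<dots> \<le> C\<^sup>2 * (?mn * (2 * n)) / (\<epsilon> / 4 * ?mn)\<^sup>2"
      proof (rule divide_right_mono)
        have "expectation (\<lambda>\<omega>. (D a c \<omega>)\<^sup>2) \<le> C\<^sup>2 * (card {..<a * b} * card {max m' (c * b')..<n} * (card {..<a * b} + card {max m' (c * b')..<n}))"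
          unfolding D_def by (rule bounded_two_sample_second_moment(2)[OF hmP hb hmean _ _ dis]) auto
        also have "\<dots> \<le> C\<^sup>2 * real (m' * n * (2 * n))"
        proof (intro mult_left_mono of_nat_mono)
          show "card {..<a * b} * card {max m' (c * b')..<n} * (card {..<a * b} + card {max m' (c * b')..<n}) \<le> m' * n * (2 * n)"
            using ab m' by (intro mult_le_mono) auto
        qed simp
        finally show "expectation (\<lambda>\<omega>. (D a c \<omega>)\<^sup>2) \<le> C\<^sup>2 * (?mn * (2 * n))" by simp
      qed simp
      also have "\<dots> = 32 * C\<^sup>2 / (\<epsilon>\<^sup>2 * m')"
        using \<epsilon> mpos by (simp add: field_simps power2_eq_square)
      finally show ?thesis .
    qed
    let ?E = "{\<omega>\<in>space M. \<exists>p\<le>m'. \<exists>q\<in>{m'..n}. \<epsilon> * m' * n < \<bar>\<Sum>i<p. \<Sum>j=q..<n. H (X i \<omega>) (X j \<omega>) - u\<bar>}"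
    have "?E \<subseteq> Bad1 \<union> (\<Union>x\<in>Adm. Bad2 (fst x) (snd x))"
    proof (rule subsetI, rule ccontr)
      fix \<omega> assume w: "\<omega> \<in> ?E" and no: "\<omega> \<notin> Bad1 \<union> (\<Union>x\<in>Adm. Bad2 (fst x) (snd x))"
      then have wM: "\<omega> \<in> space M" by simp
      from w obtain p q where p: "p \<le> m'" and q: "m' \<le> q" "q \<le> n"
        and big: "\<epsilon> * ?mn < \<bar>\<Sum>i<p. \<Sum>j=q..<n. H (X i \<omega>) (X j \<omega>) - u\<bar>" by (auto simp: mult.assoc)
      note rr = rectangle_sum_rounding[where h = "\<lambda>i j. h (X i \<omega>) (X j \<omega>)", OF hb L0 m'(2) m'(4) p q, folded b_def b'_def]
      have adm: "(p div b, q div b') \<in> Adm"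
        using rr(1,2) p by (auto simp: Adm_def intro: le_trans[OF div_times_less_eq_dividend])
      have 1: "\<bar>\<Sum>i<p. \<Sum>j=q..<n. h (X i \<omega>) (X j \<omega>)\<bar> \<le> \<epsilon> / 4 * ?mn + \<epsilon> / 4 * ?mn"
      proof -
        have "\<bar>D (p div b) (q div b') \<omega>\<bar> \<le> \<epsilon> / 4 * ?mn"
          using no adm wM unfolding Bad2_def by fastforce
        moreover have "4 * C * m' * n / L \<le> \<epsilon> / 4 * ?mn"
          using mult_right_mono[OF CL, of ?mn] mnpos by (simp add: mult_ac)
        ultimately show ?thesis using rr(3) unfolding D_def by linarith
      qed
      have 2: "\<bar>\<Sum>i<p. \<Sum>j=q..<n. H (X i \<omega>) (X j \<omega>) - T (X i \<omega>) (X j \<omega>)\<bar> \<le> \<epsilon> / 4 * ?mn"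
      proof -
        have "\<bar>\<Sum>i<p. \<Sum>j=q..<n. H (X i \<omega>) (X j \<omega>) - T (X i \<omega>) (X j \<omega>)\<bar> \<le> (\<Sum>i<p. \<Sum>j=q..<n. Q (X i \<omega>) (X j \<omega>))"
          unfolding Q_def by (intro order_trans[OF sum_abs] sum_mono sum_abs)
        also have "\<dots> \<le> (\<Sum>i<m'. \<Sum>j=q..<n. Q (X i \<omega>) (X j \<omega>))"
          using p by (intro sum_mono2 sum_nonneg) (auto simp: Q_def)
        also have "\<dots> \<le> (\<Sum>i<m'. \<Sum>j=m'..<n. Q (X i \<omega>) (X j \<omega>))"
          using q by (intro sum_mono sum_mono2) (auto simp: Q_def)
        also have "\<dots> \<le> \<epsilon> / 4 * ?mn" using no wM by (auto simp: Bad1_def)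
        finally show ?thesis .
      qed
      have 3: "\<bar>\<Sum>i<p. \<Sum>j=q..<n. uT - u\<bar> \<le> \<epsilon> / 4 * ?mn"
      proof -
        have "\<bar>\<Sum>i<p. \<Sum>j=q..<n. uT - u\<bar> = (real p * real (n - q)) * \<bar>uT - u\<bar>" by (simp add: abs_mult)
        also have "\<dots> \<le> ?mn * (\<epsilon> / 4)"
        proof (intro mult_mono)
          show "\<bar>uT - u\<bar> \<le> \<epsilon> / 4" using uu \<eta>(2) by linarith
        qed (use p in auto)
        finally show ?thesis by (simp add: mult.commute)
      qed
      have "(\<Sum>i<p. \<Sum>j=q..<n. H (X i \<omega>) (X j \<omega>) - u)
          = (\<Sum>i<p. \<Sum>j=q..<n. h (X i \<omega>) (X j \<omega>)) + (\<Sum>i<p. \<Sum>j=q..<n. H (X i \<omega>) (X j \<omega>) - T (X i \<omega>) (X j \<omega>)) + (\<Sum>i<p. \<Sum>j=q..<n. uT - u)"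
        unfolding sum.distrib[symmetric] by (intro sum.cong refl) (simp add: h_def)
      then show False using big 1 2 3 by linarith
    qed
    then have "prob ?E \<le> prob (Bad1 \<union> (\<Union>x\<in>Adm. Bad2 (fst x) (snd x)))"
      using Adm by (intro finite_measure_mono) auto
    also have "\<dots> \<le> prob Bad1 + prob (\<Union>x\<in>Adm. Bad2 (fst x) (snd x))"
      using Adm by (intro measure_Un_le) auto
    also have "prob (\<Union>x\<in>Adm. Bad2 (fst x) (snd x)) \<le> (\<Sum>x\<in>Adm. prob (Bad2 (fst x) (snd x)))"
      using Adm by (intro finite_measure_subadditive_finite) auto
    also have "\<dots> \<le> (\<Sum>x\<in>Adm. 32 * C\<^sup>2 / (\<epsilon>\<^sup>2 * m'))" by (intro sum_mono pB2) simp
    also have "\<dots> \<le> L\<^sup>2 * (32 * C\<^sup>2 / (\<epsilon>\<^sup>2 * m'))"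
    proof -
      have "real (card Adm) \<le> real (L\<^sup>2)" using Adm(2) by (simp only: of_nat_le_iff)
      then have "real (card Adm) * (32 * C\<^sup>2 / (\<epsilon>\<^sup>2 * m')) \<le> real (L\<^sup>2) * (32 * C\<^sup>2 / (\<epsilon>\<^sup>2 * m'))"
        by (intro mult_right_mono) auto
      then show ?thesis by simp
    qed
    also have "\<dots> = (L\<^sup>2 * (32 * C\<^sup>2 / \<epsilon>\<^sup>2)) / m'" by simp
    also have "\<dots> \<le> \<gamma> / 4"
    proof -
      have "L\<^sup>2 * (32 * C\<^sup>2 / \<epsilon>\<^sup>2) * 4 / \<gamma> \<le> m'" using m0 m'(3) by linarith
      then have "L\<^sup>2 * (32 * C\<^sup>2 / \<epsilon>\<^sup>2) * 4 \<le> m' * \<gamma>" using \<gamma> by (simp only: pos_divide_le_eq)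
      moreover have "Z / m' \<le> \<gamma> / 4" if "Z * 4 \<le> m' * \<gamma>" for Z
        using that mpos by (simp add: pos_divide_le_eq mult.commute)
      ultimately show ?thesis by blast
    qed
    finally have "prob ?E \<le> \<gamma> / 2" using pB1 by simp
    then show ?case using \<gamma> unfolding m'_def by simp
  qed
qed

end

section \<open>Cross sums of a degenerate antisymmetric kernel\<close>

context iid_sequence begin

text \<open>Integrate first over \<open>X j\<close>, which occurs only in the first factor.\<close>

lemma degenerate_orthogonal:
  fixes r :: "real \<Rightarrow> real \<Rightarrow> real"
  assumes r: "case_prod r \<in> borel_measurable (borel \<Otimes>\<^sub>M borel)"
    and int: "integrable M (\<lambda>\<omega>. r (X i \<omega>) (X j \<omega>) * r (X i' \<omega>) (X j' \<omega>))"
    and deg: "AE x in law. (\<integral>y. r x y \<partial>law) = 0"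
    and j: "j \<notin> {i, i', j'}"
  shows "expectation (\<lambda>\<omega>. r (X i \<omega>) (X j \<omega>) * r (X i' \<omega>) (X j' \<omega>)) = 0"
proof -
  let ?I = "{i, i', j'}" and ?P = "PiM {i, i', j'} (\<lambda>_. borel :: real measure)"
  define V where "V \<omega> = (\<lambda>k\<in>?I. X k \<omega>)" for \<omega>
  have Vm[measurable]: "V \<in> measurable M ?P" unfolding V_def[abs_def] by (intro measurable_restrict) simp
  have iv: "indep_var ?P V (PiM {j} (\<lambda>_. borel)) (\<lambda>\<omega>. \<lambda>k\<in>{j}. X k \<omega>)"
    unfolding V_def[abs_def] using j by (intro indep_var_restrict[OF indep]) auto
  define Z where "Z \<omega> = (\<lambda>k\<in>{j}. X k \<omega>)" for \<omega>
  let ?Q = "PiM {j} (\<lambda>_. borel :: real measure)"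
  have Zm[measurable]: "Z \<in> measurable M ?Q" unfolding Z_def[abs_def] by (intro measurable_restrict) simp
  have pl: "distr M (?P \<Otimes>\<^sub>M ?Q) (\<lambda>\<omega>. (V \<omega>, Z \<omega>)) = distr M ?P V \<Otimes>\<^sub>M distr M ?Q Z"
    using iv unfolding Z_def[abs_def, symmetric] by (simp add: indep_var_distribution_eq)
  define f where "f = (\<lambda>(v, z). r (v i) (z j) * r (v i') (v j'))"
  have c: "(\<lambda>v. v k) \<in> borel_measurable ?P" if "k \<in> ?I" for k
    by (rule measurable_component_singleton[OF that])
  have cj: "(\<lambda>z. z j) \<in> borel_measurable ?Q" by (rule measurable_component_singleton) simp
  have m1: "(\<lambda>w. (fst w i, snd w j)) \<in> measurable (?P \<Otimes>\<^sub>M ?Q) (borel \<Otimes>\<^sub>M borel)"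
    by (intro measurable_Pair measurable_compose[OF measurable_fst c] measurable_compose[OF measurable_snd cj]) auto
  have m2: "(\<lambda>w. (fst w i', fst w j')) \<in> measurable (?P \<Otimes>\<^sub>M ?Q) (borel \<Otimes>\<^sub>M borel)"
    by (intro measurable_Pair measurable_compose[OF measurable_fst c]) auto
  have fm: "f \<in> borel_measurable (?P \<Otimes>\<^sub>M ?Q)"
    unfolding f_def using borel_measurable_times[OF measurable_compose[OF m1 r] measurable_compose[OF m2 r]]
    by (simp add: case_prod_beta)
  interpret V: prob_space "distr M ?P V" by (rule prob_space_distr) simp
  interpret Z: prob_space "distr M ?Q Z" by (rule prob_space_distr) simp
  interpret F: prob_space law by (rule prob_space_distr) simp
  interpret VZ: pair_sigma_finite "distr M ?P V" "distr M ?Q Z" ..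
  have Zlaw: "distr (distr M ?Q Z) borel (\<lambda>z. z j) = law"
    using ident[of j] by (subst distr_distr[OF cj Zm]) (simp add: o_def Z_def)
  have inner: "(\<integral>z. r x (z j) \<partial>distr M ?Q Z) = (\<integral>y. r x y \<partial>law)" for x
  proof -
    have rx: "r x \<in> borel_measurable borel"
      using measurable_compose[OF measurable_Pair1' r, of x] by simp
    have "(\<integral>y. r x y \<partial>distr (distr M ?Q Z) borel (\<lambda>z. z j)) = (\<integral>z. r x (z j) \<partial>distr M ?Q Z)"
      by (rule integral_distr) (use cj rx in simp_all)
    then show ?thesis unfolding Zlaw by simp
  qed
  have fV: "f (V \<omega>, Z \<omega>) = r (X i \<omega>) (X j \<omega>) * r (X i' \<omega>) (X j' \<omega>)" for \<omega>
    by (simp add: f_def V_def Z_def)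
  have pm: "(\<lambda>\<omega>. (V \<omega>, Z \<omega>)) \<in> measurable M (?P \<Otimes>\<^sub>M ?Q)" by simp
  have fi: "integrable (distr M ?P V \<Otimes>\<^sub>M distr M ?Q Z) f"
    unfolding pl[symmetric] by (subst integrable_distr_eq[OF pm fm]) (simp add: fV int)
  have "expectation (\<lambda>\<omega>. r (X i \<omega>) (X j \<omega>) * r (X i' \<omega>) (X j' \<omega>)) = (\<integral>w. f w \<partial>(distr M ?P V \<Otimes>\<^sub>M distr M ?Q Z))"
    unfolding pl[symmetric] by (subst integral_distr[OF pm fm]) (simp add: fV)
  also have "\<dots> = (\<integral>v. (\<integral>z. f (v, z) \<partial>distr M ?Q Z) \<partial>distr M ?P V)"
    by (rule VZ.integral_fst'[OF fi, symmetric])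
  also have "\<dots> = (\<integral>v. r (v i') (v j') * (\<integral>y. r (v i) y \<partial>law) \<partial>distr M ?P V)"
    by (simp add: f_def mult.commute inner)
  also have "\<dots> = (\<integral>\<omega>. r (X i' \<omega>) (X j' \<omega>) * (\<integral>y. r (X i \<omega>) y \<partial>law) \<partial>M)"
  proof (subst integral_distr)
    have "(\<lambda>x. \<integral>y. r x y \<partial>law) \<in> borel_measurable borel"
      using r by (intro F.borel_measurable_lebesgue_integral) (simp add: measurable_cong_sets[OF sets_pair_measure_cong[OF refl sets_distr] refl])
    from measurable_compose[OF c[of i] this] 
    have "(\<lambda>v. \<integral>y. r (v i) y \<partial>law) \<in> borel_measurable ?P" by simp
    moreover have "(\<lambda>v. r (v i') (v j')) \<in> borel_measurable ?P"
    proof -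
      have "(\<lambda>v. (v i', v j')) \<in> measurable ?P (borel \<Otimes>\<^sub>M borel)" by (intro measurable_Pair c) auto
      from measurable_compose[OF this r] show ?thesis by simp
    qed
    ultimately show "(\<lambda>v. r (v i') (v j') * (\<integral>y. r (v i) y \<partial>law)) \<in> borel_measurable ?P" by simp
  qed (simp_all add: V_def)
  also have "\<dots> = 0"
  proof (rule integral_eq_zero_AE)
    have "AE x in distr M borel (X i). (\<integral>y. r x y \<partial>law) = 0" by (subst ident[of i]) (rule deg)
    then have "AE \<omega> in M. (\<integral>y. r (X i \<omega>) y \<partial>law) = 0" by (rule AE_distrD[OF rv])
    then show "AE \<omega> in M. r (X i' \<omega>) (X j' \<omega>) * (\<integral>y. r (X i \<omega>) y \<partial>law) = 0" by auto
  qed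
  finally show ?thesis .
qed

end

text \<open>The remainder of the Hoeffding decomposition of an antisymmetric kernel is of this kind.\<close>

locale degenerate_kernel = iid_sequence +
  fixes r :: "real \<Rightarrow> real \<Rightarrow> real"
  assumes r_meas: "case_prod r \<in> borel_measurable (borel \<Otimes>\<^sub>M borel)"
    and r_antisym: "r y x = - r x y"
    and r_square: "integrable M (\<lambda>\<omega>. (r (X 0 \<omega>) (X 1 \<omega>))\<^sup>2)"
    and r_degenerate: "AE x in law. (\<integral>y. r x y \<partial>law) = 0"
begin

definition "kernel_variance \<equiv> expectation (\<lambda>\<omega>. (r (X 0 \<omega>) (X 1 \<omega>))\<^sup>2)"

lemma kernel_measurable: "(\<lambda>\<omega>. r (X i \<omega>) (X j \<omega>)) \<in> borel_measurable M"
  by (rule measurable_pair[OF r_meas])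

lemma kernel_square: assumes "i \<noteq> j"
  shows "integrable M (\<lambda>\<omega>. (r (X i \<omega>) (X j \<omega>))\<^sup>2)" and "expectation (\<lambda>\<omega>. (r (X i \<omega>) (X j \<omega>))\<^sup>2) = kernel_variance"
proof -
  have m: "case_prod (\<lambda>x y. (r x y)\<^sup>2) \<in> borel_measurable (borel \<Otimes>\<^sub>M borel)"
    using borel_measurable_power[OF r_meas, of 2] by (simp add: case_prod_beta')
  show "integrable M (\<lambda>\<omega>. (r (X i \<omega>) (X j \<omega>))\<^sup>2)"
    using r_square integrable_pair[OF m, of 0 1] integrable_pair[OF m assms] by simp
  show "expectation (\<lambda>\<omega>. (r (X i \<omega>) (X j \<omega>))\<^sup>2) = kernel_variance"
    unfolding kernel_variance_def using expectation_pair[OF m, of 0 1] expectation_pair[OF m assms] by simp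
qed

lemma kernel_products_integrable: "i \<noteq> j \<Longrightarrow> i' \<noteq> j' \<Longrightarrow> integrable M (\<lambda>\<omega>. r (X i \<omega>) (X j \<omega>) * r (X i' \<omega>) (X j' \<omega>))"
  by (intro integrable_mult_of_squares kernel_measurable kernel_square)

lemma kernel_variance_nonneg: "kernel_variance \<ge> 0" unfolding kernel_variance_def by simp

text \<open>If the second indices agree, antisymmetry exchanges the roles of the two arguments in both factors.\<close>

lemma kernel_orthogonal:
  assumes "i \<in> A" "i' \<in> A" "j \<in> B" "j' \<in> B" "A \<inter> B = {}" "(i, j) \<noteq> (i', j')"
  shows "expectation (\<lambda>\<omega>. r (X i \<omega>) (X j \<omega>) * r (X i' \<omega>) (X j' \<omega>)) = 0"
proof -
  have ne: "i \<noteq> j" "i' \<noteq> j'" "i \<noteq> j'" "i' \<noteq> j" using assms by auto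
  show ?thesis
  proof (cases "j = j'")
    case False
    then show ?thesis using ne by (intro degenerate_orthogonal r_meas kernel_products_integrable r_degenerate) auto
  next
    case True
    then have "i \<noteq> i'" using assms by auto
    have "expectation (\<lambda>\<omega>. r (X j \<omega>) (X i \<omega>) * r (X j' \<omega>) (X i' \<omega>)) = 0"
      using ne True \<open>i \<noteq> i'\<close> by (intro degenerate_orthogonal r_meas kernel_products_integrable r_degenerate) auto
    moreover have "r (X j \<omega>) (X i \<omega>) * r (X j' \<omega>) (X i' \<omega>) = r (X i \<omega>) (X j \<omega>) * r (X i' \<omega>) (X j' \<omega>)" for \<omega>
      using r_antisym[of "X j \<omega>" "X i \<omega>"] r_antisym[of "X j' \<omega>" "X i' \<omega>"] by simp
    ultimately show ?thesis by simp
  qed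
qed

lemma degenerate_second_moment:
  assumes A: "finite A" and B: "finite B" and AB: "A \<inter> B = {}"
  shows "integrable M (\<lambda>\<omega>. (\<Sum>i\<in>A. \<Sum>j\<in>B. r (X i \<omega>) (X j \<omega>))\<^sup>2)"
    and "expectation (\<lambda>\<omega>. (\<Sum>i\<in>A. \<Sum>j\<in>B. r (X i \<omega>) (X j \<omega>))\<^sup>2) = card A * card B * kernel_variance"
proof -
  let ?r = "\<lambda>p \<omega>. r (X (fst p) \<omega>) (X (snd p) \<omega>)" and ?C = "A \<times> B"
  have s: "(\<Sum>i\<in>A. \<Sum>j\<in>B. r (X i \<omega>) (X j \<omega>))\<^sup>2 = (\<Sum>p\<in>?C. \<Sum>p'\<in>?C. ?r p \<omega> * ?r p' \<omega>)" for \<omega>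
    by (simp add: sum.cartesian_product case_prod_beta power2_eq_square sum_product)
  have int: "integrable M (\<lambda>\<omega>. ?r p \<omega> * ?r p' \<omega>)" if "p \<in> ?C" "p' \<in> ?C" for p p'
    using that AB by (intro kernel_products_integrable) auto
  show "integrable M (\<lambda>\<omega>. (\<Sum>i\<in>A. \<Sum>j\<in>B. r (X i \<omega>) (X j \<omega>))\<^sup>2)"
    unfolding s by (intro Bochner_Integration.integrable_sum int)
  have e: "expectation (\<lambda>\<omega>. ?r p \<omega> * ?r p' \<omega>) = (if p = p' then kernel_variance else 0)" if "p \<in> ?C" "p' \<in> ?C" for p p'
  proof (cases "p = p'")
    case True
    have "fst p \<noteq> snd p" using that AB by auto
    then show ?thesis using True kernel_square(2) by (simp add: power2_eq_square)
  next
    case False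
    then have "expectation (\<lambda>\<omega>. ?r p \<omega> * ?r p' \<omega>) = 0"
      using that AB by (intro kernel_orthogonal[of _ A _ _ B]) (auto simp: prod_eq_iff)
    then show ?thesis using False by simp
  qed
  have "expectation (\<lambda>\<omega>. (\<Sum>i\<in>A. \<Sum>j\<in>B. r (X i \<omega>) (X j \<omega>))\<^sup>2) = (\<Sum>p\<in>?C. \<Sum>p'\<in>?C. expectation (\<lambda>\<omega>. ?r p \<omega> * ?r p' \<omega>))"
    unfolding s by (subst Bochner_Integration.integral_sum)
      (auto intro!: Bochner_Integration.integrable_sum sum.cong Bochner_Integration.integral_sum int)
  also have "\<dots> = (\<Sum>p\<in>?C. \<Sum>p'\<in>?C. if p = p' then kernel_variance else 0)" by (intro sum.cong refl e)
  also have "\<dots> = card A * card B * kernel_variance" using A B by (simp add: card_cartesian_product)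
  finally show "expectation (\<lambda>\<omega>. (\<Sum>i\<in>A. \<Sum>j\<in>B. r (X i \<omega>) (X j \<omega>))\<^sup>2) = card A * card B * kernel_variance" .
qed

definition cross_sum :: "nat \<Rightarrow> nat \<Rightarrow> 'a \<Rightarrow> real" where
  "cross_sum n k \<omega> = (\<Sum>i<k. \<Sum>j=k..<n. r (X i \<omega>) (X j \<omega>))"

lemma diagonal_block_sum_zero: "finite I \<Longrightarrow> (\<Sum>i\<in>I. \<Sum>j\<in>I. r (X i \<omega>) (X j \<omega>)) = 0"
proof -
  have "(\<Sum>i\<in>I. \<Sum>j\<in>I. r (X i \<omega>) (X j \<omega>)) = (\<Sum>j\<in>I. \<Sum>i\<in>I. r (X i \<omega>) (X j \<omega>))" by (rule sum.swap)
  also have "\<dots> = (\<Sum>j\<in>I. \<Sum>i\<in>I. - r (X j \<omega>) (X i \<omega>))" by (intro sum.cong refl r_antisym)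
  also have "\<dots> = - (\<Sum>i\<in>I. \<Sum>j\<in>I. r (X i \<omega>) (X j \<omega>))" by (simp add: sum_negf)
  finally show ?thesis by simp
qed

text \<open>Because of antisymmetry the sum over a square of indices vanishes. The cross sum can therefore be
  extended to all \<open>j < n\<close>, its increments are sums over strips, and a strip again loses its square.\<close>

lemma cross_sum_increment:
  assumes "k \<le> k'" "k' \<le> n"
  shows "cross_sum n k' \<omega> - cross_sum n k \<omega> = (\<Sum>i=k..<k'. \<Sum>j\<in>{..<n} - {k..<k'}. r (X i \<omega>) (X j \<omega>))"
proof -
  let ?r = "\<lambda>i j. r (X i \<omega>) (X j \<omega>)"
  have full: "cross_sum n l \<omega> = (\<Sum>i<l. \<Sum>j<n. ?r i j)" if "l \<le> n" for l
  proof -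
    have "(\<Sum>i<l. \<Sum>j<n. ?r i j) = (\<Sum>i<l. (\<Sum>j<l. ?r i j) + (\<Sum>j=l..<n. ?r i j))"
      using that by (simp add: lessThan_atLeast0 sum.atLeastLessThan_concat)
    also have "\<dots> = cross_sum n l \<omega>" by (simp add: sum.distrib diagonal_block_sum_zero cross_sum_def)
    finally show ?thesis by simp
  qed
  have "(\<Sum>i<k'. \<Sum>j<n. ?r i j) = (\<Sum>i<k. \<Sum>j<n. ?r i j) + (\<Sum>i=k..<k'. \<Sum>j<n. ?r i j)"
    using assms by (simp add: lessThan_atLeast0 sum.atLeastLessThan_concat)
  then have "cross_sum n k' \<omega> - cross_sum n k \<omega> = (\<Sum>i=k..<k'. \<Sum>j<n. ?r i j)" using assms by (simp add: full)
  also have "\<dots> = (\<Sum>i=k..<k'. (\<Sum>j\<in>{..<n} - {k..<k'}. ?r i j) + (\<Sum>j\<in>{k..<k'}. ?r i j))"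
    using assms by (intro sum.cong refl sum.subset_diff) auto
  also have "\<dots> = (\<Sum>i=k..<k'. \<Sum>j\<in>{..<n} - {k..<k'}. ?r i j)" by (simp add: sum.distrib diagonal_block_sum_zero)
  finally show ?thesis .
qed

lemma cross_sum_measurable[measurable]: "cross_sum n k \<in> borel_measurable M"
  unfolding cross_sum_def[abs_def] by (intro borel_measurable_sum kernel_measurable)

lemma cross_sum_increment_prob:
  assumes kk: "k \<le> k'" "k' \<le> n" and a: "a > 0"
  shows "prob {\<omega>\<in>space M. a \<le> \<bar>cross_sum n k' \<omega> - cross_sum n k \<omega>\<bar>} \<le> real (k' - k) * real n * kernel_variance / a\<^sup>2"
proof -
  have dis: "{k..<k'} \<inter> ({..<n} - {k..<k'}) = {}" by auto
  note sm = degenerate_second_moment[OF _ _ dis]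
  have "prob {\<omega>\<in>space M. a \<le> \<bar>cross_sum n k' \<omega> - cross_sum n k \<omega>\<bar>} \<le> expectation (\<lambda>\<omega>. (cross_sum n k' \<omega> - cross_sum n k \<omega>)\<^sup>2) / a\<^sup>2"
    by (rule second_moment_Markov[OF _ _ a]) (simp, simp add: cross_sum_increment[OF kk] sm)
  also have "\<dots> \<le> real (k' - k) * real n * kernel_variance / a\<^sup>2"
  proof (rule divide_right_mono)
    have "expectation (\<lambda>\<omega>. (cross_sum n k' \<omega> - cross_sum n k \<omega>)\<^sup>2) = card {k..<k'} * card ({..<n} - {k..<k'}) * kernel_variance"
      unfolding cross_sum_increment[OF kk] by (rule sm(2)) auto
    also have "\<dots> = real ((k' - k) * card ({..<n} - {k..<k'})) * kernel_variance" by simp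
    also have "\<dots> \<le> real ((k' - k) * n) * kernel_variance"
    proof (intro mult_right_mono of_nat_mono mult_left_mono kernel_variance_nonneg)
      show "card ({..<n} - {k..<k'}) \<le> n" using card_mono[of "{..<n}" "{..<n} - {k..<k'}"] by auto
    qed simp
    finally show "expectation (\<lambda>\<omega>. (cross_sum n k' \<omega> - cross_sum n k \<omega>)\<^sup>2) \<le> real (k' - k) * real n * kernel_variance" by simp
  qed simp
  finally show ?thesis .
qed

text \<open>Two union bounds, over the grid of multiples of \<open>b\<close> and over the distances to it. With increments of
  variance at most \<open>b n\<close> times a constant, neither of them needs a maximal inequality: relative to \<open>n\<^sup>3\<close> they
  cost \<open>n / b\<close> times \<open>n\<^sup>2\<close> and \<open>n\<close> times \<open>b n\<close>.\<close>

lemma cross_sum_max_prob: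
  fixes b n :: nat
  assumes b: "b > 0" and n: "n > 0" and \<epsilon>: "\<epsilon> > 0"
  shows "prob {\<omega>\<in>space M. \<exists>k\<le>n. 2 * \<epsilon> * (n * sqrt n) < \<bar>cross_sum n k \<omega>\<bar>} \<le> kernel_variance / \<epsilon>\<^sup>2 * (1 / b + (1 + 2 * b) / n)"
proof -
  define a where "a = \<epsilon> * (n * sqrt n)"
  have a: "a > 0" using n \<epsilon> by (simp add: a_def)
  have a2: "a\<^sup>2 = \<epsilon>\<^sup>2 * real n ^ 3" by (simp add: a_def power_mult_distrib power3_eq_cube power2_eq_square)
  define G where "G c = {\<omega>\<in>space M. a \<le> \<bar>cross_sum n (c * b) \<omega> - cross_sum n 0 \<omega>\<bar>}" for c
  define R where "R k = {\<omega>\<in>space M. a \<le> \<bar>cross_sum n k \<omega> - cross_sum n (k div b * b) \<omega>\<bar>}" for k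
  have [measurable]: "G c \<in> events" "R c \<in> events" for c unfolding G_def R_def by measurable
  have sub: "{\<omega>\<in>space M. \<exists>k\<le>n. 2 * \<epsilon> * (n * sqrt n) < \<bar>cross_sum n k \<omega>\<bar>} \<subseteq> (\<Union>c\<le>n div b. G c) \<union> (\<Union>k\<le>n. R k)"
  proof
    fix \<omega> assume "\<omega> \<in> {\<omega>\<in>space M. \<exists>k\<le>n. 2 * \<epsilon> * (n * sqrt n) < \<bar>cross_sum n k \<omega>\<bar>}"
    then obtain k where k: "\<omega> \<in> space M" "k \<le> n" "2 * a < \<bar>cross_sum n k \<omega>\<bar>" by (auto simp: a_def)
    have D0: "cross_sum n 0 \<omega> = 0" by (simp add: cross_sum_def)
    have kb: "k div b \<le> n div b" using k(2) by (rule div_le_mono)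
    from k(3) have "a \<le> \<bar>cross_sum n (k div b * b) \<omega>\<bar> \<or> a \<le> \<bar>cross_sum n k \<omega> - cross_sum n (k div b * b) \<omega>\<bar>" by linarith
    then have "\<omega> \<in> G (k div b) \<or> \<omega> \<in> R k" using k(1) by (simp add: G_def R_def D0)
    then show "\<omega> \<in> (\<Union>c\<le>n div b. G c) \<union> (\<Union>k\<le>n. R k)" using k(2) kb by auto
  qed
  have pG: "prob (G c) \<le> real n * real n * kernel_variance / a\<^sup>2" if "c \<le> n div b" for c
  proof -
    have cb: "c * b \<le> n" using that b by (simp add: less_eq_div_iff_mult_less_eq)
    have "prob (G c) \<le> real (c * b - 0) * n * kernel_variance / a\<^sup>2"
      unfolding G_def using cross_sum_increment_prob[OF _ cb a, of 0] by simp
    also have "\<dots> \<le> real n * real n * kernel_variance / a\<^sup>2"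
    proof (intro divide_right_mono mult_right_mono kernel_variance_nonneg)
      show "real (c * b - 0) \<le> real n" using cb by (simp del: of_nat_mult)
    qed auto
    finally show ?thesis .
  qed
  have pR: "prob (R k) \<le> real b * real n * kernel_variance / a\<^sup>2" if "k \<le> n" for k
  proof -
    have "prob (R k) \<le> real (k - k div b * b) * n * kernel_variance / a\<^sup>2"
      unfolding R_def using cross_sum_increment_prob[OF _ that a, of "k div b * b"] by simp
    also have "\<dots> \<le> real b * real n * kernel_variance / a\<^sup>2"
    proof (intro divide_right_mono mult_right_mono kernel_variance_nonneg)
      have "k - k div b * b = k mod b" by (rule minus_div_mult_eq_mod)
      then show "real (k - k div b * b) \<le> real b" using mod_less_divisor[OF b, of k] by simp
    qed auto
    finally show ?thesis .
  qed
  have "prob {\<omega>\<in>space M. \<exists>k\<le>n. 2 * \<epsilon> * (n * sqrt n) < \<bar>cross_sum n k \<omega>\<bar>} \<le> prob ((\<Union>c\<le>n div b. G c) \<union> (\<Union>k\<le>n. R k))"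
    by (rule finite_measure_mono[OF sub]) auto
  also have "\<dots> \<le> prob (\<Union>c\<le>n div b. G c) + prob (\<Union>k\<le>n. R k)" by (intro measure_Un_le) auto
  also have "\<dots> \<le> (\<Sum>c\<le>n div b. prob (G c)) + (\<Sum>k\<le>n. prob (R k))"
    by (intro add_mono finite_measure_subadditive_finite) auto
  also have "\<dots> \<le> (\<Sum>c\<le>n div b. real n * real n * kernel_variance / a\<^sup>2) + (\<Sum>k\<le>n. real b * real n * kernel_variance / a\<^sup>2)"
    by (intro add_mono sum_mono pG pR) auto
  also have "\<dots> = (real (n div b) + 1) * (real n * real n * kernel_variance / a\<^sup>2) + (real n + 1) * (real b * real n * kernel_variance / a\<^sup>2)" by (simp add: algebra_simps)
  also have "\<dots> \<le> (real n / b + 1) * (real n * real n * kernel_variance / a\<^sup>2) + (2 * real n) * (real b * real n * kernel_variance / a\<^sup>2)"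
  proof (intro add_mono mult_right_mono)
    have "real (n div b * b) \<le> real n" by (simp only: of_nat_le_iff div_times_less_eq_dividend)
    then show "real (n div b) \<le> real n / b" using b by (simp add: pos_le_divide_eq)
    show "real n + 1 \<le> 2 * real n" using n by simp
  qed (use kernel_variance_nonneg in auto)
  also have "\<dots> = kernel_variance / \<epsilon>\<^sup>2 * (1 / b + (1 + 2 * b) / n)"
    unfolding a2 using n b \<epsilon> by (simp add: divide_simps power3_eq_cube power2_eq_square) (simp add: algebra_simps)
  finally show ?thesis .
qed

theorem cross_sums_negligible:
  assumes \<epsilon>: "\<epsilon> > 0"
  shows "(\<lambda>n. prob {\<omega>\<in>space M. \<exists>k\<le>n. \<epsilon> * (n * sqrt n) < \<bar>cross_sum n k \<omega>\<bar>}) \<longlonglongrightarrow> 0"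
proof (rule tendstoI)
  fix \<gamma> :: real assume \<gamma>: "\<gamma> > 0"
  define w where "w = kernel_variance / (\<epsilon> / 2)\<^sup>2"
  have w: "w \<ge> 0" using kernel_variance_nonneg by (simp add: w_def)
  obtain b0 :: nat where "2 * w / \<gamma> < b0" using reals_Archimedean2 by blast
  moreover define b where "b = b0 + 1"
  ultimately have b: "b > 0" "2 * w / \<gamma> < b" by auto
  have wb: "w / b < \<gamma> / 2" using b \<gamma> by (simp add: field_simps)
  have "(\<lambda>n. w * (1 / b + (1 + 2 * b) / n)) \<longlonglongrightarrow> w * (1 / b + 0)"
    by (intro tendsto_intros tendsto_divide_0[OF tendsto_const] filterlim_at_top_imp_at_infinity filterlim_real_sequentially)
  then have "\<forall>\<^sub>F n in sequentially. w * (1 / b + (1 + 2 * b) / n) < \<gamma>"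
  proof (rule order_tendstoD)
    have "w / b < \<gamma>" using wb \<gamma> by linarith
    then show "w * (1 / b + 0) < \<gamma>" by simp
  qed
  then show "\<forall>\<^sub>F n in sequentially. dist (prob {\<omega>\<in>space M. \<exists>k\<le>n. \<epsilon> * (n * sqrt n) < \<bar>cross_sum n k \<omega>\<bar>}) 0 < \<gamma>"
    using eventually_gt_at_top[of 0]
  proof eventually_elim
    case (elim n)
    have "prob {\<omega>\<in>space M. \<exists>k\<le>n. 2 * (\<epsilon> / 2) * (n * sqrt n) < \<bar>cross_sum n k \<omega>\<bar>} \<le> w * (1 / b + (1 + 2 * b) / n)"
      unfolding w_def by (rule cross_sum_max_prob[OF b(1) elim(2)]) (use \<epsilon> in simp)
    then show ?case using elim(1) by simp
  qed
qed

end

section \<open>The change-point statistic\<close>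

text \<open>Here \<open>S\<close> is the random walk, \<open>G\<close> the statistic, and \<open>ks\<close> the change point; \<open>\<rho>\<close> bounds the
  negligible random terms and \<open>\<tau>\<close> the error of \<open>ks \<approx> c \<surd>n\<close>. From \<open>ks\<close> on, the statistic and the comparison
  process agree pointwise. Before \<open>ks\<close> they do not, but both are at most \<open>c \<bar>u\<bar>\<close> up to small errors, a value
  that the comparison process takes at \<open>0\<close> and the statistic nearly takes at \<open>ks\<close>.\<close>

lemma change_point_max_comparison:
  fixes S G :: "nat \<Rightarrow> real" and n ks :: nat and c u \<rho> \<tau> :: real
  assumes ks: "1 \<le> ks" "ks < n" and c: "c > 0" and \<rho>: "\<rho> \<ge> 0" and S0: "S 0 = 0"
    and G: "\<And>k. 1 \<le> k \<Longrightarrow> k < n \<Longrightarrow>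
       \<bar>n * sqrt n * G k - (n * S k - k * S n + u * real (min k ks) * real (n - max k ks))\<bar> \<le> 2 * \<rho> * (n * sqrt n)"
    and S1: "\<And>k. k \<le> ks \<Longrightarrow> \<bar>S k\<bar> \<le> \<rho> * sqrt n" and S2: "\<bar>S n\<bar> \<le> \<rho> * n"
    and \<kappa>: "\<bar>ks / sqrt n - c\<bar> \<le> \<tau>" "ks / sqrt n \<le> 2 * c" "c * (ks / n) \<le> \<tau>"
  shows "\<bar>(MAX k\<in>{1..<n}. \<bar>G k\<bar>) - (MAX k\<in>{..n}. \<bar>(S k - k / n * S n) / sqrt n + c * (1 - k / n) * u\<bar>)\<bar>
     \<le> (4 + 4 * c) * \<rho> + 2 * \<bar>u\<bar> * \<tau>"
proof -
  define q where "q = sqrt n"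
  have n: "real n > 0" using ks by simp
  have q: "q > 0" and qq: "q * q = n" using n by (auto simp: q_def)
  define a where "a k = (S k - k / n * S n) / q + c * (1 - k / n) * u" for k :: nat
  define B where "B k = (S k - k / n * S n) / q" for k :: nat
  have \<tau>: "\<tau> \<ge> 0" using \<kappa>(1) by simp
  have u\<tau>: "0 \<le> \<bar>u\<bar> * \<tau>" and c\<rho>: "0 \<le> c * \<rho>" using \<tau> c \<rho> by auto
  have Gk: "\<bar>G k - (B k + u * (min k ks / q) * (1 - max k ks / n))\<bar> \<le> 2 * \<rho>" if "1 \<le> k" "k < n" for k
  proof -
    have "max k ks \<le> n" using that ks by simp
    then have "n * q * (B k + u * (min k ks / q) * (1 - max k ks / n)) = n * S k - k * S n + u * real (min k ks) * real (n - max k ks)"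
      using n q by (simp add: B_def of_nat_diff field_simps del: of_nat_min of_nat_max)
    then have "n * q * (G k - (B k + u * (min k ks / q) * (1 - max k ks / n))) = n * q * G k - (n * S k - k * S n + u * real (min k ks) * real (n - max k ks))"
      by (simp only: right_diff_distrib)
    then have "\<bar>n * q * (G k - (B k + u * (min k ks / q) * (1 - max k ks / n)))\<bar> \<le> 2 * \<rho> * (n * q)"
      using G[OF that] by (simp only: q_def)
    then have "(n * q) * \<bar>G k - (B k + u * (min k ks / q) * (1 - max k ks / n))\<bar> \<le> (n * q) * (2 * \<rho>)"
      using n q by (simp only: abs_mult abs_of_pos mult.commute)
    then show ?thesis using n q by simp
  qed
  have late: "\<bar>G k - a k\<bar> \<le> 2 * \<rho> + \<bar>u\<bar> * \<tau>" if "ks \<le> k" "k < n" for k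
  proof -
    have "\<bar>(B k + u * (min k ks / q) * (1 - max k ks / n)) - a k\<bar> = \<bar>u * (ks / q - c) * (1 - k / n)\<bar>"
      using that by (simp add: a_def B_def algebra_simps min_absorb2 max_absorb1)
    also have "\<dots> = \<bar>u\<bar> * \<bar>ks / q - c\<bar> * \<bar>1 - k / n\<bar>" by (simp only: abs_mult)
    also have "\<dots> \<le> \<bar>u\<bar> * \<tau> * 1"
      using \<kappa>(1) that n by (intro mult_mono) (auto simp: q_def)
    finally have 1: "\<bar>(B k + u * (min k ks / q) * (1 - max k ks / n)) - a k\<bar> \<le> \<bar>u\<bar> * \<tau>" by simp
    have "1 \<le> k" using that ks by simp
    from Gk[OF this that(2)] 1 show ?thesis by linarith
  qed
  have Bk: "\<bar>B k\<bar> \<le> \<rho> + 2 * (c * \<rho>)" if "k \<le> ks" for k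
  proof -
    have 1: "\<bar>S k\<bar> / q \<le> \<rho>" using S1[OF that] q by (simp add: q_def pos_divide_le_eq)
    have "\<bar>k / n * S n\<bar> / q \<le> (k / n * (\<rho> * n)) / q"
    proof (rule divide_right_mono)
      have "\<bar>k / n * S n\<bar> = k / n * \<bar>S n\<bar>" by (simp add: abs_mult)
      also have "\<dots> \<le> k / n * (\<rho> * n)" using S2 by (intro mult_left_mono) auto
      finally show "\<bar>k / n * S n\<bar> \<le> k / n * (\<rho> * n)" .
    qed (use q in simp)
    also have "\<dots> = \<rho> * (k / q)" using n by simp
    also have "\<dots> \<le> \<rho> * (2 * c)"
    proof (rule mult_left_mono[OF _ \<rho>])
      have "k / q \<le> ks / q" using that q by (intro divide_right_mono) auto
      then show "k / q \<le> 2 * c" using \<kappa>(2) by (simp add: q_def)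
    qed
    finally have 2: "\<bar>k / n * S n\<bar> / q \<le> \<rho> * (2 * c)" .
    have "\<bar>B k\<bar> \<le> (\<bar>S k\<bar> + \<bar>k / n * S n\<bar>) / q"
      unfolding B_def abs_divide abs_of_pos[OF q] using q by (intro divide_right_mono abs_triangle_ineq4) auto
    also have "\<dots> = \<bar>S k\<bar> / q + \<bar>k / n * S n\<bar> / q" by (rule add_divide_distrib)
    finally show ?thesis using 1 2 by (simp add: mult_ac)
  qed
  have a0: "\<bar>a 0\<bar> = c * \<bar>u\<bar>" using c by (simp add: a_def S0 abs_mult)
  have early: "\<bar>G k\<bar> \<le> \<bar>a 0\<bar> + (3 * \<rho> + 2 * (c * \<rho>) + \<bar>u\<bar> * \<tau>)" if "1 \<le> k" "k < ks" for k
  proof -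
    have "\<bar>u * (min k ks / q) * (1 - max k ks / n)\<bar> = \<bar>u\<bar> * (k / q) * (1 - ks / n)"
      using that ks n q by (simp add: abs_mult min_absorb1 max_absorb2)
    also have "\<dots> \<le> \<bar>u\<bar> * (c + \<tau>) * 1"
    proof (intro mult_mono)
      have "k / q \<le> ks / q" using that q by (intro divide_right_mono) auto
      then show "k / q \<le> c + \<tau>" using \<kappa>(1) by (simp add: q_def)
    qed (use ks n q c \<tau> in auto)
    also have "\<dots> = c * \<bar>u\<bar> + \<bar>u\<bar> * \<tau>" by (simp add: algebra_simps)
    finally have 1: "\<bar>u * (min k ks / q) * (1 - max k ks / n)\<bar> \<le> c * \<bar>u\<bar> + \<bar>u\<bar> * \<tau>" .
    have "k < n" "k \<le> ks" using that ks by auto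
    from Gk[OF that(1) this(1)] Bk[OF this(2)] 1 show ?thesis unfolding a0 by linarith
  qed
  \<comment> \<open>The drift has hardly decreased between \<open>0\<close> and \<open>ks\<close>, since \<open>ks / n\<close> is small.\<close>
  have aks: "c * \<bar>u\<bar> \<le> \<bar>a ks\<bar> + (\<rho> + 2 * (c * \<rho>) + \<bar>u\<bar> * \<tau>)"
  proof -
    have "c * u = a ks - B ks + (c * (ks / n)) * u" by (simp add: a_def B_def algebra_simps)
    then have "\<bar>c * u\<bar> \<le> \<bar>a ks\<bar> + \<bar>B ks\<bar> + \<bar>(c * (ks / n)) * u\<bar>" by linarith
    moreover have "\<bar>(c * (ks / n)) * u\<bar> \<le> \<bar>u\<bar> * \<tau>"
    proof -
      have "\<bar>(c * (ks / n)) * u\<bar> = \<bar>u\<bar> * (c * (ks / n))" using c n by (simp add: abs_mult)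
      also have "\<dots> \<le> \<bar>u\<bar> * \<tau>" using \<kappa>(3) by (intro mult_left_mono) auto
      finally show ?thesis .
    qed
    moreover have "\<bar>c * u\<bar> = c * \<bar>u\<bar>" using c by (simp add: abs_mult)
    ultimately show ?thesis using Bk[of ks] by simp
  qed
  have err: "(4 + 4 * c) * \<rho> + 2 * \<bar>u\<bar> * \<tau> = 4 * \<rho> + 4 * (c * \<rho>) + 2 * (\<bar>u\<bar> * \<tau>)" by (simp add: algebra_simps)
  have "\<bar>(MAX k\<in>{1..<n}. \<bar>G k\<bar>) - (MAX k\<in>{..n}. \<bar>a k\<bar>)\<bar> \<le> (4 + 4 * c) * \<rho> + 2 * \<bar>u\<bar> * \<tau>"
    unfolding err
  proof (rule Max_diff_le)
    fix k assume k: "k \<in> {1..<n}"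
    show "\<exists>j\<in>{..n}. \<bar>G k\<bar> \<le> \<bar>a j\<bar> + (4 * \<rho> + 4 * (c * \<rho>) + 2 * (\<bar>u\<bar> * \<tau>))"
    proof (cases "k < ks")
      case True
      then show ?thesis using early[of k] k \<rho> c\<rho> u\<tau> by (intro bexI[of _ 0]) auto
    next
      case False
      then have "\<bar>G k\<bar> \<le> \<bar>a k\<bar> + (2 * \<rho> + \<bar>u\<bar> * \<tau>)" using late[of k] k by auto
      then show ?thesis using k \<rho> c\<rho> u\<tau> by (intro bexI[of _ k]) auto
    qed
  next
    fix k assume k: "k \<in> {..n}"
    have Gks: "\<bar>a ks\<bar> \<le> \<bar>G ks\<bar> + (2 * \<rho> + \<bar>u\<bar> * \<tau>)" using late[of ks] ks by auto
    consider "k < ks" | "ks \<le> k" "k < n" | "k = n" using k by fastforce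
    then show "\<exists>j\<in>{1..<n}. \<bar>a k\<bar> \<le> \<bar>G j\<bar> + (4 * \<rho> + 4 * (c * \<rho>) + 2 * (\<bar>u\<bar> * \<tau>))"
    proof cases
      case 1
      have "\<bar>c * (1 - k / n) * u\<bar> = \<bar>u\<bar> * c * (1 - k / n)"
        using c k n by (simp add: abs_mult)
      also have "\<dots> \<le> \<bar>u\<bar> * c * 1" using c n by (intro mult_left_mono) auto
      finally have "\<bar>c * (1 - k / n) * u\<bar> \<le> c * \<bar>u\<bar>" by (simp add: mult.commute)
      moreover have "a k = B k + c * (1 - k / n) * u" by (simp add: a_def B_def)
      ultimately have "\<bar>a k\<bar> \<le> (\<rho> + 2 * (c * \<rho>)) + c * \<bar>u\<bar>"
        using 1 by (simp only:) (intro order_trans[OF abs_triangle_ineq] add_mono Bk, simp_all)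
      then have "\<bar>a k\<bar> \<le> \<bar>G ks\<bar> + (4 * \<rho> + 4 * (c * \<rho>) + 2 * (\<bar>u\<bar> * \<tau>))"
        using aks Gks by linarith
      then show ?thesis using ks by (intro bexI[of _ ks]) auto
    next
      case 2
      then have "\<bar>a k\<bar> \<le> \<bar>G k\<bar> + (2 * \<rho> + \<bar>u\<bar> * \<tau>)" using late[of k] by linarith
      then show ?thesis using 2 ks \<rho> c\<rho> u\<tau> by (intro bexI[of _ k]) auto
    next
      case 3
      have "a k = 0" using 3 n by (simp add: a_def)
      then show ?thesis using ks \<rho> c\<rho> u\<tau> by (intro bexI[of _ ks]) auto
    qed
  qed (use ks in auto)
  then show ?thesis unfolding a_def q_def .
qed

text \<open>Pairs on different sides of the change point are those with \<open>i < ks \<le> j\<close> after the shift of indices to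
  \<open>0\<close>. Combined with \<open>i < k \<le> j\<close>, this is the rectangle \<open>i < min k ks\<close>, \<open>max k ks \<le> j\<close>. The function \<open>gg\<close> stands for
  the projection; its contributions add up to the tied-down walk.\<close>

lemma change_point_decomposition:
  fixes g gg :: "real \<Rightarrow> real" and y x S :: "nat \<Rightarrow> real" and k n ks :: nat
  assumes kn: "1 \<le> k" "k < n" "ks < n"
  defines "x \<equiv> \<lambda>i. y (Suc i)" and "S \<equiv> \<lambda>k. \<Sum>i<k. gg (y (Suc i))"
  shows "n * sqrt n * G0 g (\<lambda>i. if i \<le> ks then \<mu> + y i else \<mu> + \<Delta> + y i) n k
    = (n * S k - k * S n + u * real (min k ks) * real (n - max k ks))
      + (\<Sum>i<k. \<Sum>j=k..<n. g (x j - x i) - gg (x i) + gg (x j))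
      + (\<Sum>i<min k ks. \<Sum>j=max k ks..<n. g (x j - x i + \<Delta>) - g (x j - x i) - u)"
proof -
  let ?z = "\<lambda>i. if i \<le> ks then \<mu> + y i else \<mu> + \<Delta> + y i"
  let ?H = "\<lambda>i j. g (x j - x i + \<Delta>) - g (x j - x i)"
  have n: "real n > 0" using kn by simp
  have pw: "real n powr (3/2) = n * sqrt n"
  proof -
    have "real n powr (3/2) = real n powr (1 + 1/2)" by simp
    also have "\<dots> = real n powr 1 * real n powr (1/2)" by (rule powr_add)
    finally show ?thesis using n by (simp add: powr_half_sqrt)
  qed
  have inner: "(\<Sum>j=k+1..n. f j) = (\<Sum>j=k..<n. f (Suc j))" for f :: "nat \<Rightarrow> real"
  proof -
    have "{k+1..n} = Suc ` {k..<n}" by (simp add: image_Suc_atLeastLessThan atLeastLessThanSuc_atLeastAtMost)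
    then have "(\<Sum>j=k+1..n. f j) = sum f (Suc ` {k..<n})" by (simp only:)
    also have "\<dots> = (\<Sum>j=k..<n. f (Suc j))" by (subst sum.reindex) auto
    finally show ?thesis .
  qed
  have outer: "(\<Sum>i=1..k. f i) = (\<Sum>i<k. f (Suc i))" for f :: "nat \<Rightarrow> real"
    by (simp add: sum.atLeast1_atMost_eq)
  have "n * sqrt n * G0 g ?z n k = (\<Sum>i<k. \<Sum>j=k..<n. g (?z (Suc j) - ?z (Suc i)))"
    using n by (simp add: G0_def pw inner[simplified] outer[simplified])
  also have "\<dots> = (\<Sum>i<k. \<Sum>j=k..<n. g (x j - x i) + (if i < ks \<and> ks \<le> j then ?H i j else 0))"
  proof (intro sum.cong refl)
    fix i j assume "i \<in> {..<k}" "j \<in> {k..<n}"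
    then have "i < j" by simp
    then show "g (?z (Suc j) - ?z (Suc i)) = g (x j - x i) + (if i < ks \<and> ks \<le> j then ?H i j else 0)"
      by (auto simp: x_def algebra_simps not_le)
  qed
  also have "\<dots> = (\<Sum>i<k. \<Sum>j=k..<n. g (x j - x i)) + (\<Sum>i<k. \<Sum>j=k..<n. if i < ks \<and> ks \<le> j then ?H i j else 0)"
    by (simp add: sum.distrib)
  also have "(\<Sum>i<k. \<Sum>j=k..<n. if i < ks \<and> ks \<le> j then ?H i j else 0) = (\<Sum>i<min k ks. \<Sum>j=max k ks..<n. ?H i j)"
  proof (rule sum.mono_neutral_cong_right)
    fix i assume "i \<in> {..<min k ks}"
    then show "(\<Sum>j=k..<n. if i < ks \<and> ks \<le> j then ?H i j else 0) = (\<Sum>j=max k ks..<n. ?H i j)"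
      by (intro sum.mono_neutral_cong_right) auto
  qed (auto simp: min_le_iff_disj intro!: sum.neutral)
  also have "\<dots> = (\<Sum>i<min k ks. \<Sum>j=max k ks..<n. ?H i j - u) + u * real (min k ks) * real (n - max k ks)"
  proof -
    have "(\<Sum>i<min k ks. \<Sum>j=max k ks..<n. ?H i j)
        = (\<Sum>i<min k ks. \<Sum>j=max k ks..<n. ?H i j - u) + (\<Sum>i<min k ks. \<Sum>j=max k ks..<n. u)"
      unfolding sum.distrib[symmetric] by (intro sum.cong refl) simp
    also have "(\<Sum>i<min k ks. \<Sum>j=max k ks..<n. u) = u * real (min k ks) * real (n - max k ks)"
      by (simp del: of_nat_min)
    finally show ?thesis .
  qed
  also have "(\<Sum>i<k. \<Sum>j=k..<n. g (x j - x i)) = (\<Sum>i<k. \<Sum>j=k..<n. g (x j - x i) - gg (x i) + gg (x j)) + (\<Sum>i<k. \<Sum>j=k..<n. gg (x i) - gg (x j))"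
    unfolding sum.distrib[symmetric] by (intro sum.cong refl) simp
  also have "(\<Sum>i<k. \<Sum>j=k..<n. gg (x i) - gg (x j)) = n * S k - k * S n"
  proof -
    have "(\<Sum>j=k..<n. gg (x j)) = S n - S k"
    proof -
      have "S n = S k + (\<Sum>j=k..<n. gg (x j))"
        unfolding S_def x_def using kn by (simp add: lessThan_atLeast0 sum.atLeastLessThan_concat)
      then show ?thesis by simp
    qed
    moreover have "(\<Sum>i<k. gg (x i)) = S k" by (simp add: S_def x_def)
    ultimately have "(\<Sum>i<k. \<Sum>j=k..<n. gg (x i) - gg (x j)) = real (n - k) * S k - k * (S n - S k)"
      by (simp add: sum_subtractf sum_distrib_left[symmetric])
    also have "\<dots> = n * S k - k * S n" using kn by (simp add: of_nat_diff algebra_simps)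
    finally show ?thesis .
  qed
  finally show ?thesis by (simp only: add_ac)
qed


lemma change_point_scaling:
  fixes kstar :: "nat \<Rightarrow> nat" and c :: real
  assumes c: "c > 0" and lim: "(\<lambda>n. real (kstar n) / (c * sqrt (real n))) \<longlonglongrightarrow> 1"
  shows "(\<lambda>n. real (kstar n) / sqrt n) \<longlonglongrightarrow> c"
    and "(\<lambda>n. real (kstar n) / n) \<longlonglongrightarrow> 0"
    and "filterlim kstar at_top sequentially"
proof -
  have "(\<lambda>n. c * (real (kstar n) / (c * sqrt (real n)))) \<longlonglongrightarrow> c * 1" by (intro tendsto_intros lim)
  then show 1: "(\<lambda>n. real (kstar n) / sqrt n) \<longlonglongrightarrow> c" using c by simp
  have sq: "filterlim (\<lambda>n. sqrt (real n)) at_top sequentially"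
    by (rule filterlim_compose[OF sqrt_at_top filterlim_real_sequentially])
  have "(\<lambda>n. real (kstar n) / sqrt n / sqrt n) \<longlonglongrightarrow> 0"
    by (rule tendsto_divide_0[OF 1 filterlim_at_top_imp_at_infinity[OF sq]])
  then show "(\<lambda>n. real (kstar n) / n) \<longlonglongrightarrow> 0" by simp
  have "filterlim (\<lambda>n. real (kstar n) / sqrt n * sqrt n) at_top sequentially"
    by (rule filterlim_tendsto_pos_mult_at_top[OF 1 c sq])
  then have top: "filterlim (\<lambda>n. real (kstar n) / sqrt n * sqrt n) at_top sequentially" .
  show "filterlim kstar at_top sequentially"
    unfolding filterlim_at_top
  proof
    fix Z :: nat
    have "\<forall>\<^sub>F n in sequentially. real Z \<le> real (kstar n) / sqrt n * sqrt n"
      using top by (simp only: filterlim_at_top)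
    then show "\<forall>\<^sub>F n in sequentially. Z \<le> kstar n"
      using eventually_gt_at_top[of 0] by eventually_elim simp
  qed
qed

context iid_sequence begin

lemma antisymmetric_mean_zero:
  fixes g :: "real \<Rightarrow> real"
  assumes [measurable]: "g \<in> borel_measurable borel" and odd: "\<And>x. g (- x) = - g x"
  shows "(\<integral>(z, y). g (z - y) \<partial>(law \<Otimes>\<^sub>M law)) = 0"
proof -
  have m: "case_prod (\<lambda>z y. g (z - y)) \<in> borel_measurable (borel \<Otimes>\<^sub>M borel)" by measurable
  have "(\<integral>(z, y). g (z - y) \<partial>(law \<Otimes>\<^sub>M law)) = expectation (\<lambda>\<omega>. g (X 0 \<omega> - X 1 \<omega>))"
    using expectation_pair[OF m, of 0 1] by simp
  also have "\<dots> = expectation (\<lambda>\<omega>. - g (X 1 \<omega> - X 0 \<omega>))"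
    using odd[of "X _ _ - X _ _"] by (intro Bochner_Integration.integral_cong refl) (metis minus_diff_eq odd)
  also have "\<dots> = - (\<integral>(z, y). g (z - y) \<partial>(law \<Otimes>\<^sub>M law))"
    using expectation_pair[OF m, of 1 0] by simp
  finally show ?thesis by simp
qed

text \<open>Degeneracy holds almost everywhere only, because \<open>g (\<xi> - x)\<close> is integrable for almost every \<open>x\<close>.\<close>

lemma Hoeffding_projection:
  fixes g :: "real \<Rightarrow> real"
  assumes g[measurable]: "g \<in> borel_measurable borel" and odd: "\<And>x. g (- x) = - g x"
    and sq: "integrable M (\<lambda>\<omega>. (g (X 1 \<omega> - X 0 \<omega>))\<^sup>2)"
    and proj_sq: "integrable M (\<lambda>\<omega>. (g1 law g (X 0 \<omega>))\<^sup>2)"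
  shows g1_measurable: "g1 law g \<in> borel_measurable borel"
    and g1_centred: "expectation (\<lambda>\<omega>. g1 law g (X 0 \<omega>)) = 0"
    and "degenerate_kernel M X (\<lambda>x y. g (y - x) - g1 law g x + g1 law g y)"
proof -
  interpret F: prob_space law by (rule prob_space_distr) simp
  interpret FF: pair_sigma_finite law law ..
  let ?h = "g1 law g"
  have h: "?h x = (\<integral>z. g (z - x) \<partial>law)" for x
    unfolding g1_def antisymmetric_mean_zero[OF g odd] by simp
  have m: "case_prod (\<lambda>z y. g (z - y)) \<in> borel_measurable (borel \<Otimes>\<^sub>M borel)" by measurable
  show hm[measurable]: "?h \<in> borel_measurable borel"
  proof -
    have "(\<lambda>x. \<integral>z. g (z - x) \<partial>law) \<in> borel_measurable borel"
      by (rule F.borel_measurable_lebesgue_integral) measurable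
    then show ?thesis by (subst h[abs_def])
  qed
  have int: "integrable M (\<lambda>\<omega>. g (X 1 \<omega> - X 0 \<omega>))"
    by (rule square_integrable_imp_integrable[OF _ sq]) measurable
  have intP: "integrable (law \<Otimes>\<^sub>M law) (case_prod (\<lambda>z y. g (z - y)))"
    using int integrable_pair[OF m, of 1 0] by simp
  have "expectation (\<lambda>\<omega>. ?h (X 0 \<omega>)) = (\<integral>x. ?h x \<partial>law)" by (subst integral_distr) auto
  also have "\<dots> = (\<integral>x. (\<integral>z. g (z - x) \<partial>law) \<partial>law)" by (simp add: h)
  also have "\<dots> = (\<integral>(z, y). g (z - y) \<partial>(law \<Otimes>\<^sub>M law))"
    by (rule FF.integral_snd[OF intP])
  also have "\<dots> = 0" by (rule antisymmetric_mean_zero[OF g odd])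
  finally show c: "expectation (\<lambda>\<omega>. ?h (X 0 \<omega>)) = 0" .
  have hint: "integrable law ?h"
    by (subst integrable_distr_eq) (auto intro!: square_integrable_imp_integrable[OF _ proj_sq])
  have hlaw: "(\<integral>y. ?h y \<partial>law) = 0" using c by (subst integral_distr) auto
  show "degenerate_kernel M X (\<lambda>x y. g (y - x) - ?h x + ?h y)"
  proof unfold_locales
    show "(\<lambda>(x, y). g (y - x) - ?h x + ?h y) \<in> borel_measurable (borel \<Otimes>\<^sub>M borel)" by measurable
    show "g (x - y) - ?h y + ?h x = - (g (y - x) - ?h x + ?h y)" for x y
      using odd[of "y - x"] by simp
    have h1: "integrable M (\<lambda>\<omega>. (?h (X 1 \<omega>))\<^sup>2)"
      using integrable_ident[of "\<lambda>x. (?h x)\<^sup>2" 1] proj_sq by simp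
    show "integrable M (\<lambda>\<omega>. (g (X 1 \<omega> - X 0 \<omega>) - ?h (X 0 \<omega>) + ?h (X 1 \<omega>))\<^sup>2)"
    proof (rule Bochner_Integration.integrable_bound)
      show "integrable M (\<lambda>\<omega>. 3 * ((g (X 1 \<omega> - X 0 \<omega>))\<^sup>2 + (?h (X 0 \<omega>))\<^sup>2 + (?h (X 1 \<omega>))\<^sup>2))"
        using sq proj_sq h1 by simp
      have "(a - b + c)\<^sup>2 \<le> 3 * (a\<^sup>2 + b\<^sup>2 + c\<^sup>2)" for a b c :: real
        using zero_le_power2[of "a + b"] zero_le_power2[of "a - c"] zero_le_power2[of "b + c"]
        by (simp add: power2_eq_square algebra_simps)
      then show "AE \<omega> in M. norm ((g (X 1 \<omega> - X 0 \<omega>) - ?h (X 0 \<omega>) + ?h (X 1 \<omega>))\<^sup>2)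
          \<le> norm (3 * ((g (X 1 \<omega> - X 0 \<omega>))\<^sup>2 + (?h (X 0 \<omega>))\<^sup>2 + (?h (X 1 \<omega>))\<^sup>2))" by auto
    qed measurable
    have "AE x in law. integrable law (\<lambda>z. g (z - x))"
      using FF.AE_integrable_snd[OF intP] by simp
    then show "AE x in law. (\<integral>y. g (y - x) - ?h x + ?h y \<partial>law) = 0"
    proof eventually_elim
      case (elim x)
      have "F.prob UNIV = 1" using F.prob_space by simp
      with elim have "(\<integral>y. g (y - x) - ?h x + ?h y \<partial>law) = (\<integral>y. g (y - x) \<partial>law) - ?h x + (\<integral>y. ?h y \<partial>law)"
        using hint by simp
      then show ?case using hlaw by (simp add: h)
    qed
  qed
qed

end

theorem theorem2:
  fixes M :: "'a measure" and \<xi> :: "nat \<Rightarrow> 'a \<Rightarrow> real"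
    and g :: "real \<Rightarrow> real" and \<mu> \<Delta> c \<sigma> :: real and kstar :: "nat \<Rightarrow> nat"
    and N :: "'b measure" and W :: "real \<Rightarrow> 'b \<Rightarrow> real"
  assumes prob: "prob_space M"
    and indep: "prob_space.indep_vars M (\<lambda>_. borel) \<xi> {1..}"
    and ident: "\<And>i. i \<ge> 1 \<Longrightarrow> distr M borel (\<xi> i) = distr M borel (\<xi> 1)"
    and int_xi: "integrable M (\<xi> 1)"
    and mean_zero: "(\<integral>\<omega>. \<xi> 1 \<omega> \<partial>M) = 0"
    and g_meas: "g \<in> borel_measurable borel"
    and g_odd: "\<And>x. g (- x) = - g x"
    and jump: "\<Delta> \<noteq> 0"
    and c_pos: "c > 0"
    and kstar_range: "\<And>n. n \<ge> 2 \<Longrightarrow> kstar n \<in> {1..n - 1}"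
    and kstar_lim: "(\<lambda>n. real (kstar n) / (c * sqrt (real n))) \<longlonglongrightarrow> 1"
    and g_sq: "integrable M (\<lambda>\<omega>. (g (\<xi> 2 \<omega> - \<xi> 1 \<omega>))\<^sup>2)"
    and u_exists: "integrable M (\<lambda>\<omega>. g (\<xi> 2 \<omega> - \<xi> 1 \<omega> + \<Delta>) - g (\<xi> 2 \<omega> - \<xi> 1 \<omega>))"
    and h1_var: "integrable M (\<lambda>\<omega>. (h1 (distr M borel (\<xi> 1)) g \<Delta> (\<xi> 1 \<omega>)
                   - (\<integral>\<omega>'. h1 (distr M borel (\<xi> 1)) g \<Delta> (\<xi> 1 \<omega>') \<partial>M))\<^sup>2)"
    and sigma_eq: "\<sigma>\<^sup>2 = (\<integral>\<omega>. (g1 (distr M borel (\<xi> 1)) g (\<xi> 1 \<omega>))\<^sup>2 \<partial>M)"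
    and sigma_pos: "\<sigma> > 0"
    and bridge: "std_brownian_bridge N W"
  shows "weak_conv_m
           (\<lambda>n. distr M borel
              (\<lambda>\<omega>. MAX k\<in>{1..<n}. \<bar>G0 g (\<lambda>i. cp_obs \<mu> \<Delta> (kstar n) \<xi> i \<omega>) n k\<bar>))
           (distr N borel
              (\<lambda>\<omega>. SUP l\<in>{0..1}. \<bar>\<sigma> * W l \<omega> + c * (1 - l) * u_shift (distr M borel (\<xi> 1)) g \<Delta>\<bar>))"
proof -
  interpret prob_space M by (rule prob)
  define x where "x i = \<xi> (Suc i)" for i
  have xi_rv[measurable]: "\<xi> i \<in> borel_measurable M" if "i \<ge> 1" for i
    using indep that by (auto simp: indep_vars_def)
  interpret x: iid_sequence M x
  proof unfold_locales
    show "indep_vars (\<lambda>_. borel) x UNIV"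
      unfolding x_def[abs_def] by (rule indep_vars_reindex_inj[OF indep]) auto
    show "distr M borel (x i) = distr M borel (x 0)" for i
      using ident[of "Suc i"] by (simp add: x_def)
  qed
  define F where "F = distr M borel (\<xi> 1)"
  have F: "distr M borel (x 0) = F" by (simp add: F_def x_def)
  have x01: "\<xi> 1 = x 0" "\<xi> 2 = x 1" by (simp_all add: x_def numeral_2_eq_2)
  define h where "h = g1 F g"
  define u where "u = u_shift F g \<Delta>"
  define H where "H a b = g (b - a + \<Delta>) - g (b - a)" for a b
  have sigma_h: "\<sigma>\<^sup>2 = (\<integral>\<omega>. (h (x 0 \<omega>))\<^sup>2 \<partial>M)"
    using sigma_eq unfolding h_def F_def x01 .
  \<comment> \<open>Otherwise the integral \<open>\<sigma>\<^sup>2\<close> would have the default value \<open>0\<close>.\<close>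
  have proj_sq: "integrable M (\<lambda>\<omega>. (h (x 0 \<omega>))\<^sup>2)"
  proof (rule ccontr)
    assume "\<not> ?thesis"
    then have "(\<integral>\<omega>. (h (x 0 \<omega>))\<^sup>2 \<partial>M) = 0" by (rule not_integrable_integral_eq)
    then show False using sigma_h sigma_pos by simp
  qed
  have sq: "integrable M (\<lambda>\<omega>. (g (x 1 \<omega> - x 0 \<omega>))\<^sup>2)" using g_sq unfolding x01 .
  note proj = x.Hoeffding_projection[OF g_meas g_odd sq, unfolded F, folded h_def, OF proj_sq]
  have hm[measurable]: "h \<in> borel_measurable borel" by (rule proj(1))
  interpret R: degenerate_kernel M x "\<lambda>a b. g (b - a) - h a + h b" by (rule proj(3))
  interpret S: centred_iid_sequence M "\<lambda>i \<omega>. h (x i \<omega>)" \<sigma>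
  proof -
    interpret iid_sequence M "\<lambda>i \<omega>. h (x i \<omega>)" by (rule x.compose[OF hm])
    show "centred_iid_sequence M (\<lambda>i \<omega>. h (x i \<omega>)) \<sigma>"
      by unfold_locales (use proj_sq proj(2) sigma_h sigma_pos in simp_all)
  qed
  have Hm: "case_prod H \<in> borel_measurable (borel \<Otimes>\<^sub>M borel)"
    unfolding H_def using g_meas by measurable
  have Hint: "integrable M (\<lambda>\<omega>. H (x 0 \<omega>) (x 1 \<omega>))"
    using u_exists unfolding x01 H_def .
  have Hu: "expectation (\<lambda>\<omega>. H (x 0 \<omega>) (x 1 \<omega>)) = u"
  proof -
    have m: "case_prod (\<lambda>z y. g (z - y + \<Delta>) - g (z - y)) \<in> borel_measurable (borel \<Otimes>\<^sub>M borel)"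
      using g_meas by measurable
    show ?thesis using x.expectation_pair[OF m, of 1 0] by (simp add: H_def u_def u_shift_def F)
  qed
  note k1 = change_point_scaling[OF c_pos kstar_lim]
  define d where "d t = c * (1 - t) * u" for t
  have d: "continuous_on {0..1} d" unfolding d_def by (intro continuous_intros)
  \<comment> \<open>\<open>T\<close> is the statistic and \<open>A\<close> the tied-down walk with the limiting drift, to which the invariance principle applies.\<close>
  define T where "T n \<omega> = (MAX k\<in>{1..<n}. \<bar>G0 g (\<lambda>i. cp_obs \<mu> \<Delta> (kstar n) \<xi> i \<omega>) n k\<bar>)" for n \<omega>
  define A where "A n \<omega> = (MAX k\<in>{..n}. \<bar>((\<Sum>i<k. h (x i \<omega>)) - k / n * (\<Sum>i<n. h (x i \<omega>))) / sqrt n + d (k / n)\<bar>)" for n :: nat and \<omega>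
  have N: "prob_space N" using bridge by (simp add: std_brownian_bridge_def)
  have Ym: "(\<lambda>\<omega>. SUP l\<in>{0..1}. \<bar>\<sigma> * W l \<omega> + d l\<bar>) \<in> borel_measurable N" by (rule bridge_sup_limit(3)[OF bridge d])
  have Tm: "T n \<in> borel_measurable M" for n
  proof -
    have "(\<lambda>\<omega>. cp_obs \<mu> \<Delta> (kstar n) \<xi> i \<omega>) \<in> borel_measurable M" if "i \<ge> 1" for i
      using xi_rv[OF that] unfolding cp_obs_def by measurable
    then have "(\<lambda>\<omega>. g (cp_obs \<mu> \<Delta> (kstar n) \<xi> j \<omega> - cp_obs \<mu> \<Delta> (kstar n) \<xi> i \<omega>)) \<in> borel_measurable M" if "i \<ge> 1" "j \<ge> 1" for i j
      using that by (intro measurable_compose[OF _ g_meas] borel_measurable_diff)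
    then show ?thesis
      unfolding T_def[abs_def] G0_def
      by (intro borel_measurable_Max borel_measurable_abs borel_measurable_times borel_measurable_const borel_measurable_sum) auto
  qed
  have Am: "A n \<in> borel_measurable M" for n unfolding A_def[abs_def] by measurable
  have "weak_conv_m (\<lambda>n. distr M borel (T n)) (distr N borel (\<lambda>\<omega>. SUP l\<in>{0..1}. \<bar>\<sigma> * W l \<omega> + d l\<bar>))"
  proof (rule weak_conv_by_approximation[OF prob N Tm Am Ym Ym _ tendsto_const])
    show "weak_conv_m (\<lambda>n. distr M borel (A n)) (distr N borel (\<lambda>\<omega>. SUP l\<in>{0..1}. \<bar>\<sigma> * W l \<omega> + d l\<bar>))"
      unfolding A_def[abs_def] by (rule S.bridge_invariance_principle[OF bridge d])
    fix e :: real assume e: "e > 0"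
    define \<rho> where "\<rho> = e / (2 * (4 + 4 * c))"
    define \<tau> where "\<tau> = e / (4 * (\<bar>u\<bar> + 1))"
    have \<rho>: "\<rho> > 0" "(4 + 4 * c) * \<rho> = e / 2" using e c_pos by (auto simp: \<rho>_def field_simps)
    have \<tau>: "\<tau> > 0" "2 * \<bar>u\<bar> * \<tau> \<le> e / 2"
    proof -
      show \<tau>0: "\<tau> > 0" using e by (simp add: \<tau>_def)
      have "2 * \<bar>u\<bar> * \<tau> \<le> 2 * (\<bar>u\<bar> + 1) * \<tau>" using \<tau>0 by (intro mult_right_mono) auto
      also have "\<dots> = e / 2" by (simp add: \<tau>_def field_simps)
      finally show "2 * \<bar>u\<bar> * \<tau> \<le> e / 2" .
    qed
    \<comment> \<open>The exceptional events: a large cross sum, a large fluctuation of the jump kernel, a large walk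
      before the change point, a large final value of the walk. The factor
      \<open>2 * c\<close> accounts for \<open>kstar n \<le> 2 * c * sqrt n\<close>.\<close>
    define E1 where "E1 n = {\<omega>\<in>space M. \<exists>k\<le>n. \<rho> * (n * sqrt n) < \<bar>R.cross_sum n k \<omega>\<bar>}" for n
    define E2 where "E2 n = {\<omega>\<in>space M. \<exists>p\<le>kstar n. \<exists>q\<in>{kstar n..n}. \<rho> / (2 * c) * kstar n * n < \<bar>\<Sum>i<p. \<Sum>j=q..<n. H (x i \<omega>) (x j \<omega>) - u\<bar>}" for n
    define E3 where "E3 n = {\<omega>\<in>space M. \<exists>k\<le>kstar n. \<rho> * sqrt n \<le> \<bar>\<Sum>i<k. h (x i \<omega>)\<bar>}" for n
    define E4 where "E4 n = {\<omega>\<in>space M. \<rho> * n \<le> \<bar>\<Sum>i<n. h (x i \<omega>)\<bar>}" for n :: nat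
    have [measurable]: "(\<lambda>\<omega>. H (x i \<omega>) (x j \<omega>)) \<in> borel_measurable M" for i j by (rule x.measurable_pair[OF Hm])
    have Em: "E1 n \<in> events" "E2 n \<in> events" "E3 n \<in> events" "E4 n \<in> events" for n
      unfolding E1_def E2_def E3_def E4_def by measurable
    have l1: "(\<lambda>n. prob (E1 n)) \<longlonglongrightarrow> 0"
      unfolding E1_def by (rule R.cross_sums_negligible[OF \<rho>(1)])
    have ksn: "\<forall>\<^sub>F n in sequentially. 1 \<le> kstar n \<and> kstar n < n"
      using kstar_range by (intro eventually_sequentiallyI[of 2]) force
    have l2: "(\<lambda>n. prob (E2 n)) \<longlonglongrightarrow> 0"
      unfolding E2_def Hu[symmetric]
      using ksn by (intro x.uniform_two_sample_LLN Hm Hint k1(3)) (auto elim: eventually_mono simp: \<rho> c_pos)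
    have l3: "(\<lambda>n. prob (E3 n)) \<longlonglongrightarrow> 0"
      unfolding E3_def by (rule S.initial_partial_sums_negligible[OF k1(2) \<rho>(1)])
    have l4: "(\<lambda>n. prob (E4 n)) \<longlonglongrightarrow> 0"
    proof (rule tendsto_sandwich[OF _ _ tendsto_const])
      have "(\<lambda>n. \<sigma>\<^sup>2 / \<rho>\<^sup>2 / real n) \<longlonglongrightarrow> 0"
        by (intro tendsto_divide_0[OF tendsto_const] filterlim_at_top_imp_at_infinity filterlim_real_sequentially)
      then show "(\<lambda>n. \<sigma>\<^sup>2 / \<rho>\<^sup>2 / real n) \<longlonglongrightarrow> 0" .
      show "\<forall>\<^sub>F n in sequentially. prob (E4 n) \<le> \<sigma>\<^sup>2 / \<rho>\<^sup>2 / real n"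
        using eventually_gt_at_top[of 0]
      proof eventually_elim
        case (elim n)
        have "prob (E4 n) \<le> card {..<n} * \<sigma>\<^sup>2 / (\<rho> * n)\<^sup>2"
          unfolding E4_def using elim \<rho> by (intro S.sum_Chebyshev) auto
        also have "\<dots> = \<sigma>\<^sup>2 / \<rho>\<^sup>2 / real n" using elim by (simp add: power2_eq_square)
        finally show ?case .
      qed
    qed (auto intro: always_eventually)
    have "(\<lambda>n. prob (E1 n) + prob (E2 n) + prob (E3 n) + prob (E4 n)) \<longlonglongrightarrow> 0 + 0 + 0 + 0"
      by (intro tendsto_add l1 l2 l3 l4)
    then have small: "\<forall>\<^sub>F n in sequentially. prob (E1 n) + prob (E2 n) + prob (E3 n) + prob (E4 n) < e"
      by (rule order_tendstoD) (use e in simp)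
    have ev1: "\<forall>\<^sub>F n in sequentially. dist (real (kstar n) / sqrt n) c < min \<tau> c"
      using k1(1) \<tau> c_pos by (intro tendstoD) auto
    have ev2: "\<forall>\<^sub>F n in sequentially. real (kstar n) / n < \<tau> / c"
      by (rule order_tendstoD[OF k1(2)]) (use \<tau> c_pos in simp)
    have "\<forall>\<^sub>F n in sequentially. prob {\<omega>\<in>space M. e < \<bar>A n \<omega> - T n \<omega>\<bar>} \<le> e"
      using small ev1 ev2 ksn
    proof eventually_elim
      case (elim n)
      define ks where "ks = kstar n"
      have ks: "1 \<le> ks" "ks < n" using elim(4) by (auto simp: ks_def)
      have n: "real n > 0" using ks by simp
      have \<kappa>: "\<bar>real ks / sqrt n - c\<bar> \<le> \<tau>" "real ks / sqrt n \<le> 2 * c" "c * (real ks / n) \<le> \<tau>"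
      proof -
        have "\<bar>real ks / sqrt n - c\<bar> < min \<tau> c" using elim(2) by (simp add: ks_def dist_real_def)
        then show "\<bar>real ks / sqrt n - c\<bar> \<le> \<tau>" "real ks / sqrt n \<le> 2 * c" by linarith+
        have "real ks / n \<le> \<tau> / c" using elim(3) by (simp add: ks_def)
        then have "real ks / n * c \<le> \<tau>" using c_pos by (simp only: pos_le_divide_eq)
        then show "c * (real ks / n) \<le> \<tau>" by (simp only: mult.commute)
      qed
      have good: "\<bar>A n \<omega> - T n \<omega>\<bar> \<le> e" if w: "\<omega> \<in> space M" "\<omega> \<notin> E1 n" "\<omega> \<notin> E2 n" "\<omega> \<notin> E3 n" "\<omega> \<notin> E4 n" for \<omega>
      proof -
        define S where "S k = (\<Sum>i<k. h (x i \<omega>))" for k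
        define G where "G k = G0 g (\<lambda>i. cp_obs \<mu> \<Delta> ks \<xi> i \<omega>) n k" for k
        have dec: "\<bar>n * sqrt n * G k - (n * S k - k * S n + u * real (min k ks) * real (n - max k ks))\<bar> \<le> 2 * \<rho> * (n * sqrt n)"
          if k: "1 \<le> k" "k < n" for k
        proof -
          let ?R2 = "\<Sum>i<min k ks. \<Sum>j=max k ks..<n. H (x i \<omega>) (x j \<omega>) - u"
          have eq: "n * sqrt n * G k = (n * S k - k * S n + u * real (min k ks) * real (n - max k ks)) + R.cross_sum n k \<omega> + ?R2"
            using change_point_decomposition[OF k ks(2), of g \<mu> "\<lambda>i. \<xi> i \<omega>" \<Delta> h u]
            by (simp add: G_def S_def R.cross_sum_def H_def x_def cp_obs_def)
          have 1: "\<bar>R.cross_sum n k \<omega>\<bar> \<le> \<rho> * (n * sqrt n)"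
            using w(1,2) k by (auto simp: E1_def not_less)
          have "\<bar>?R2\<bar> \<le> \<rho> / (2 * c) * ks * n"
          proof (rule ccontr)
            assume "\<not> ?thesis"
            then have "\<omega> \<in> E2 n" unfolding E2_def ks_def[symmetric] using w(1) k ks
              by (auto intro!: exI[of _ "min k ks"] bexI[of _ "max k ks"])
            then show False using w(3) by simp
          qed
          also have "\<dots> \<le> \<rho> * (n * sqrt n)"
          proof -
            have "real ks \<le> 2 * c * sqrt n" using \<kappa>(2) n by (simp add: pos_divide_le_eq)
            then have "\<rho> / (2 * c) * ks * n \<le> \<rho> / (2 * c) * (2 * c * sqrt n) * n"
              using \<rho> c_pos by (intro mult_right_mono mult_left_mono) auto
            also have "\<dots> = \<rho> * (n * sqrt n)" using c_pos by simp
            finally show ?thesis .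
          qed
          finally have 2: "\<bar>?R2\<bar> \<le> \<rho> * (n * sqrt n)" .
          have "\<bar>(Z + D + R) - Z\<bar> \<le> 2 * \<rho> * b" if "\<bar>D\<bar> \<le> \<rho> * b" "\<bar>R\<bar> \<le> \<rho> * b" for Z D R b :: real
            using that by linarith
          from this[OF 1 2] show ?thesis unfolding eq .
        qed
        have "\<bar>(MAX k\<in>{1..<n}. \<bar>G k\<bar>) - (MAX k\<in>{..n}. \<bar>(S k - k / n * S n) / sqrt n + c * (1 - k / n) * u\<bar>)\<bar>
            \<le> (4 + 4 * c) * \<rho> + 2 * \<bar>u\<bar> * \<tau>"
        proof (rule change_point_max_comparison[OF ks c_pos less_imp_le[OF \<rho>(1)] _ dec _ _ \<kappa>])
          show "S 0 = 0" by (simp add: S_def)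
          show "\<bar>S k\<bar> \<le> \<rho> * sqrt n" if "k \<le> ks" for k
            using w(1,4) that by (force simp: E3_def S_def ks_def)
          show "\<bar>S n\<bar> \<le> \<rho> * n" using w(1,5) by (simp add: E4_def S_def)
        qed
        then have "\<bar>T n \<omega> - A n \<omega>\<bar> \<le> (4 + 4 * c) * \<rho> + 2 * \<bar>u\<bar> * \<tau>"
          by (simp add: T_def A_def G_def S_def d_def ks_def)
        then show ?thesis using \<rho>(2) \<tau>(2) by linarith
      qed
      have "prob {\<omega>\<in>space M. e < \<bar>A n \<omega> - T n \<omega>\<bar>} \<le> prob (E1 n \<union> E2 n \<union> E3 n \<union> E4 n)"
        using good Em by (intro finite_measure_mono) (auto simp: not_le[symmetric])
      also have "\<dots> \<le> prob (E1 n) + prob (E2 n) + prob (E3 n) + prob (E4 n)"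
        using Em by (intro order_trans[OF measure_Un_le] add_mono) auto
      finally show ?case using elim(1) by simp
    qed
    then show "\<forall>\<^sub>F L::nat in sequentially. \<forall>\<^sub>F n in sequentially. prob {\<omega>\<in>space M. e < \<bar>A n \<omega> - T n \<omega>\<bar>} \<le> e"
      by simp
  qed
  then show ?thesis
    unfolding T_def[abs_def] d_def u_def F_def .
qed

end
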